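(* On classical knots every weak parity is either zero or trivial: if $\mathcal K$ is a classical knot, $\mathfrak K$ is its category of classical diagrams, and $\psi$ is a weak parity on $\mathfrak K$, then either $\psi_D(v)=0$ for all $D\in ob(\mathfrak K)$ and all crossings $v$ of $D$, or $\psi_D(v)=1$ for all $D\in ob(\mathfrak K)$ and all crossings $v$ of $D$.
   Context: Classical knots are regarded as knots on the sphere $S^2$: a (classical) diagram is a generically immersed circle in $S^2$ with over/under information at each double point (crossing), and a classical knot is an equivalence class of diagrams modulo isotopy of diagrams and Reidemeister moves $R1,R2,R3$. The category of diagrams $\mathfrak K$ of $\mathcal K$ has as objects all classical diagrams of $\mathcal K$ and as morphisms formal compositions of elementary morphisms (isotopies of diagrams and Reidemeister moves). For a diagram $D$ let $\mathcal V(D)$ be its set of crossings. An elementary morphism $f\colon D\to D'$ induces a partial bijection $f_*\colon\mathcal V(D)\to\mathcal V(D')$ between corresponding crossings: it is a bijection for isotopies and third moves; for first and second moves it is defined on, and has as image, exactly the crossings not participating in the move. A weak parity on $\mathfrak K$ is a family of maps $\psi_D\colon\mathcal V(D)\to\mathbb Z_2=\{0,1\}$, $D\in ob(\mathfrak K)$, such that: ($\Psi0$) for every elementary morphism $f\colon D\to D'$ and every $v\in\mathcal V(D)$ not participating in the move, $\psi_D(v)=\psi_{D'}(f_*(v))$; ($\Psi2$) if $f\colon D\to D'$ is a decreasing second Reidemeister move in which $u,v\in\mathcal V(D)$ participate, then $\psi_D(u)=\psi_D(v)$; ($\Psi3$) if $f\colon D\to D'$ is a third Reidemeister move in which $u,v,w\in\mathcal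 V(D)$ participate, then $\psi_D(x)=\psi_{D'}(f_*(x))$ for $x=u,v,w$, and $\psi_D(u)+\psi_D(v)+\psi_D(w)\neq 1$ as an integer. The zero weak parity is identically $0$; the trivial weak parity is identically $1$. *)

theory Defs
  imports
    "HOL-Library.Numeral_Type"
    "HOL-Combinatorics.Permutations"
    "HOL-Combinatorics.Orbits"
begin

text \<open>
  A generically immersed circle in the oriented sphere, with over/under information, is
  recorded by its 4-valent plane graph. The four half-edges (darts) at a crossing \<open>v\<close> are
  \<open>(v, 0), (v, 1), (v, 2), (v, 3)\<close> in counterclockwise order; indices are integers modulo 4.
  Darts 0 and 2 form the underpass and darts 1 and 3 the overpass, so the labelling of a crossing
  is determined up to adding 2. The map \<open>glue\<close> matches the two darts of every edge. The simple
  closed curve without crossings is the diagram with the empty set of crossings.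
\<close>

type_synonym dart = "nat \<times> 4"

record diagram =
  crossings :: "nat set"
  glue :: "dart \<Rightarrow> dart"

definition darts :: "diagram \<Rightarrow> dart set" where
  "darts D = crossings D \<times> UNIV"

definition over :: "dart \<Rightarrow> bool" where
  "over d \<longleftrightarrow> snd d = 1 \<or> snd d = 3"

definition opposite :: "dart \<Rightarrow> dart" where
  "opposite d = (fst d, snd d + 2)"

text \<open>
  Leaving a crossing along \<open>d\<close>, the curve arrives along \<open>glue D d\<close> and goes straight on. The face
  on the left of the edge leaving along \<open>d\<close> continues with the dart that precedes \<open>glue D d\<close> in
  counterclockwise order.
\<close>

definition straight_step :: "diagram \<Rightarrow> dart \<Rightarrow> dart" where
  "straight_step D d = opposite (glue D d)"

definition face_step :: "diagram \<Rightarrow> dart \<Rightarrow> dart" where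
  "face_step D d = (fst (glue D d), snd (glue D d) - 1)"

definition edges :: "diagram \<Rightarrow> dart set set" where
  "edges D = {{d, glue D d} | d. d \<in> darts D}"

definition faces :: "diagram \<Rightarrow> dart set set" where
  "faces D = {orbit (face_step D) d | d. d \<in> darts D}"

text \<open>
  The circle is not oriented: the walk from \<open>d\<close> has to run through every overpass and underpass in
  one of its two directions. This makes the graph connected, so that Euler's formula expresses
  that the surface glued from the faces is a sphere.
\<close>

definition single_component :: "diagram \<Rightarrow> bool" where
  "single_component D \<longleftrightarrow>
     (\<forall>d\<in>darts D. \<forall>e\<in>darts D.
        \<exists>k. (straight_step D ^^ k) d = e \<or> (straight_step D ^^ k) d = opposite e)"

definition spherical :: "diagram \<Rightarrow> bool" where
  "spherical D \<longleftrightarrow> crossings D = {} \<or>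
     int (card (crossings D)) - int (card (edges D)) + int (card (faces D)) = 2"

definition classical_diagram :: "diagram \<Rightarrow> bool" where
  "classical_diagram D \<longleftrightarrow>
     finite (crossings D) \<and>
     glue D permutes darts D \<and>
     (\<forall>d\<in>darts D. glue D d \<noteq> d \<and> glue D (glue D d) = d) \<and>
     single_component D \<and>
     spherical D"

text \<open>
  Orientation-preserving homeomorphisms of the sphere are isotopic to the identity, so an isotopy
  is seen on diagrams as an isomorphism of plane graphs that respects the counterclockwise order
  and the over/under information; \<open>s\<close> is the shift of the labels at each crossing.
\<close>

definition isotopy :: "diagram \<Rightarrow> (nat \<Rightarrow> nat) \<Rightarrow> diagram \<Rightarrow> bool" where
  "isotopy D f D' \<longleftrightarrow>
     bij_betw f (crossings D) (crossings D') \<and>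
     (\<exists>s :: nat \<Rightarrow> 4. (\<forall>v\<in>crossings D. s v = 0 \<or> s v = 2) \<and>
        (let F = (\<lambda>(v, i). (f v, i + s v)) in
          \<forall>d\<in>darts D. glue D' (F d) = F (glue D d)))"

text \<open>
  \<open>straight_to S D d e\<close>: the curve leaving along the dart \<open>d\<close>, passing straight through crossings
  in \<open>S\<close>, first reaches a crossing outside \<open>S\<close> along the dart \<open>e\<close>. Hence \<open>erased S D D'\<close> says that
  \<open>D'\<close> is obtained from \<open>D\<close> by making the double points in \<open>S\<close> disappear.
\<close>

inductive straight_to :: "nat set \<Rightarrow> diagram \<Rightarrow> dart \<Rightarrow> dart \<Rightarrow> bool" for S D where
  stop: "fst (glue D d) \<notin> S \<Longrightarrow> straight_to S D d (glue D d)"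
| pass: "fst (glue D d) \<in> S \<Longrightarrow> straight_to S D (straight_step D d) e \<Longrightarrow> straight_to S D d e"

definition erased :: "nat set \<Rightarrow> diagram \<Rightarrow> diagram \<Rightarrow> bool" where
  "erased S D D' \<longleftrightarrow>
     crossings D' = crossings D - S \<and> (\<forall>d\<in>darts D'. straight_to S D d (glue D' d))"

text \<open>A decreasing first move removes a loop bounding a face with the single corner \<open>v\<close>.\<close>

definition R1_decreasing :: "diagram \<Rightarrow> nat \<Rightarrow> diagram \<Rightarrow> bool" where
  "R1_decreasing D v D' \<longleftrightarrow>
     v \<in> crossings D \<and> (\<exists>i. face_step D (v, i) = (v, i)) \<and> erased {v} D D'"

text \<open>
  A decreasing second move removes a face with the two corners \<open>u\<close> and \<open>v\<close>, one side of which
  is over at both ends (and then the other side is under at both ends).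
\<close>

definition R2_decreasing :: "diagram \<Rightarrow> nat \<Rightarrow> nat \<Rightarrow> diagram \<Rightarrow> bool" where
  "R2_decreasing D u v D' \<longleftrightarrow>
     u \<in> crossings D \<and> v \<in> crossings D \<and> u \<noteq> v \<and>
     (\<exists>i j. face_step D (u, i) = (v, j) \<and> face_step D (v, j) = (u, i) \<and>
        (over (u, i) \<longleftrightarrow> over (glue D (u, i)))) \<and>
     erased {u, v} D D'"

text \<open>
  A third move takes place at a face with three different corners, run through with the face on
  the left along the sides leaving by the darts \<open>a\<close>, \<open>b\<close>, \<open>c\<close>; one side is over at both of its
  ends, that is, the three strands lie at a top, a middle and a bottom level. The move interchanges
  on each strand the two crossings of the triangle, without changing the directions of the strands
  at these crossings. So if a side leaves \<open>u\<close> along \<open>a\<close> and arrives at \<open>v\<close> along \<open>b'\<close>, the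
  positions of \<open>opposite a\<close> and \<open>b'\<close>, and likewise those of \<open>opposite b'\<close> and \<open>a\<close>, are
  interchanged in the plane graph.
\<close>

definition triangle_swap :: "diagram \<Rightarrow> dart set \<Rightarrow> dart \<Rightarrow> dart" where
  "triangle_swap D sides d =
     (if d \<in> sides then opposite (glue D d)
      else if opposite d \<in> sides then glue D (opposite d)
      else d)"

definition R3_move :: "diagram \<Rightarrow> nat \<Rightarrow> nat \<Rightarrow> nat \<Rightarrow> diagram \<Rightarrow> bool" where
  "R3_move D u v w D' \<longleftrightarrow>
     {u, v, w} \<subseteq> crossings D \<and> u \<noteq> v \<and> v \<noteq> w \<and> u \<noteq> w \<and>
     (\<exists>a b c. fst a = u \<and> fst b = v \<and> fst c = w \<and>
        face_step D a = b \<and> face_step D b = c \<and> face_step D c = a \<and>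
        (\<exists>d\<in>{a, b, c}. over d \<and> over (glue D d)) \<and>
        (let sides = {a, b, c} \<union> glue D ` {a, b, c}; P = triangle_swap D sides in
          crossings D' = crossings D \<and> glue D' = P \<circ> glue D \<circ> P))"

text \<open>
  Labels of crossings not affected by a move are kept, as in the move of a picture inside a disc;
  arbitrary relabellings are isotopies.
\<close>

datatype move =
    Isotopy "nat \<Rightarrow> nat"
  | R1_dec nat
  | R1_inc nat
  | R2_dec nat nat
  | R2_inc nat nat
  | R3 nat nat nat

fun realizes :: "move \<Rightarrow> diagram \<Rightarrow> diagram \<Rightarrow> bool" where
  "realizes (Isotopy f) D D' \<longleftrightarrow> isotopy D f D'"
| "realizes (R1_dec v) D D' \<longleftrightarrow> R1_decreasing D v D'"
| "realizes (R1_inc v) D D' \<longleftrightarrow> R1_decreasing D' v D"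
| "realizes (R2_dec u v) D D' \<longleftrightarrow> R2_decreasing D u v D'"
| "realizes (R2_inc u v) D D' \<longleftrightarrow> R2_decreasing D' u v D"
| "realizes (R3 u v w) D D' \<longleftrightarrow> R3_move D u v w D'"

definition elementary_morphism :: "move \<Rightarrow> diagram \<Rightarrow> diagram \<Rightarrow> bool" where
  "elementary_morphism m D D' \<longleftrightarrow>
     classical_diagram D \<and> classical_diagram D' \<and> realizes m D D'"

fun participants :: "move \<Rightarrow> nat set" where
  "participants (Isotopy f) = {}"
| "participants (R1_dec v) = {v}"
| "participants (R1_inc v) = {v}"
| "participants (R2_dec u v) = {u, v}"
| "participants (R2_inc u v) = {u, v}"
| "participants (R3 u v w) = {u, v, w}"

text \<open>
  The partial bijection of crossings induced by an elementary morphism with source \<open>D\<close>. In an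
  increasing move the participating crossings do not belong to \<open>D\<close>.
\<close>

fun induced :: "move \<Rightarrow> diagram \<Rightarrow> nat \<rightharpoonup> nat" where
  "induced (Isotopy f) D = (Some \<circ> f) |` crossings D"
| "induced (R1_dec v) D = Some |` (crossings D - {v})"
| "induced (R1_inc v) D = Some |` crossings D"
| "induced (R2_dec u v) D = Some |` (crossings D - {u, v})"
| "induced (R2_inc u v) D = Some |` crossings D"
| "induced (R3 u v w) D = Some |` crossings D"

text \<open>
  Morphisms of the category of diagrams are formal compositions, here lists of elementary
  morphisms together with their targets.
\<close>

inductive diagram_morphism :: "diagram \<Rightarrow> (move \<times> diagram) list \<Rightarrow> diagram \<Rightarrow> bool" where
  Nil: "classical_diagram D \<Longrightarrow> diagram_morphism D [] D"
| Cons: "elementary_morphism m D D' \<Longrightarrow> diagram_morphism D' ms D'' \<Longrightarrow>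
    diagram_morphism D ((m, D') # ms) D''"

definition knot_equivalence :: "(diagram \<times> diagram) set" where
  "knot_equivalence = {(D, D'). \<exists>ms. diagram_morphism D ms D'}"

text \<open>A classical knot is represented by the set of objects of its category of diagrams.\<close>

definition classical_knots :: "diagram set set" where
  "classical_knots = Collect classical_diagram // knot_equivalence"

definition weak_parity :: "diagram set \<Rightarrow> (diagram \<Rightarrow> nat \<Rightarrow> int) \<Rightarrow> bool" where
  "weak_parity K \<psi> \<longleftrightarrow>
     (\<forall>D\<in>K. \<forall>v\<in>crossings D. \<psi> D v \<in> {0, 1}) \<and>
     \<comment> \<open>\<open>(\<Psi>0)\<close>\<close>
     (\<forall>D\<in>K. \<forall>D'\<in>K. \<forall>m. elementary_morphism m D D' \<longrightarrow>
        (\<forall>v\<in>crossings D - participants m. \<psi> D v = \<psi> D' (the (induced m D v)))) \<and>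
     \<comment> \<open>\<open>(\<Psi>2)\<close>\<close>
     (\<forall>D\<in>K. \<forall>D'\<in>K. \<forall>u v. elementary_morphism (R2_dec u v) D D' \<longrightarrow> \<psi> D u = \<psi> D v) \<and>
     \<comment> \<open>\<open>(\<Psi>3)\<close>\<close>
     (\<forall>D\<in>K. \<forall>D'\<in>K. \<forall>u v w. elementary_morphism (R3 u v w) D D' \<longrightarrow>
        (\<forall>x\<in>{u, v, w}. \<psi> D x = \<psi> D' (the (induced (R3 u v w) D x))) \<and>
        \<psi> D u + \<psi> D v + \<psi> D w \<noteq> 1)"

end

(*
Let v be a crossing of D with parity 0. After a curl at v, increasing second moves and third moves
let the overpass of v run, over everything else, around a growing tree of crossings of D. Whenever
this contour is slid over a crossing w, the third move shows that h + r + psi(w) is not 1, where h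
and r are the parities of the new crossings with the two strands at w; h and r agree on the two
sides of w. Once the tree contains all crossings, every edge outside the tree is crossed twice by
the contour, and by Euler's formula some two of these crossings bound a bigon. They have equal
parities, and a decreasing second move removes them; this is repeated until one edge at v is left.
So the parity of the crossing with the contour is constant along the knot, hence equal to
psi(v) = 0, and psi(w) is not 1 for every w. Therefore psi is constant on each diagram, and the
moves carry the constant from one diagram to the next.
*)
theory Submission
  imports Defs
begin

text \<open>The numbers decide the construction. A contour around one crossing meets four darts, and
  each new leaf of the tree trades one of them for three, so a contour around all V crossings meets
  2 V + 2. Dually it is a polygon whose sides are glued in pairs, with the F = V + 2 faces of the
  diagram as vertices; fewer than two corners per vertex force two places where neighbouring sides
  are glued. Two are wanted, because one may involve the base edge, that of the dart
  \<open>x0\<close>, where the contour joins the overpass of v and which is therefore kept to the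
  end.

  The obstacle is that diagrams are bare permutations: every move has to be shown to keep one
  component and Euler's formula, and a second move keeps the latter only if it cuts a face in two.
  This is the condition on \<open>turn Q 3\<close> and \<open>P\<close>, to be verified at each use.

  The other gap is the diagram without crossings. It has no parity that could transport the
  constant, so the one-crossing diagrams next to it, which all have one parity, stand in for
  it.\<close>

section \<open>Quarter turns of darts\<close>

definition turn :: "dart \<Rightarrow> 4 \<Rightarrow> dart" where
  "turn d n = (fst d, snd d + n)"

lemma fst_turn [simp]: "fst (turn d n) = fst d"
  by (simp add: turn_def)

lemma turn_turn [simp]: "turn (turn d m) n = turn d (m + n)"
  by (simp add: turn_def add.assoc)

lemma turn_0 [simp]: "turn d 0 = d"
  by (simp add: turn_def)

lemma turn_wrap [simp]: "turn d 4 = d" "turn d 5 = turn d 1" "turn d 6 = turn d 2"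
proof -
  have "(4::4) = 0" "(5::4) = 1" "(6::4) = 2" by simp_all
  then show "turn d 4 = d" "turn d 5 = turn d 1" "turn d 6 = turn d 2" by (simp_all only: turn_0)
qed

lemma turn_eq_turn_iff [simp]: "turn d m = turn d n \<longleftrightarrow> m = n"
  by (simp add: turn_def)

lemma turn_inject: "turn d n = turn e n \<longleftrightarrow> d = e"
  by (auto simp: turn_def prod_eq_iff)

lemma turn_3_eq_iff: "turn d 3 = e \<longleftrightarrow> d = turn e 1"
proof
  assume "turn d 3 = e"
  then have "turn (turn d 3) 1 = turn e 1" by simp
  then show "d = turn e 1" by simp
qed simp

lemma turn_eq_self_iff [simp]: "turn d m = d \<longleftrightarrow> m = 0" "d = turn d m \<longleftrightarrow> m = 0"
  by (auto simp: turn_def prod_eq_iff)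

lemma four_cases: "i = (0::4) \<or> i = 1 \<or> i = 2 \<or> i = 3"
proof (cases i)
  case (of_int z)
  then have "z = 0 \<or> z = 1 \<or> z = 2 \<or> z = 3" by auto
  with of_int show ?thesis by auto
qed

lemma opposite_turn: "opposite d = turn d 2"
  by (simp add: opposite_def turn_def)

lemma face_step_turn: "face_step D d = turn (glue D d) 3"
proof -
  have "(-1::4) = 3" by simp
  then have "i - 1 = i + 3" for i :: 4 by (metis uminus_add_conv_diff add.commute)
  then show ?thesis by (simp add: face_step_def turn_def)
qed

lemma straight_step_turn: "straight_step D d = turn (glue D d) 2"
  by (simp add: straight_step_def opposite_turn)

lemma same_crossing_turn:
  assumes "fst d = fst e"
  shows "d = e \<or> d = turn e 1 \<or> d = turn e 2 \<or> d = turn e 3"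
proof -
  have "d = turn e (snd d - snd e)" using assms by (simp add: turn_def prod_eq_iff)
  with four_cases[of "snd d - snd e"] show ?thesis by (metis turn_0)
qed

lemma turn_in_darts [simp]: "turn d n \<in> darts D \<longleftrightarrow> d \<in> darts D"
  by (simp add: darts_def mem_Times_iff)

lemma in_darts_iff: "d \<in> darts D \<longleftrightarrow> fst d \<in> crossings D"
  by (simp add: darts_def mem_Times_iff)

section \<open>Counting orbits\<close>

lemma orbit_three_cycle:
  assumes "f x = y" "f y = z" "f z = x"
  shows "card (orbit f ` {x, y, z}) = 1"
proof -
  have "y \<in> orbit f x" "z \<in> orbit f y" "x \<in> orbit f z"
    using assms orbit.base[of f] by metis+
  then have "orbit f x = orbit f y" "orbit f z = orbit f y"
    by (meson orbit_trans subset_antisym subsetI)+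
  then show ?thesis by simp
qed

lemma orbit_closed_subset:
  assumes "f ` S \<subseteq> S" "x \<in> S"
  shows "orbit f x \<subseteq> S"
proof
  fix y assume "y \<in> orbit f x"
  then show "y \<in> S" by induction (use assms in auto)
qed

text \<open>\<open>orbit f x\<close> starts with \<open>f x\<close>, so \<open>x\<close> belongs to
  it only if it is periodic. Extending \<open>f\<close> by the identity outside \<open>X\<close>
  gives a permutation of a finite set, and there every point is periodic.\<close>

lemma finite_inj_self_in_orbit:
  assumes "finite X" "inj_on f X" "f ` X \<subseteq> X" "x \<in> X"
  shows "x \<in> orbit f x"
proof -
  define g where "g = (\<lambda>d. if d \<in> X then f d else d)"
  have "bij_betw f X X"
    using assms by (simp add: bij_betw_def endo_inj_surj)
  then have "bij_betw g X X"
    by (subst bij_betw_cong[of X g f]) (auto simp: g_def)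
  then have "g permutes X"
    by (rule bij_imp_permutes) (simp add: g_def)
  then have "x \<in> orbit g x"
    using assms(1) by (metis permutation_permutes permutation_self_in_orbit)
  moreover have "orbit g x = orbit f x"
    by (rule orbit_cong0[OF \<open>x \<in> X\<close>]) (use assms in \<open>auto simp: g_def\<close>)
  ultimately show ?thesis by simp
qed

lemma orbit_eq_iff:
  assumes "finite X" "inj_on f X" "f ` X \<subseteq> X" "x \<in> X" "y \<in> X"
  shows "orbit f x = orbit f y \<longleftrightarrow> y \<in> orbit f x"
proof
  show "y \<in> orbit f x" if "orbit f x = orbit f y"
    using finite_inj_self_in_orbit[OF assms(1-3,5)] that by simp
next
  assume y: "y \<in> orbit f x"
  have "x \<in> orbit f x" using finite_inj_self_in_orbit[OF assms(1-4)] .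
  then show "orbit f x = orbit f y"
    using y by (metis orbit_swap orbit_trans subset_antisym subsetI)
qed

text \<open>Choosing a preimage makes \<open>F\<close> a function of \<open>G\<close>.\<close>

lemma card_image_le_if_finer:
  assumes "finite Y" "\<And>x y. x \<in> Y \<Longrightarrow> y \<in> Y \<Longrightarrow> G x = G y \<Longrightarrow> F x = F y"
  shows "card (F ` Y) \<le> card (G ` Y)"
proof -
  define h where "h = (\<lambda>z. F (SOME x. x \<in> Y \<and> G x = z))"
  have h: "h (G x) = F x" if "x \<in> Y" for x
  proof -
    have "\<exists>x'. x' \<in> Y \<and> G x' = G x" using that by blast
    from someI_ex[OF this] show ?thesis unfolding h_def using assms(2) that by blast
  qed
  then have "F ` Y = h ` G ` Y" by (auto simp: image_iff)
  then show ?thesis using assms(1) by (metis card_image_le finite_imageI)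
qed

text \<open>
  \<open>\<pi>\<close> sends a point to the last point of \<open>Y\<close> before it on its orbit, so that \<open>g\<close> is the first
  return map of \<open>f\<close> to \<open>Y\<close>.
\<close>

lemma card_orbits_first_return:
  assumes "finite X" "inj_on f X" "f ` X \<subseteq> X"
    and "inj_on g Y" "g ` Y \<subseteq> Y" "Y \<subseteq> X"
    and \<pi>_Y: "\<And>y. y \<in> Y \<Longrightarrow> \<pi> y = y"
    and \<pi>_step: "\<And>z. z \<in> X \<Longrightarrow> \<pi> (f z) = \<pi> z \<or> \<pi> (f z) = g (\<pi> z)"
    and \<pi>_X: "\<And>z. z \<in> X \<Longrightarrow> \<pi> z \<in> Y \<and> z \<in> orbit f (\<pi> z)"
    and g_orbit: "\<And>y. y \<in> Y \<Longrightarrow> g y \<in> orbit f y"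
  shows "card (orbit f ` X) = card (orbit g ` Y)"
proof -
  note f = assms(1-3)
  have finY: "finite Y" using assms by (meson finite_subset)
  note g = finY assms(4,5)
  have "orbit f z = orbit f (\<pi> z)" if "z \<in> X" for z
    using orbit_eq_iff[OF f, of "\<pi> z" z] \<pi>_X[OF that] that assms(6) by auto
  then have "orbit f ` X \<subseteq> orbit f ` Y"
    using \<pi>_X by blast
  then have "orbit f ` X = orbit f ` Y"
    using assms(6) by blast
  moreover have "orbit f x = orbit f y \<longleftrightarrow> orbit g x = orbit g y" if xy: "x \<in> Y" "y \<in> Y" for x y
  proof -
    have "y \<in> orbit g x" if "y \<in> orbit f x"
    proof -
      \<comment> \<open>The points whose last visit to \<open>Y\<close> lies on the
        \<open>g\<close>-cycle of \<open>x\<close> form an \<open>f\<close>-closed set, so the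
        \<open>f\<close>-orbit of \<open>x\<close> cannot leave it.\<close>
      have "f ` {z\<in>X. \<pi> z \<in> orbit g x} \<subseteq> {z\<in>X. \<pi> z \<in> orbit g x}"
      proof
        fix s assume "s \<in> f ` {z\<in>X. \<pi> z \<in> orbit g x}"
        then obtain z where z: "s = f z" "z \<in> X" "\<pi> z \<in> orbit g x" by blast
        then have "\<pi> s \<in> orbit g x"
          using \<pi>_step[OF z(2)] orbit.step[OF z(3)] by metis
        then show "s \<in> {z\<in>X. \<pi> z \<in> orbit g x}" using z assms(3) by blast
      qed
      moreover have "x \<in> {z\<in>X. \<pi> z \<in> orbit g x}"
        using xy \<pi>_Y assms(6) finite_inj_self_in_orbit[OF g xy(1)] by auto
      ultimately have "y \<in> {z\<in>X. \<pi> z \<in> orbit g x}"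
        using orbit_closed_subset[of f "{z\<in>X. \<pi> z \<in> orbit g x}" x] that by fast
      then show ?thesis using \<pi>_Y xy by simp
    qed
    moreover have "y \<in> orbit f x" if "y \<in> orbit g x"
      using that
    proof (induction)
      case base show ?case using g_orbit xy by blast
    next
      case (step z)
      have "z \<in> Y" using step(1) orbit_closed_subset[OF assms(5) xy(1)] by blast
      then show ?case using step.IH g_orbit orbit_trans by metis
    qed
    ultimately show ?thesis
      using orbit_eq_iff[OF f, of x y] orbit_eq_iff[OF g, of x y] xy assms(6) by blast
  qed
  ultimately show ?thesis
    using card_image_le_if_finer[OF finY, of "orbit f" "orbit g"]
      card_image_le_if_finer[OF finY, of "orbit g" "orbit f"] by simp
qed

lemma card_orbits_Un:
  assumes "finite X" "f ` X \<subseteq> X" "finite Z" "f ` Z \<subseteq> Z" "X \<inter> Z = {}"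
  shows "card (orbit f ` (X \<union> Z)) = card (orbit f ` X) + card (orbit f ` Z)"
proof -
  have "orbit f x \<noteq> orbit f z" if "x \<in> X" "z \<in> Z" for x z
    using that orbit_closed_subset[OF assms(2), of x] orbit_closed_subset[OF assms(4), of z]
      assms(5) orbit_nonempty[of f x] by blast
  then have "orbit f ` X \<inter> orbit f ` Z = {}" by blast
  then show ?thesis
    by (simp add: image_Un card_Un_disjoint assms)
qed

text \<open>\<open>f\<close> is \<open>g\<close> composed with the transposition of \<open>x\<close>
  and \<open>y\<close>. As these lie on different cycles, the two cycles are spliced into one and no
  other cycle changes.\<close>

lemma card_orbits_merge:
  assumes "finite Y" "inj_on g Y" "g ` Y \<subseteq> Y" "x \<in> Y" "y \<in> Y" "y \<notin> orbit g x"
    and f: "f x = g y" "f y = g x" "\<And>z. z \<in> Y \<Longrightarrow> z \<noteq> x \<Longrightarrow> z \<noteq> y \<Longrightarrow> f z = g z"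
  shows "card (orbit g ` Y) = card (orbit f ` Y) + 1"
proof -
  note g = assms(1-3)
  have "x \<noteq> y" using finite_inj_self_in_orbit[OF g assms(4)] assms(6) by blast
  have x_orb: "x \<in> orbit g x" and y_orb: "y \<in> orbit g y"
    using finite_inj_self_in_orbit[OF g] assms by auto
  have x_notin: "x \<notin> orbit g y"
    using assms(6) orbit_eq_iff[OF g] assms(4,5) y_orb by blast
  let ?U = "orbit g x \<union> orbit g y"
  have subY: "orbit g z \<subseteq> Y" if "z \<in> Y" for z
    using orbit_closed_subset[OF g(3) that] .
  have closed_U: "f ` ?U \<subseteq> ?U"
  proof -
    have "f z \<in> ?U" if "z \<in> ?U" for z
    proof -
      have "z \<in> Y" using that subY assms by blast
      show ?thesis
      proof (cases "z = x \<or> z = y")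
        case True then show ?thesis using f by (auto intro: orbit.base)
      next
        case False then show ?thesis using f(3)[OF \<open>z \<in> Y\<close>] that by (auto intro: orbit.step)
      qed
    qed
    then show ?thesis by blast
  qed
  have one_orbit: "orbit f z = ?U" if "z \<in> {x, y}" for z
  proof -
    \<comment> \<open>From \<open>a\<close>, the map \<open>f\<close> enters the
      \<open>g\<close>-cycle of \<open>b\<close>, runs through it up to \<open>b\<close>, and
      crosses back because \<open>f b = g a\<close>. The roles of \<open>x\<close> and
      \<open>y\<close> are symmetric.\<close>
    have half: "orbit g b \<subseteq> orbit f a \<and> orbit g a \<subseteq> orbit f a"
      if ab: "a = x \<and> b = y \<or> a = y \<and> b = x" for a b
    proof -
      have 1: "f a = g b" "f b = g a" using ab f by auto
      have b: "b \<in> orbit f a" and sub: "orbit g b \<subseteq> orbit f a"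
      proof -
        show "orbit g b \<subseteq> orbit f a"
        proof
          fix s assume "s \<in> orbit g b"
          then show "s \<in> orbit f a"
          proof (induction)
            case base then show ?case using 1 by (metis orbit.base)
          next
            case (step s)
            have "s \<noteq> a" using step(1) ab assms(6) x_notin by auto
            have "s \<in> Y" using step(1) subY ab assms by blast
            show ?case
            proof (cases "s = b")
              case True then show ?thesis using 1 by (metis orbit.base)
            next
              case False
              then have "f s = g s" using f(3) \<open>s \<in> Y\<close> \<open>s \<noteq> a\<close> ab by blast
              then show ?thesis using step.IH by (metis orbit.step)
            qed
          qed
        qed
        then show "b \<in> orbit f a" using x_orb y_orb ab by blast
      qed
      moreover have "orbit g a \<subseteq> orbit f a"
      proof
        fix s assume "s \<in> orbit g a"
        then show "s \<in> orbit f a"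
        proof (induction)
          case base then show ?case using 1 b by (metis orbit.step)
        next
          case (step s)
          have "s \<noteq> b" using step(1) ab assms(6) x_notin by auto
          have "s \<in> Y" using step(1) subY ab assms by blast
          show ?case
          proof (cases "s = a")
            case True then show ?thesis using 1 b by (metis orbit.step)
          next
            case False
            then have "f s = g s" using f(3) \<open>s \<in> Y\<close> \<open>s \<noteq> b\<close> ab by blast
            then show ?thesis using step.IH by (metis orbit.step)
          qed
        qed
      qed
      ultimately show ?thesis by blast
    qed
    have "?U \<subseteq> orbit f z" using half[of x y] half[of y x] that by blast
    moreover have "orbit f z \<subseteq> ?U"
      using orbit_closed_subset[OF closed_U] that x_orb y_orb by blast
    ultimately show ?thesis by blast
  qed
  let ?R = "Y - ?U"
  have g_R: "g w \<in> ?R" if "w \<in> ?R" for w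
  proof -
    have "g w \<notin> orbit g v" if "v \<in> {x, y}" for v
    proof
      assume gw: "g w \<in> orbit g v"
      have "w \<in> Y" "v \<in> Y" "g w \<in> Y" using \<open>w \<in> ?R\<close> that assms by auto
      have "orbit g w = orbit g (g w)" "orbit g v = orbit g (g w)"
        using orbit_eq_iff[OF g] \<open>w \<in> Y\<close> \<open>v \<in> Y\<close> \<open>g w \<in> Y\<close> gw by (blast intro: orbit.base)+
      then have "w \<in> orbit g v" using finite_inj_self_in_orbit[OF g \<open>w \<in> Y\<close>] by simp
      then show False using \<open>w \<in> ?R\<close> that by blast
    qed
    then show ?thesis using that g(3) by blast
  qed
  have other: "orbit f z = orbit g z" if "z \<in> ?R" for z
  proof (rule orbit_cong0[OF that, symmetric])
    show "g \<in> ?R \<rightarrow> ?R" using g_R by blast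
    show "g w = f w" if "w \<in> ?R" for w
    proof -
      have "w \<noteq> x" "w \<noteq> y" "w \<in> Y" using that x_orb y_orb by blast+
      then show ?thesis using f(3) by simp
    qed
  qed
  have in_U: "orbit g z \<in> {orbit g x, orbit g y}" if "z \<in> ?U" for z
  proof -
    have "z \<in> Y" using that subY assms(4,5) by blast
    then have "orbit g x = orbit g z \<or> orbit g y = orbit g z"
      using that orbit_eq_iff[OF g assms(4)] orbit_eq_iff[OF g assms(5)] by auto
    then show ?thesis by auto
  qed
  have in_U': "orbit f z = ?U" if z: "z \<in> ?U" for z
  proof -
    have "z \<in> orbit f x" using one_orbit z by blast
    moreover have "x \<in> orbit f x" using one_orbit x_orb by blast
    ultimately have "orbit f x = orbit f z"
      by (metis orbit_swap orbit_trans subset_antisym subsetI)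
    then show ?thesis using one_orbit by blast
  qed
  have Y: "Y = ?R \<union> ?U" using subY[OF assms(4)] subY[OF assms(5)] by blast
  have "orbit g ` Y = orbit g ` ?R \<union> {orbit g x, orbit g y}"
  proof -
    have "orbit g ` ?U \<subseteq> {orbit g x, orbit g y}" using in_U by blast
    then have "orbit g ` ?U = {orbit g x, orbit g y}" using x_orb y_orb by fast
    then show ?thesis using Y by (metis image_Un)
  qed
  moreover have "orbit f ` Y = orbit g ` ?R \<union> {?U}"
  proof -
    have "orbit f ` ?U \<subseteq> {?U}" using in_U' by blast
    then have "orbit f ` ?U = {?U}" using x_orb by fast
    moreover have "orbit f ` ?R = orbit g ` ?R" using other by (rule image_cong[OF refl])
    ultimately show ?thesis using Y by (metis image_Un)
  qed
  moreover have "orbit g ` ?R \<inter> {orbit g x, orbit g y, ?U} = {}"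
  proof -
    have "z \<in> orbit g z" if "z \<in> ?R" for z
      using finite_inj_self_in_orbit[OF g] that by blast
    then have "orbit g z \<noteq> orbit g x \<and> orbit g z \<noteq> orbit g y \<and> orbit g z \<noteq> ?U" if "z \<in> ?R" for z
      using that by blast
    then show ?thesis by blast
  qed
  moreover have "orbit g x \<noteq> orbit g y" using assms(6) y_orb by blast
  moreover have "finite (orbit g ` ?R)" using assms(1) by simp
  ultimately show ?thesis by (simp add: card_Un_disjoint)
qed

lemma even_card_involution:
  assumes "finite S" "\<And>s. s \<in> S \<Longrightarrow> f s \<in> S \<and> f (f s) = s \<and> f s \<noteq> s"
  shows "even (card S)"
  using assms
proof (induction "card S" arbitrary: S rule: less_induct)
  case less
  show ?case
  proof (cases "S = {}")
    case False
    then obtain s where s: "s \<in> S" by blast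
    have fs: "f s \<in> S" "f s \<noteq> s" "f (f s) = s" using less.prems(2) s by auto
    have "card (S - {s, f s}) = card S - 2" "card S \<ge> 2"
      using s fs less.prems(1) card_mono[of S "{s, f s}"] by (auto simp: card_Diff_subset)
    moreover have "even (card (S - {s, f s}))"
    proof (rule less.hyps)
      show "card (S - {s, f s}) < card S" using calculation by linarith
      show "finite (S - {s, f s})" using less.prems(1) by simp
      show "f z \<in> S - {s, f s} \<and> f (f z) = z \<and> f z \<noteq> z" if "z \<in> S - {s, f s}" for z
        using that less.prems(2) fs(3) by (metis DiffD1 DiffD2 DiffI insert_iff singletonD)
    qed
    ultimately show ?thesis by presburger
  qed simp
qed

section \<open>Classical diagrams\<close>

text \<open>The part of \<open>classical_diagram\<close> that concerns the gluing alone. It is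
  checked directly for each modified diagram, while connectivity and the number of faces are
  transported.\<close>

definition involutive :: "diagram \<Rightarrow> bool" where
  "involutive D \<longleftrightarrow> finite (crossings D) \<and> glue D permutes darts D \<and>
     (\<forall>d\<in>darts D. glue D d \<noteq> d \<and> glue D (glue D d) = d)"

text \<open>\<open>single_component\<close> in the form of an induction principle: it speaks of sets
  closed under going to the other end of an edge and straight through a crossing, not of powers of a
  step, and so passes easily from one diagram to another.\<close>

definition connected_diagram :: "diagram \<Rightarrow> bool" where
  "connected_diagram D \<longleftrightarrow>
     (\<forall>S \<subseteq> darts D. S \<noteq> {} \<longrightarrow> glue D ` S \<subseteq> S \<longrightarrow> (\<forall>d\<in>S. turn d 2 \<in> S) \<longrightarrow> S = darts D)"

lemma connected_diagramD:
  assumes "connected_diagram D" "S \<subseteq> darts D" "d \<in> S"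
    and "\<And>d. d \<in> S \<Longrightarrow> glue D d \<in> S" "\<And>d. d \<in> S \<Longrightarrow> turn d 2 \<in> S"
  shows "S = darts D"
  using assms unfolding connected_diagram_def by blast

context
  fixes D :: diagram
  assumes inv: "involutive D"
begin

lemma involutive_finite: "finite (crossings D)" "finite (darts D)"
  using inv by (simp_all add: involutive_def darts_def)

lemma glue_in [simp]: "glue D d \<in> darts D \<longleftrightarrow> d \<in> darts D"
  using inv by (simp add: involutive_def permutes_in_image)

lemma glue_glue [simp]: "glue D (glue D d) = d"
  using inv unfolding involutive_def by (metis permutes_not_in)

lemma glue_neq: "d \<in> darts D \<Longrightarrow> glue D d \<noteq> d"
  using inv by (simp add: involutive_def)

lemma glue_outside: "d \<notin> darts D \<Longrightarrow> glue D d = d"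
  using inv unfolding involutive_def by (metis permutes_not_in)

lemma glue_eq_iff: "glue D d = e \<longleftrightarrow> d = glue D e"
  by (metis glue_glue)

lemma glue_inject: "glue D d = glue D e \<longleftrightarrow> d = e"
  by (metis glue_glue)

lemma face_step_in [simp]: "face_step D d \<in> darts D \<longleftrightarrow> d \<in> darts D"
  by (simp add: face_step_turn)

lemma inj_face_step: "inj_on (face_step D) X"
  by (rule inj_onI) (simp add: face_step_turn turn_inject glue_inject)

lemma face_step_image: "face_step D ` darts D \<subseteq> darts D"
  by auto

lemma faces_eq: "faces D = orbit (face_step D) ` darts D"
  by (auto simp: faces_def)

lemma card_darts: "card (darts D) = 4 * card (crossings D)"
  by (simp add: darts_def card_cartesian_product)

lemma card_edges: "card (edges D) = 2 * card (crossings D)"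
proof -
  have eq: "edges D = (\<lambda>d. {d, glue D d}) ` darts D"
    by (auto simp: edges_def)
  have "card (darts D) = (\<Sum>e\<in>edges D. card e)"
  proof (subst card_Union_disjoint[symmetric])
    have "{d, glue D d} = {e, glue D e}" if "{d, glue D d} \<inter> {e, glue D e} \<noteq> {}" for d e
    proof -
      have "d = e \<or> d = glue D e \<or> glue D d = e \<or> glue D d = glue D e"
        using that by blast
      then have "d = e \<or> d = glue D e" by (metis glue_glue)
      then show ?thesis by auto
    qed
    then show "pairwise disjnt (edges D)"
      unfolding eq pairwise_def disjnt_def by blast
    show "card (darts D) = card (\<Union> (edges D))"
      unfolding eq by (rule arg_cong[of _ _ card]) auto
  qed (auto simp: eq)
  also have "\<dots> = (\<Sum>e\<in>edges D. 2)"
    by (rule sum.cong) (auto simp: eq card_insert_if glue_neq[symmetric] glue_neq)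
  finally show ?thesis using card_darts by simp
qed

text \<open>A crossing has four darts and an edge two, so E = 2 V and Euler's formula reads F = V +
  2.\<close>

lemma spherical_iff:
  "spherical D \<longleftrightarrow> crossings D = {} \<or> card (orbit (face_step D) ` darts D) = card (crossings D) + 2"
  by (auto simp: spherical_def card_edges faces_eq)

lemma single_component_iff: "single_component D \<longleftrightarrow> connected_diagram D"
proof
  assume sc: "single_component D"
  show "connected_diagram D"
    unfolding connected_diagram_def
  proof (intro allI impI)
    fix S assume S: "S \<subseteq> darts D" "S \<noteq> {}" "glue D ` S \<subseteq> S" "\<forall>d\<in>S. turn d 2 \<in> S"
    then obtain d where d: "d \<in> S" by blast
    have walk: "(straight_step D ^^ k) d \<in> S" for k
      by (induction k) (use S d in \<open>auto simp: straight_step_turn\<close>)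
    have "e \<in> S" if "e \<in> darts D" for e
    proof -
      obtain k where "(straight_step D ^^ k) d = e \<or> (straight_step D ^^ k) d = opposite e"
        using sc S(1) d \<open>e \<in> darts D\<close> unfolding single_component_def by blast
      then have "e \<in> S \<or> turn e 2 \<in> S" using walk[of k] by (auto simp: opposite_turn)
      then show ?thesis
      proof
        assume "turn e 2 \<in> S"
        then have "turn (turn e 2) 2 \<in> S" using S(4) by blast
        then show ?thesis by simp
      qed
    qed
    then show "S = darts D" using S(1) by blast
  qed
next
  assume conn: "connected_diagram D"
  show "single_component D"
    unfolding single_component_def
  proof (intro ballI)
    fix d e assume d: "d \<in> darts D" and e: "e \<in> darts D"
    let ?f = "straight_step D"
    have inj: "inj_on ?f (darts D)"
      by (rule inj_onI) (simp add: straight_step_turn turn_inject glue_inject)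
    have im: "?f ` darts D \<subseteq> darts D" by (auto simp: straight_step_turn)
    have symm: "y \<in> orbit ?f x \<Longrightarrow> x \<in> darts D \<Longrightarrow> x \<in> orbit ?f y" for x y
      using finite_inj_self_in_orbit[OF involutive_finite(2) inj im] orbit_swap by metis
    have sub: "orbit ?f x \<subseteq> darts D" if "x \<in> darts D" for x
      using orbit_closed_subset[OF im that] .
    \<comment> \<open>The walk from \<open>d\<close> in both directions: the second set holds the
      opposites of the darts in the orbit, which are the darts of the reversed walk.\<close>
    let ?S = "orbit ?f d \<union> {x. turn x 2 \<in> orbit ?f d}"
    have rev: "turn (glue D x) 2 \<in> orbit ?f d" if "x \<in> orbit ?f d" for x
      using orbit.step[OF that] by (simp add: straight_step_turn)
    have rev': "turn (glue D (turn x 2)) 0 \<in> orbit ?f d" if x: "x \<in> orbit ?f d" for x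
    proof -
      have xD: "x \<in> darts D" using x sub d by blast
      have "glue D (turn x 2) \<in> orbit ?f x"
      proof (rule symm)
        have "?f (glue D (turn x 2)) = x" by (simp add: straight_step_turn)
        then show "x \<in> orbit ?f (glue D (turn x 2))" by (metis orbit.base)
        show "glue D (turn x 2) \<in> darts D" using xD by simp
      qed
      then show ?thesis using x by (simp add: orbit_trans)
    qed
    have "?S = darts D"
    proof (rule connected_diagramD[OF conn])
      show "?S \<subseteq> darts D"
      proof
        fix x assume "x \<in> ?S"
        then have "x \<in> darts D \<or> turn x 2 \<in> darts D" using sub[OF d] by blast
        then show "x \<in> darts D" by simp
      qed
      show "d \<in> ?S"
        using finite_inj_self_in_orbit[OF involutive_finite(2) inj im d] by blast
      show "glue D x \<in> ?S" if "x \<in> ?S" for x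
        using that rev[of x] rev'[of "turn x 2"] by auto
      show "turn x 2 \<in> ?S" if "x \<in> ?S" for x
        using that by auto
    qed
    with e have "e \<in> orbit ?f d \<or> turn e 2 \<in> orbit ?f d" by blast
    then show "\<exists>k. (?f ^^ k) d = e \<or> (?f ^^ k) d = opposite e"
      by (auto simp: orbit_altdef opposite_turn)
  qed
qed

end

lemma classical_diagram_iff:
  "classical_diagram D \<longleftrightarrow> involutive D \<and> connected_diagram D \<and>
     (crossings D = {} \<or> card (orbit (face_step D) ` darts D) = card (crossings D) + 2)"
  using spherical_iff[of D] single_component_iff[of D]
  by (auto simp: classical_diagram_def involutive_def)

lemma involutiveI:
  assumes "finite (crossings D)" "\<And>d. d \<notin> darts D \<Longrightarrow> glue D d = d"
    and "\<And>d. d \<in> darts D \<Longrightarrow> glue D d \<in> darts D \<and> glue D d \<noteq> d \<and> glue D (glue D d) = d"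
  shows "involutive D"
  unfolding involutive_def
proof (intro conjI)
  have "bij_betw (glue D) (darts D) (darts D)"
    by (rule bij_betwI[where g = "glue D"]) (use assms(3) in auto)
  then show "glue D permutes darts D"
    by (rule bij_imp_permutes) (rule assms(2))
qed (use assms in auto)

section \<open>Second Reidemeister moves\<close>

text \<open>
  The edge \<open>{x, glue D x}\<close> of \<open>D\<close> is pushed over the edge \<open>{y, glue D y}\<close>. Its strand runs
  \<open>x\<close>, \<open>P\<close>, \<open>Q\<close>, \<open>glue D x\<close> in \<open>E\<close>, the other strand runs \<open>y\<close>, \<open>Q\<close>, \<open>P\<close>, \<open>glue D y\<close>.
\<close>

locale R2_pair =
  fixes D E :: diagram and x y P Q :: dart
  assumes invD: "involutive D" and invE: "involutive E"
    and crossings_E: "crossings E = crossings D \<union> {fst P, fst Q}"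
    and fresh: "fst P \<notin> crossings D" "fst Q \<notin> crossings D" "fst P \<noteq> fst Q"
    and level: "snd P \<in> {0, 2}" "snd Q \<in> {0, 2}"
    and xy: "x \<in> darts D" "y \<in> darts D" "y \<noteq> x" "y \<noteq> glue D x"
    and glue_E: "glue E x = turn P 1" "glue E (glue D x) = turn Q 3"
      "glue E y = Q" "glue E (glue D y) = P"
      "glue E (turn P 3) = turn Q 1" "glue E (turn P 2) = turn Q 2"
    and glue_E_old: "\<And>z. z \<in> darts D \<Longrightarrow> z \<notin> {x, glue D x, y, glue D y} \<Longrightarrow> glue E z = glue D z"
begin

lemma glue_E' [simp]: "glue E x = turn P 1" "glue E (glue D x) = turn Q 3"
  "glue E y = Q" "glue E (glue D y) = P"
  "glue E (turn P 3) = turn Q 1" "glue E (turn P 2) = turn Q 2"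
  "glue E (turn P 1) = x" "glue E (turn Q 3) = glue D x" "glue E Q = y" "glue E P = glue D y"
  "glue E (turn Q 1) = turn P 3" "glue E (turn Q 2) = turn P 2"
  using glue_E by (simp_all add: glue_eq_iff[OF invE, symmetric])
    (metis glue_E glue_glue[OF invE])+

lemma darts_E: "d \<in> darts E \<longleftrightarrow> d \<in> darts D \<or> fst d = fst P \<or> fst d = fst Q"
  by (auto simp: in_darts_iff crossings_E)

lemma darts_E_cases:
  assumes "d \<in> darts E"
  obtains "d \<in> darts D" | "d = P" | "d = turn P 1" | "d = turn P 2" | "d = turn P 3"
    | "d = Q" | "d = turn Q 1" | "d = turn Q 2" | "d = turn Q 3"
  using assms same_crossing_turn[of d P] same_crossing_turn[of d Q] unfolding darts_E by blast

lemma old_neq [simp]: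
  assumes "z \<in> darts D"
  shows "z \<noteq> P" "z \<noteq> Q" "z \<noteq> turn P n" "z \<noteq> turn Q n" "P \<noteq> z" "Q \<noteq> z" "turn P n \<noteq> z" "turn Q n \<noteq> z"
  using assms fresh by (auto simp: in_darts_iff)

lemma new_neq [simp]: "turn P m \<noteq> turn Q n" "turn Q n \<noteq> turn P m" "P \<noteq> turn Q n" "Q \<noteq> turn P m"
  "turn Q n \<noteq> P" "turn P n \<noteq> Q" "P \<noteq> Q" "Q \<noteq> P"
  using fresh by (metis fst_turn)+

lemma xy_neq [simp]: "x \<noteq> y" "y \<noteq> x" "glue D x \<noteq> x" "x \<noteq> glue D x" "glue D y \<noteq> y" "y \<noteq> glue D y"
  "glue D x \<noteq> y" "y \<noteq> glue D x" "glue D y \<noteq> x" "x \<noteq> glue D y" "glue D x \<noteq> glue D y" "glue D y \<noteq> glue D x"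
  using xy glue_neq[OF invD] glue_glue[OF invD] by metis+

lemma in_D [simp]: "x \<in> darts D" "y \<in> darts D" "glue D x \<in> darts D" "glue D y \<in> darts D"
  "x \<in> darts E" "y \<in> darts E" "P \<in> darts E" "Q \<in> darts E"
  using xy invD by (auto simp: darts_E)

lemma not_in_D [simp]: "P \<notin> darts D" "Q \<notin> darts D"
  using fresh by (auto simp: in_darts_iff)

lemma glue_E_cases:
  assumes "z \<in> darts D"
  obtains "z = x" | "z = glue D x" | "z = y" | "z = glue D y"
    | "z \<notin> {x, glue D x, y, glue D y}" "glue E z = glue D z"
  using glue_E_old assms by blast

text \<open>Both strands stay unbroken, and each only gains four darts. A closed set of one diagram
  becomes a closed set of the other by adding these darts for every strand it contains, or by
  dropping them.\<close>

lemma connected_iff: "connected_diagram E \<longleftrightarrow> connected_diagram D"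
proof
  assume conn: "connected_diagram E"
  show "connected_diagram D"
    unfolding connected_diagram_def
  proof (intro allI impI)
    fix S assume S: "S \<subseteq> darts D" "S \<noteq> {}" "glue D ` S \<subseteq> S" "\<forall>d\<in>S. turn d 2 \<in> S"
    have gS: "glue D z \<in> S \<longleftrightarrow> z \<in> S" for z
      using S(3) glue_glue[OF invD] by (metis image_subset_iff)
    define X where "X = (if x \<in> S then {turn P 1, turn P 3, turn Q 1, turn Q 3} else {})"
    define Y where "Y = (if y \<in> S then {P, turn P 2, Q, turn Q 2} else {})"
    obtain s where s: "s \<in> S" using S(2) by blast
    have "S \<union> X \<union> Y = darts E"
    proof (rule connected_diagramD[OF conn])
      show "S \<union> X \<union> Y \<subseteq> darts E"
        using S(1) by (auto simp: X_def Y_def darts_E split: if_splits)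
      show "s \<in> S \<union> X \<union> Y" using s by blast
      show "turn d 2 \<in> S \<union> X \<union> Y" if "d \<in> S \<union> X \<union> Y" for d
        using that S(4) by (auto simp: X_def Y_def split: if_splits)
      show "glue E d \<in> S \<union> X \<union> Y" if "d \<in> S \<union> X \<union> Y" for d
      proof (cases "d \<in> S")
        case True
        then have "d \<in> darts D" using S(1) by blast
        then show ?thesis
        proof (cases rule: glue_E_cases)
          case 2 then show ?thesis using True gS by (auto simp: X_def Y_def)
        next
          case 4 then show ?thesis using True gS by (auto simp: X_def Y_def)
        qed (use True gS in \<open>auto simp: X_def Y_def\<close>)
      next
        case False
        then show ?thesis using that gS[of x] gS[of y] by (auto simp: X_def Y_def split: if_splits)
      qed
    qed
    moreover have "X \<inter> darts D = {}" "Y \<inter> darts D = {}"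
      unfolding X_def Y_def using fresh by (auto simp: in_darts_iff)
    moreover have "darts D \<subseteq> darts E" by (auto simp: darts_E)
    ultimately show "S = darts D" using S(1) by blast
  qed
next
  assume conn: "connected_diagram D"
  show "connected_diagram E"
    unfolding connected_diagram_def
  proof (intro allI impI)
    fix S assume S: "S \<subseteq> darts E" "S \<noteq> {}" "glue E ` S \<subseteq> S" "\<forall>d\<in>S. turn d 2 \<in> S"
    have g: "glue E d \<in> S" if "d \<in> S" for d using S(3) that by blast
    have t: "turn d 2 \<in> S" if "d \<in> S" for d using S(4) that by blast
    have "x \<in> S \<Longrightarrow> turn P 1 \<in> S" "turn P 1 \<in> S \<Longrightarrow> turn P 3 \<in> S" "turn P 3 \<in> S \<Longrightarrow> turn Q 1 \<in> S"
      "turn Q 1 \<in> S \<Longrightarrow> turn Q 3 \<in> S" "turn Q 3 \<in> S \<Longrightarrow> glue D x \<in> S"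
      "glue D x \<in> S \<Longrightarrow> turn Q 3 \<in> S" "turn Q 3 \<in> S \<Longrightarrow> turn Q 1 \<in> S" "turn Q 1 \<in> S \<Longrightarrow> turn P 3 \<in> S"
      "turn P 3 \<in> S \<Longrightarrow> turn P 1 \<in> S" "turn P 1 \<in> S \<Longrightarrow> x \<in> S"
      using g[of x] t[of "turn P 1"] g[of "turn P 3"] t[of "turn Q 1"] g[of "turn Q 3"]
        g[of "glue D x"] t[of "turn Q 3"] g[of "turn Q 1"] t[of "turn P 3"] g[of "turn P 1"] by simp_all
    then have xs: "turn P 1 \<in> S \<longleftrightarrow> x \<in> S" "turn P 3 \<in> S \<longleftrightarrow> x \<in> S" "turn Q 1 \<in> S \<longleftrightarrow> x \<in> S"
      "turn Q 3 \<in> S \<longleftrightarrow> x \<in> S" "glue D x \<in> S \<longleftrightarrow> x \<in> S"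
      by blast+
    have "y \<in> S \<Longrightarrow> Q \<in> S" "Q \<in> S \<Longrightarrow> turn Q 2 \<in> S" "turn Q 2 \<in> S \<Longrightarrow> turn P 2 \<in> S"
      "turn P 2 \<in> S \<Longrightarrow> P \<in> S" "P \<in> S \<Longrightarrow> glue D y \<in> S"
      "glue D y \<in> S \<Longrightarrow> P \<in> S" "P \<in> S \<Longrightarrow> turn P 2 \<in> S" "turn P 2 \<in> S \<Longrightarrow> turn Q 2 \<in> S"
      "turn Q 2 \<in> S \<Longrightarrow> Q \<in> S" "Q \<in> S \<Longrightarrow> y \<in> S"
      using g[of y] t[of Q] g[of "turn Q 2"] t[of "turn P 2"] g[of P]
        g[of "glue D y"] t[of P] g[of "turn P 2"] t[of "turn Q 2"] g[of Q] by simp_all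
    then have ys: "P \<in> S \<longleftrightarrow> y \<in> S" "turn P 2 \<in> S \<longleftrightarrow> y \<in> S" "Q \<in> S \<longleftrightarrow> y \<in> S"
      "turn Q 2 \<in> S \<longleftrightarrow> y \<in> S" "glue D y \<in> S \<longleftrightarrow> y \<in> S"
      by blast+
    obtain s where s: "s \<in> S" "s \<in> darts D"
    proof -
      obtain s where s: "s \<in> S" using S(2) by blast
      then have "s \<in> darts E" using S(1) by blast
      then consider "s \<in> darts D" | "x \<in> S" | "y \<in> S"
        by (rule darts_E_cases) (use s xs ys in simp_all)
      then show ?thesis using that[of s] that[of x] that[of y] s by cases simp_all
    qed
    have "S \<inter> darts D = darts D"
    proof (rule connected_diagramD[OF conn])
      show "s \<in> S \<inter> darts D" using s by blast
      show "glue D d \<in> S \<inter> darts D" if "d \<in> S \<inter> darts D" for d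
      proof -
        have "d \<in> darts D" using that by blast
        then show ?thesis
        proof (cases rule: glue_E_cases)
          case 5 then show ?thesis using that g[of d] invD by auto
        qed (use that xs ys invD in auto)
      qed
      show "turn d 2 \<in> S \<inter> darts D" if "d \<in> S \<inter> darts D" for d
        using that t[of d] by auto
    qed blast
    then have D: "d \<in> S" if "d \<in> darts D" for d using that by blast
    have "d \<in> S" if "d \<in> darts E" for d
      using that by (rule darts_E_cases) (use xs ys D in_D in simp_all)
    then show "S = darts E" using S(1) by blast
  qed
qed

lemma face_step_E [simp]:
  "face_step E x = P" "face_step E (glue D x) = turn Q 2"
  "face_step E y = turn Q 3" "face_step E (glue D y) = turn P 3"
  "face_step E P = face_step D y" "face_step E (turn P 1) = face_step D (glue D x)"
  "face_step E (turn P 2) = turn Q 1" "face_step E (turn P 3) = Q"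
  "face_step E Q = face_step D (glue D y)" "face_step E (turn Q 1) = turn P 2"
  "face_step E (turn Q 2) = turn P 1" "face_step E (turn Q 3) = face_step D x"
  by (simp_all add: face_step_turn glue_glue[OF invD])

text \<open>
  The pushed strand cuts the face on the left of \<open>x\<close> and \<open>y\<close> into two, one on each side of the new
  bigon, exactly if the new corners opposite to those of the bigon lie in different faces.
\<close>

lemma card_faces:
  assumes "turn Q 3 \<notin> orbit (face_step E) P"
  shows "card (orbit (face_step E) ` darts E) = card (orbit (face_step D) ` darts D) + 2"
proof -
  let ?f = "face_step E" and ?g = "face_step D"
  \<comment> \<open>The first return map of the faces of \<open>E\<close> to the darts of
    \<open>D\<close>, apart from the bigon \<open>Z\<close>: the continuations after
    \<open>x\<close> and \<open>y\<close> are exchanged.\<close>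
  define r where "r = ?g(x := ?g y, y := ?g x)"
  define Z where "Z = {turn P 2, turn Q 1}"
  define X where "X = darts E - Z"
  define \<pi> where "\<pi> = (\<lambda>d. if d \<in> darts D then d else if d = P then x
    else if d = turn Q 3 then y else if d \<in> {turn Q 2, turn P 1} then glue D x else glue D y)"
  have finE: "finite (darts E)" and finD: "finite (darts D)"
    using involutive_finite invD invE by auto
  have DX: "darts D \<subseteq> X" by (auto simp: X_def Z_def darts_E)
  have X_cases: "z \<in> darts D \<or> z \<in> {P, turn P 1, turn P 3, Q, turn Q 2, turn Q 3}" if "z \<in> X" for z
    using that unfolding X_def Z_def by (auto elim: darts_E_cases)
  have old: "?f z = ?g z" if "z \<in> darts D" "z \<notin> {x, glue D x, y, glue D y}" for z
    using that glue_E_old by (simp add: face_step_turn)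
  have fX: "?f ` X \<subseteq> X"
  proof -
    have "?f z \<in> X" if "z \<in> X" for z
    proof (cases "z \<in> darts D")
      case True
      then show ?thesis
      proof (cases rule: glue_E_cases)
        case 5
        then show ?thesis using old[of z] True DX invD by auto
      qed (auto simp: X_def Z_def darts_E)
    next
      case False
      then show ?thesis using X_cases[OF that] DX invD
        by (auto simp: X_def Z_def darts_E)
    qed
    then show ?thesis by blast
  qed
  have rD: "r ` darts D \<subseteq> darts D" using invD by (auto simp: r_def)
  have inj_r: "inj_on r (darts D)"
  proof (rule inj_onI)
    fix a b assume "r a = r b"
    then show "a = b"
      unfolding r_def using inj_face_step[OF invD, of UNIV]
      by (auto simp: fun_upd_def inj_eq split: if_splits)
  qed
  have f_orb: "?f (?f z) \<in> orbit ?f z" for z by (blast intro: orbit.intros)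
  have r_orbit: "r z \<in> orbit ?f z" if "z \<in> darts D" for z
    using that
  proof (cases rule: glue_E_cases)
    case 1 then show ?thesis using f_orb[of x] by (simp add: r_def)
  next
    case 2 then show ?thesis
      using orbit.step[OF f_orb[of "glue D x"]] by (simp add: r_def)
  next
    case 3 then show ?thesis using f_orb[of y] by (simp add: r_def)
  next
    case 4 then show ?thesis
      using orbit.step[OF f_orb[of "glue D y"]] by (simp add: r_def)
  next
    case 5
    then show ?thesis using old[OF that 5(1)] orbit.base[of ?f z] by (simp add: r_def)
  qed
  have 1: "card (orbit ?f ` X) = card (orbit r ` darts D)"
  proof (rule card_orbits_first_return[where \<pi> = \<pi>])
    show "finite X" using finE by (simp add: X_def)
    show "inj_on ?f X" using inj_face_step[OF invE] .
    show "?f ` X \<subseteq> X" "inj_on r (darts D)" "r ` darts D \<subseteq> darts D" "darts D \<subseteq> X"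
      using fX inj_r rD DX by auto
    show "\<pi> z = z" if "z \<in> darts D" for z using that by (simp add: \<pi>_def)
    show "r z \<in> orbit ?f z" if "z \<in> darts D" for z using r_orbit[OF that] .
    show "\<pi> (?f z) = \<pi> z \<or> \<pi> (?f z) = r (\<pi> z)" if "z \<in> X" for z
    proof (cases "z \<in> darts D")
      case True
      then show ?thesis
      proof (cases rule: glue_E_cases)
        case 5
        then show ?thesis using old[of z] True invD by (auto simp: \<pi>_def r_def)
      qed (auto simp: \<pi>_def)
    next
      case False
      then show ?thesis using X_cases[OF that] invD by (auto simp: \<pi>_def r_def)
    qed
    show "\<pi> z \<in> darts D \<and> z \<in> orbit ?f (\<pi> z)" if "z \<in> X" for z
    proof (cases "z \<in> darts D")
      case True
      then show ?thesis using finite_inj_self_in_orbit[OF finE inj_face_step[OF invE]]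
          face_step_image[OF invE] by (auto simp: \<pi>_def darts_E)
    next
      case False
      have o: "P \<in> orbit ?f x" "turn Q 3 \<in> orbit ?f y" "turn Q 2 \<in> orbit ?f (glue D x)"
        "turn P 3 \<in> orbit ?f (glue D y)" "turn P 1 \<in> orbit ?f (glue D x)" "Q \<in> orbit ?f (glue D y)"
        using orbit.base[of ?f x] orbit.base[of ?f y] orbit.base[of ?f "glue D x"]
          orbit.base[of ?f "glue D y"] f_orb[of "glue D x"] f_orb[of "glue D y"] by simp_all
      then show ?thesis using X_cases[OF that] False by (auto simp: \<pi>_def)
    qed
  qed
  have "card (orbit ?f ` (X \<union> Z)) = card (orbit ?f ` X) + card (orbit ?f ` Z)"
    by (rule card_orbits_Un) (use finE fX in \<open>auto simp: X_def Z_def\<close>)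
  moreover have "X \<union> Z = darts E" by (auto simp: X_def Z_def darts_E)
  moreover have "card (orbit ?f ` Z) = 1"
  proof -
    have "orbit ?f (turn P 2) = orbit ?f (turn Q 1)"
    proof -
      have "turn P 2 \<in> orbit ?f (turn Q 1)" "turn Q 1 \<in> orbit ?f (turn P 2)"
        using orbit.base[of ?f "turn Q 1"] orbit.base[of ?f "turn P 2"] by simp_all
      then show ?thesis by (meson orbit_trans subset_antisym subsetI)
    qed
    then show ?thesis by (simp add: Z_def)
  qed
  ultimately have 2: "card (orbit ?f ` darts E) = card (orbit r ` darts D) + 1" using 1 by simp
  \<comment> \<open>In \<open>E\<close> the corners \<open>P\<close> and \<open>turn Q 3\<close>
    follow right after \<open>x\<close> and \<open>y\<close>, so a common cycle of \<open>r\<close>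
    would put them into one face.\<close>
  have "y \<notin> orbit r x"
  proof
    assume "y \<in> orbit r x"
    then have "y \<in> orbit ?f x"
    proof (induction)
      case base show ?case using r_orbit by simp
    next
      case (step z)
      then have "z \<in> darts D" using orbit_closed_subset[OF rD, of x] by auto
      then show ?case using step.IH r_orbit orbit_trans by metis
    qed
    then have "turn Q 3 \<in> orbit ?f x" using orbit.step[of y ?f x] by simp
    then show False
      using assms orbit_step[of "turn Q 3" ?f x] by simp
  qed
  then have "card (orbit r ` darts D) = card (orbit ?g ` darts D) + 1"
    by (intro card_orbits_merge[where x = x and y = y])
      (use finD inj_r rD in \<open>auto simp: r_def\<close>)
  then show ?thesis using 2 by simp
qed

lemma classical_iff:
  assumes "turn Q 3 \<notin> orbit (face_step E) P"
  shows "classical_diagram E \<longleftrightarrow> classical_diagram D"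
proof -
  have "crossings D \<noteq> {}" using xy(1) by (auto simp: in_darts_iff)
  moreover have "card (crossings E) = card (crossings D) + 2"
    unfolding crossings_E using fresh involutive_finite(1)[OF invD] by simp
  ultimately show ?thesis
    using card_faces[OF assms] connected_iff invD invE
    by (auto simp: classical_diagram_iff crossings_E)
qed

lemma R2_decreasing: "R2_decreasing E (fst P) (fst Q) D"
  unfolding R2_decreasing_def
proof (intro conjI exI)
  show "face_step E (fst P, snd (turn P 2)) = (fst Q, snd (turn Q 1))"
    "face_step E (fst Q, snd (turn Q 1)) = (fst P, snd (turn P 2))"
    using face_step_E(7,10) by (metis fst_turn prod.collapse)+
  \<comment> \<open>The side of the bigon at \<open>turn P 2\<close> belongs to the other strand,
    which passes under at both ends because \<open>P\<close> and \<open>Q\<close> carry even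
    labels.\<close>
  have "\<not> over (turn P 2)" "\<not> over (turn Q 2)"
    using level by (auto simp: over_def turn_def)
  then show "over (fst P, snd (turn P 2)) \<longleftrightarrow> over (glue E (fst P, snd (turn P 2)))"
    by (metis fst_turn prod.collapse glue_E'(6))
  have st: "straight_to {fst P, fst Q} E d (glue D d)" if d: "d \<in> darts D" for d
  proof -
    have stop: "straight_to {fst P, fst Q} E a (glue E a)" if "glue E a \<in> darts D" for a
      by (rule straight_to.stop) (use that fresh in \<open>auto simp: in_darts_iff\<close>)
    have pass: "straight_to {fst P, fst Q} E a e"
      if "glue E a = turn b n" "b = P \<or> b = Q" "straight_to {fst P, fst Q} E (turn b (n + 2)) e" for a b n e
      by (rule straight_to.pass) (use that in \<open>auto simp: straight_step_turn\<close>)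
    from d show ?thesis
    proof (cases rule: glue_E_cases)
      case 1
      show ?thesis unfolding 1
        by (rule pass[of _ P 1], simp, simp, rule pass[of _ Q 1], simp, simp)
          (use stop[of "turn Q 3"] in simp)
    next
      case 2
      show ?thesis unfolding 2
        by (rule pass[of _ Q 3], simp, simp, rule pass[of _ P 3], simp, simp)
          (use stop[of "turn P 1"] invD in simp)
    next
      case 3
      show ?thesis unfolding 3
        by (rule pass[of _ Q 0], simp, simp, rule pass[of _ P 2], simp, simp)
          (use stop[of P] in simp)
    next
      case 4
      show ?thesis unfolding 4
        by (rule pass[of _ P 0], simp, simp, rule pass[of _ Q 2], simp, simp)
          (use stop[of Q] invD in simp)
    next
      case 5
      then show ?thesis using stop[of d] d invD by simp
    qed
  qed
  show "erased {fst P, fst Q} E D"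
    unfolding erased_def using st fresh by (auto simp: crossings_E)
qed (use crossings_E fresh in auto)

end

section \<open>Carrying out and undoing a second move\<close>

definition push :: "diagram \<Rightarrow> dart \<Rightarrow> dart \<Rightarrow> dart \<Rightarrow> dart \<Rightarrow> diagram" where
  "push D x y P Q = D\<lparr>crossings := crossings D \<union> {fst P, fst Q},
     glue := (glue D)(x := turn P 1, turn P 1 := x, turn P 3 := turn Q 1, turn Q 1 := turn P 3,
       turn Q 3 := glue D x, glue D x := turn Q 3, y := Q, Q := y, turn Q 2 := turn P 2,
       turn P 2 := turn Q 2, P := glue D y, glue D y := P)\<rparr>"

lemma R2_pair_push:
  assumes D: "involutive D"
    and fresh: "fst P \<notin> crossings D" "fst Q \<notin> crossings D" "fst P \<noteq> fst Q"
    and level: "snd P \<in> {0, 2}" "snd Q \<in> {0, 2}"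
    and xy: "x \<in> darts D" "y \<in> darts D" "y \<noteq> x" "y \<noteq> glue D x"
  shows "R2_pair D (push D x y P Q) x y P Q"
proof -
  let ?E = "push D x y P Q"
  have old [simp]: "z \<noteq> P" "z \<noteq> Q" "z \<noteq> turn P n" "z \<noteq> turn Q n" "P \<noteq> z" "Q \<noteq> z" "turn P n \<noteq> z" "turn Q n \<noteq> z"
    if "z \<in> darts D" for z n
    using that fresh by (auto simp: in_darts_iff)
  have new [simp]: "turn P m \<noteq> turn Q n" "turn Q n \<noteq> turn P m" "P \<noteq> turn Q n" "Q \<noteq> turn P m"
    "turn Q n \<noteq> P" "turn P n \<noteq> Q" "P \<noteq> Q" "Q \<noteq> P" for m n
    using fresh by (metis fst_turn)+
  have in_D [simp]: "x \<in> darts D" "y \<in> darts D" "glue D x \<in> darts D" "glue D y \<in> darts D"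
    using xy D by auto
  have xy_neq [simp]: "x \<noteq> y" "y \<noteq> x" "glue D x \<noteq> x" "x \<noteq> glue D x" "glue D y \<noteq> y" "y \<noteq> glue D y"
    "glue D x \<noteq> y" "y \<noteq> glue D x" "glue D y \<noteq> x" "x \<noteq> glue D y" "glue D x \<noteq> glue D y" "glue D y \<noteq> glue D x"
    using xy glue_neq[OF D] glue_glue[OF D] by metis+
  have cr: "crossings ?E = crossings D \<union> {fst P, fst Q}" by (simp add: push_def)
  have eqs [simp]: "glue ?E x = turn P 1" "glue ?E (glue D x) = turn Q 3"
    "glue ?E y = Q" "glue ?E (glue D y) = P"
    "glue ?E (turn P 3) = turn Q 1" "glue ?E (turn P 2) = turn Q 2"
    "glue ?E (turn P 1) = x" "glue ?E (turn Q 3) = glue D x" "glue ?E Q = y" "glue ?E P = glue D y"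
    "glue ?E (turn Q 1) = turn P 3" "glue ?E (turn Q 2) = turn P 2"
    by (simp_all add: push_def)
  have other: "glue ?E z = glue D z" if "z \<notin> {x, glue D x, y, glue D y}" "fst z \<notin> {fst P, fst Q}" for z
    using that by (auto simp: push_def)
  have darts: "d \<in> darts ?E \<longleftrightarrow> d \<in> darts D \<or> fst d = fst P \<or> fst d = fst Q" for d
    by (auto simp: in_darts_iff cr)
  have "involutive ?E"
  proof (rule involutiveI)
    show "finite (crossings ?E)" using involutive_finite[OF D] by (simp add: cr)
    show "glue ?E d = d" if "d \<notin> darts ?E" for d
    proof -
      have "d \<notin> darts D" using that darts by blast
      then have "glue D d = d" "d \<notin> {x, glue D x, y, glue D y}"
        using glue_outside[OF D] in_D by auto
      then show ?thesis using that other[of d] by (auto simp: darts)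
    qed
    show "glue ?E d \<in> darts ?E \<and> glue ?E d \<noteq> d \<and> glue ?E (glue ?E d) = d" if "d \<in> darts ?E" for d
    proof (cases "d \<in> darts D")
      case True
      show ?thesis
      proof (cases "d \<in> {x, glue D x, y, glue D y}")
        case True
        then show ?thesis by (auto simp: darts)
      next
        case False
        have "fst z \<notin> {fst P, fst Q}" if "z \<in> darts D" for z
          using that fresh by (auto simp: in_darts_iff)
        moreover have "glue D d \<notin> {x, glue D x, y, glue D y}"
          using False glue_eq_iff[OF D, of d] glue_inject[OF D, of d] by auto
        ultimately have "glue ?E d = glue D d" "glue ?E (glue D d) = d"
          using other[of d] other[of "glue D d"] False True D by auto
        then show ?thesis using True D glue_neq by (auto simp: darts)
      qed
    next
      case False
      then have "fst d = fst P \<or> fst d = fst Q" using that by (simp add: darts)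
      then have "d \<in> {P, turn P 1, turn P 2, turn P 3, Q, turn Q 1, turn Q 2, turn Q 3}"
        using same_crossing_turn by blast
      then show ?thesis by (auto simp: darts)
    qed
  qed
  then show ?thesis
  proof unfold_locales
    show "glue ?E z = glue D z" if "z \<in> darts D" "z \<notin> {x, glue D x, y, glue D y}" for z
    proof (rule other[OF that(2)])
      have "fst z \<in> crossings D" using that(1) by (simp add: in_darts_iff)
      then show "fst z \<notin> {fst P, fst Q}" using fresh by (metis insert_iff singletonD)
    qed
  qed (use D fresh level xy cr in simp_all)
qed

text \<open>The loose ends are joined along the two strands. At the removed crossings the gluing
  becomes the identity, since it must fix everything outside the darts.\<close>

definition unpush :: "diagram \<Rightarrow> dart \<Rightarrow> dart \<Rightarrow> diagram" where
  "unpush E P Q = E\<lparr>crossings := crossings E - {fst P, fst Q},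
     glue := (\<lambda>d. if fst d \<in> {fst P, fst Q} then d
       else if d = glue E (turn P 1) then glue E (turn Q 3)
       else if d = glue E (turn Q 3) then glue E (turn P 1)
       else if d = glue E Q then glue E P
       else if d = glue E P then glue E Q else glue E d)\<rparr>"

text \<open>By \<open>outside\<close> none of the four outer darts of the bigon is joined to a dart
  at its two corners, so each strand has two ends that survive and can be joined.\<close>

lemma R2_pair_unpush:
  assumes E: "involutive E"
    and PQ: "P \<in> darts E" "Q \<in> darts E" "fst P \<noteq> fst Q"
    and level: "snd P \<in> {0, 2}" "snd Q \<in> {0, 2}"
    and bigon: "glue E (turn P 3) = turn Q 1" "glue E (turn P 2) = turn Q 2"
    and outside: "\<And>d. d \<in> {P, turn P 1, Q, turn Q 3} \<Longrightarrow> fst (glue E d) \<notin> {fst P, fst Q}"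
  shows "R2_pair (unpush E P Q) E (glue E (turn P 1)) (glue E Q) P Q"
proof -
  let ?D = "unpush E P Q"
  let ?x = "glue E (turn P 1)" and ?x' = "glue E (turn Q 3)" and ?y = "glue E Q" and ?y' = "glue E P"
  have new [simp]: "turn P m \<noteq> turn Q n" "turn Q n \<noteq> turn P m" "P \<noteq> turn Q n" "Q \<noteq> turn P m"
    "turn Q n \<noteq> P" "turn P n \<noteq> Q" "P \<noteq> Q" "Q \<noteq> P" for m n
    using PQ by (metis fst_turn)+
  have [simp]: "fst ?x \<noteq> fst P" "fst ?x \<noteq> fst Q" "fst ?x' \<noteq> fst P" "fst ?x' \<noteq> fst Q"
    "fst ?y \<noteq> fst P" "fst ?y \<noteq> fst Q" "fst ?y' \<noteq> fst P" "fst ?y' \<noteq> fst Q"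
    using outside by auto
  have cr: "crossings ?D = crossings E - {fst P, fst Q}" by (simp add: unpush_def)
  have darts: "d \<in> darts ?D \<longleftrightarrow> d \<in> darts E \<and> fst d \<notin> {fst P, fst Q}" for d
    by (auto simp: in_darts_iff cr)
  have ineq [simp]: "?x \<noteq> ?x'" "?x' \<noteq> ?x" "?x \<noteq> ?y" "?y \<noteq> ?x" "?x \<noteq> ?y'" "?y' \<noteq> ?x"
    "?x' \<noteq> ?y" "?y \<noteq> ?x'" "?x' \<noteq> ?y'" "?y' \<noteq> ?x'" "?y \<noteq> ?y'" "?y' \<noteq> ?y"
    by (simp_all add: glue_inject[OF E])
  have eqs [simp]: "glue ?D ?x = ?x'" "glue ?D ?x' = ?x" "glue ?D ?y = ?y'" "glue ?D ?y' = ?y"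
    by (simp_all add: unpush_def)
  have other: "glue ?D d = glue E d" if "d \<notin> {?x, ?x', ?y, ?y'}" "fst d \<notin> {fst P, fst Q}" for d
    using that by (simp add: unpush_def)
  have in_E [simp]: "?x \<in> darts E" "?x' \<in> darts E" "?y \<in> darts E" "?y' \<in> darts E"
    using E PQ by auto
  have "involutive ?D"
  proof (rule involutiveI)
    show "finite (crossings ?D)" using involutive_finite[OF E] by (simp add: cr)
    show "glue ?D d = d" if "d \<notin> darts ?D" for d
    proof (cases "fst d \<in> {fst P, fst Q}")
      case False
      then have "d \<notin> darts E" using that darts by blast
      then have "d \<notin> {?x, ?x', ?y, ?y'}" using in_E by auto
      then show ?thesis using False other[of d] glue_outside[OF E \<open>d \<notin> darts E\<close>] by simp
    qed (simp add: unpush_def)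
    show "glue ?D d \<in> darts ?D \<and> glue ?D d \<noteq> d \<and> glue ?D (glue ?D d) = d" if d: "d \<in> darts ?D" for d
    proof (cases "d \<in> {?x, ?x', ?y, ?y'}")
      case True
      then show ?thesis by (auto simp: darts)
    next
      case False
      have d': "d \<in> darts E" "fst d \<noteq> fst P" "fst d \<noteq> fst Q" using d darts by auto
      have new_end: "fst (glue E d) \<notin> {fst P, fst Q}"
      proof
        assume "fst (glue E d) \<in> {fst P, fst Q}"
        then consider "glue E d = P" | "glue E d = turn P 1" | "glue E d = turn P 2" | "glue E d = turn P 3"
          | "glue E d = Q" | "glue E d = turn Q 1" | "glue E d = turn Q 2" | "glue E d = turn Q 3"
          using same_crossing_turn[of "glue E d" P] same_crossing_turn[of "glue E d" Q] by auto
        moreover have "glue E (turn Q 1) = turn P 3" "glue E (turn Q 2) = turn P 2"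
          using bigon by (metis glue_glue[OF E])+
        moreover have "d = glue E e" if "glue E d = e" for e
          using that glue_glue[OF E] by metis
        ultimately show False
          using False d' bigon by (metis fst_turn insertCI)
      qed
      have "glue E d \<notin> {?x, ?x', ?y, ?y'}"
        using d' by (auto simp: glue_inject[OF E])
      then have "glue ?D (glue E d) = d" "glue ?D d = glue E d"
        using other[of "glue E d"] other[of d] new_end d' False E by auto
      then show ?thesis using d' new_end E glue_neq by (auto simp: darts)
    qed
  qed
  moreover have "crossings E = crossings ?D \<union> {fst P, fst Q}"
    using PQ by (auto simp: cr in_darts_iff)
  ultimately show ?thesis
  proof unfold_locales
    show "glue E z = glue ?D z" if "z \<in> darts ?D" "z \<notin> {?x, glue ?D ?x, ?y, glue ?D ?y}" for z
      using other[of z] that by (simp add: darts)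
  qed (use E level bigon PQ in \<open>simp_all add: cr darts glue_glue\<close>)
qed

section \<open>First Reidemeister moves\<close>

text \<open>The strand that ran from \<open>x\<close> to \<open>glue D x\<close> now runs
  \<open>x\<close>, \<open>turn C 2\<close>, \<open>C\<close>, \<open>turn C 1\<close>,
  \<open>turn C 3\<close>, \<open>glue D x\<close>. Its loop from \<open>C\<close> to
  \<open>turn C 1\<close> has \<open>C\<close> as its only corner on the left. The label of
  \<open>C\<close> is left free, so that both kinds of curl are covered.\<close>

locale R1_curl =
  fixes D E :: diagram and x C :: dart
  assumes invD: "involutive D" and invE: "involutive E"
    and crossings_E: "crossings E = insert (fst C) (crossings D)"
    and fresh: "fst C \<notin> crossings D"
    and x: "x \<in> darts D"
    and glue_E: "glue E x = turn C 2" "glue E (glue D x) = turn C 3" "glue E C = turn C 1"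
    and glue_E_old: "\<And>z. z \<in> darts D \<Longrightarrow> z \<notin> {x, glue D x} \<Longrightarrow> glue E z = glue D z"
begin

lemma glue_E' [simp]: "glue E x = turn C 2" "glue E (glue D x) = turn C 3" "glue E C = turn C 1"
  "glue E (turn C 2) = x" "glue E (turn C 3) = glue D x" "glue E (turn C 1) = C"
  using glue_E by (simp_all) (metis glue_E glue_glue[OF invE])+

lemma darts_E: "d \<in> darts E \<longleftrightarrow> d \<in> darts D \<or> fst d = fst C"
  by (auto simp: in_darts_iff crossings_E)

lemma darts_E_cases:
  assumes "d \<in> darts E"
  obtains "d \<in> darts D" | "d = C" | "d = turn C 1" | "d = turn C 2" | "d = turn C 3"
  using assms same_crossing_turn[of d C] unfolding darts_E by blast

lemma old_neq [simp]:
  assumes "z \<in> darts D"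
  shows "z \<noteq> C" "z \<noteq> turn C n" "C \<noteq> z" "turn C n \<noteq> z"
  using assms fresh by (auto simp: in_darts_iff)

lemma in_D [simp]: "x \<in> darts D" "glue D x \<in> darts D" "glue D x \<noteq> x" "x \<noteq> glue D x" "C \<notin> darts D"
  using x invD glue_neq[OF invD x] by (auto simp: fresh in_darts_iff[of C])

lemma glue_E_cases:
  assumes "z \<in> darts D"
  obtains "z = x" | "z = glue D x" | "z \<notin> {x, glue D x}" "glue E z = glue D z"
  using glue_E_old assms by blast

lemma connected:
  assumes conn: "connected_diagram D"
  shows "connected_diagram E"
  unfolding connected_diagram_def
proof (intro allI impI)
  fix S assume S: "S \<subseteq> darts E" "S \<noteq> {}" "glue E ` S \<subseteq> S" "\<forall>d\<in>S. turn d 2 \<in> S"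
  have g: "glue E d \<in> S" if "d \<in> S" for d using S(3) that by blast
  have t: "turn d 2 \<in> S" if "d \<in> S" for d using S(4) that by blast
  have "x \<in> S \<Longrightarrow> turn C 2 \<in> S" "turn C 2 \<in> S \<Longrightarrow> C \<in> S" "C \<in> S \<Longrightarrow> turn C 1 \<in> S"
    "turn C 1 \<in> S \<Longrightarrow> turn C 3 \<in> S" "turn C 3 \<in> S \<Longrightarrow> glue D x \<in> S"
    "glue D x \<in> S \<Longrightarrow> turn C 3 \<in> S" "turn C 3 \<in> S \<Longrightarrow> turn C 1 \<in> S" "turn C 1 \<in> S \<Longrightarrow> C \<in> S"
    "C \<in> S \<Longrightarrow> turn C 2 \<in> S" "turn C 2 \<in> S \<Longrightarrow> x \<in> S"
    using g[of x] t[of "turn C 2"] g[of C] t[of "turn C 1"] g[of "turn C 3"] g[of "glue D x"]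
      t[of "turn C 3"] g[of "turn C 1"] t[of C] g[of "turn C 2"] by simp_all
  then have xs: "turn C 1 \<in> S \<longleftrightarrow> x \<in> S" "turn C 3 \<in> S \<longleftrightarrow> x \<in> S" "turn C 2 \<in> S \<longleftrightarrow> x \<in> S"
    "C \<in> S \<longleftrightarrow> x \<in> S" "glue D x \<in> S \<longleftrightarrow> x \<in> S"
    by blast+
  obtain s where s: "s \<in> S" "s \<in> darts D"
  proof -
    obtain s where s: "s \<in> S" using S(2) by blast
    then have "s \<in> darts E" using S(1) by blast
    then consider "s \<in> darts D" | "x \<in> S"
      by (rule darts_E_cases) (use s xs in simp_all)
    then show ?thesis using that[of s] that[of x] s by cases simp_all
  qed
  have "S \<inter> darts D = darts D"
  proof (rule connected_diagramD[OF conn])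
    show "s \<in> S \<inter> darts D" using s by blast
    show "glue D d \<in> S \<inter> darts D" if "d \<in> S \<inter> darts D" for d
    proof -
      have "d \<in> darts D" using that by blast
      then show ?thesis
      proof (cases rule: glue_E_cases)
        case 3 then show ?thesis using that g[of d] invD by auto
      qed (use that xs invD in \<open>auto simp: glue_glue\<close>)
    qed
    show "turn d 2 \<in> S \<inter> darts D" if "d \<in> S \<inter> darts D" for d
      using that t[of d] by auto
  qed blast
  then have D: "d \<in> S" if "d \<in> darts D" for d using that by blast
  have "d \<in> S" if "d \<in> darts E" for d
    using that by (rule darts_E_cases) (use xs D in_D in simp_all)
  then show "S = darts E" using S(1) by blast
qed

lemma face_step_E [simp]:
  "face_step E x = turn C 1" "face_step E (glue D x) = turn C 2" "face_step E C = C"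
  "face_step E (turn C 1) = turn C 3" "face_step E (turn C 2) = face_step D (glue D x)"
  "face_step E (turn C 3) = face_step D x"
  by (simp_all add: face_step_turn glue_glue[OF invD])

text \<open>The loop is the new face \<open>{C}\<close>. On the other darts the curl only lengthens
  old faces: their first return map to the darts of \<open>D\<close> is the old face
  permutation.\<close>

lemma card_faces: "card (orbit (face_step E) ` darts E) = card (orbit (face_step D) ` darts D) + 1"
proof -
  let ?f = "face_step E" and ?g = "face_step D"
  define X where "X = darts E - {C}"
  define \<pi> where "\<pi> = (\<lambda>d. if d \<in> darts D then d else if d = turn C 2 then glue D x else x)"
  have finE: "finite (darts E)" and finD: "finite (darts D)"
    using involutive_finite invD invE by auto
  have DX: "darts D \<subseteq> X" by (auto simp: X_def darts_E)
  have X_cases: "z \<in> darts D \<or> z \<in> {turn C 1, turn C 2, turn C 3}" if "z \<in> X" for z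
    using that unfolding X_def by (auto elim: darts_E_cases)
  have old: "?f z = ?g z" if "z \<in> darts D" "z \<notin> {x, glue D x}" for z
    using that glue_E_old by (simp add: face_step_turn)
  have fX: "?f ` X \<subseteq> X"
  proof -
    have "?f z \<in> X" if "z \<in> X" for z
    proof (cases "z \<in> darts D")
      case True
      then show ?thesis
      proof (cases rule: glue_E_cases)
        case 3
        then show ?thesis using old[of z] True DX invD by auto
      qed (auto simp: X_def darts_E)
    next
      case False
      then show ?thesis using X_cases[OF that] DX invD
        by (auto simp: X_def darts_E)
    qed
    then show ?thesis by blast
  qed
  have f_orb: "?f (?f z) \<in> orbit ?f z" for z by (blast intro: orbit.intros)
  have "card (orbit ?f ` X) = card (orbit ?g ` darts D)"
  proof (rule card_orbits_first_return[where \<pi> = \<pi>])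
    show "finite X" using finE by (simp add: X_def)
    show "inj_on ?f X" "inj_on ?g (darts D)" using inj_face_step invD invE by auto
    show "?f ` X \<subseteq> X" "?g ` darts D \<subseteq> darts D" "darts D \<subseteq> X"
      using fX face_step_image[OF invD] DX by auto
    show "\<pi> z = z" if "z \<in> darts D" for z using that by (simp add: \<pi>_def)
    show "?g z \<in> orbit ?f z" if "z \<in> darts D" for z
      using that
    proof (cases rule: glue_E_cases)
      case 1 then show ?thesis using orbit.step[OF f_orb[of x]] by simp
    next
      case 2 then show ?thesis using f_orb[of "glue D x"] by simp
    next
      case 3
      then show ?thesis using old[OF that 3(1)] orbit.base[of ?f z] by simp
    qed
    show "\<pi> (?f z) = \<pi> z \<or> \<pi> (?f z) = ?g (\<pi> z)" if "z \<in> X" for z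
    proof (cases "z \<in> darts D")
      case True
      then show ?thesis
      proof (cases rule: glue_E_cases)
        case 3
        then show ?thesis using old[of z] True invD by (auto simp: \<pi>_def)
      qed (auto simp: \<pi>_def)
    next
      case False
      then show ?thesis using X_cases[OF that] invD by (auto simp: \<pi>_def)
    qed
    show "\<pi> z \<in> darts D \<and> z \<in> orbit ?f (\<pi> z)" if "z \<in> X" for z
    proof (cases "z \<in> darts D")
      case True
      then show ?thesis using finite_inj_self_in_orbit[OF finE inj_face_step[OF invE]]
          face_step_image[OF invE] by (auto simp: \<pi>_def darts_E)
    next
      case False
      have o: "turn C 1 \<in> orbit ?f x" "turn C 3 \<in> orbit ?f x" "turn C 2 \<in> orbit ?f (glue D x)"
        using orbit.base[of ?f x] f_orb[of x] orbit.base[of ?f "glue D x"] by simp_all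
      then show ?thesis using X_cases[OF that] False by (auto simp: \<pi>_def)
    qed
  qed
  moreover have "card (orbit ?f ` (X \<union> {C})) = card (orbit ?f ` X) + card (orbit ?f ` {C})"
    by (rule card_orbits_Un) (use finE fX in \<open>auto simp: X_def\<close>)
  moreover have "X \<union> {C} = darts E" by (auto simp: X_def darts_E)
  moreover have "card (orbit ?f ` {C}) = 1" by simp
  ultimately show ?thesis by (metis (no_types))
qed

lemma classical:
  assumes "classical_diagram D"
  shows "classical_diagram E"
proof -
  have "crossings D \<noteq> {}" using x by (auto simp: in_darts_iff)
  moreover have "card (crossings E) = card (crossings D) + 1"
    unfolding crossings_E using fresh involutive_finite(1)[OF invD] by simp
  ultimately show ?thesis
    using card_faces connected invE assms by (auto simp: classical_diagram_iff crossings_E)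
qed

lemma R1_decreasing: "R1_decreasing E (fst C) D"
  unfolding R1_decreasing_def
proof (intro conjI exI)
  show "face_step E (fst C, snd C) = (fst C, snd C)" by simp
  have st: "straight_to {fst C} E d (glue D d)" if d: "d \<in> darts D" for d
  proof -
    have stop: "straight_to {fst C} E a (glue E a)" if "glue E a \<in> darts D" for a
      by (rule straight_to.stop) (use that fresh in \<open>auto simp: in_darts_iff\<close>)
    have pass: "straight_to {fst C} E a e"
      if "glue E a = turn C n" "straight_to {fst C} E (turn C (n + 2)) e" for a n e
      by (rule straight_to.pass) (use that in \<open>auto simp: straight_step_turn\<close>)
    from d show ?thesis
    proof (cases rule: glue_E_cases)
      case 1
      show ?thesis unfolding 1
        by (rule pass[of _ 2], simp, rule pass[of _ 1], simp)
          (use stop[of "turn C 3"] in simp)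
    next
      case 2
      show ?thesis unfolding 2
        by (rule pass[of _ 3], simp, rule pass[of _ 0], simp)
          (use stop[of "turn C 2"] invD in simp)
    next
      case 3
      then show ?thesis using stop[of d] d invD by simp
    qed
  qed
  show "erased {fst C} E D"
    unfolding erased_def using st fresh by (auto simp: crossings_E)
qed (use crossings_E in auto)

end

definition add_curl :: "diagram \<Rightarrow> dart \<Rightarrow> dart \<Rightarrow> diagram" where
  "add_curl D x C = D\<lparr>crossings := insert (fst C) (crossings D),
     glue := (glue D)(x := turn C 2, turn C 2 := x, glue D x := turn C 3, turn C 3 := glue D x,
       C := turn C 1, turn C 1 := C)\<rparr>"

lemma R1_curl_add_curl:
  assumes D: "involutive D" and fresh: "fst C \<notin> crossings D" and x: "x \<in> darts D"
  shows "R1_curl D (add_curl D x C) x C"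
proof -
  let ?E = "add_curl D x C"
  have old [simp]: "z \<noteq> C" "z \<noteq> turn C n" "C \<noteq> z" "turn C n \<noteq> z" if "z \<in> darts D" for z n
    using that fresh by (auto simp: in_darts_iff)
  have in_D [simp]: "x \<in> darts D" "glue D x \<in> darts D" "glue D x \<noteq> x" "x \<noteq> glue D x"
    using x D glue_neq[OF D x] by auto
  have cr: "crossings ?E = insert (fst C) (crossings D)" by (simp add: add_curl_def)
  have eqs [simp]: "glue ?E x = turn C 2" "glue ?E (glue D x) = turn C 3" "glue ?E C = turn C 1"
    "glue ?E (turn C 2) = x" "glue ?E (turn C 3) = glue D x" "glue ?E (turn C 1) = C"
    by (simp_all add: add_curl_def)
  have other: "glue ?E z = glue D z" if "z \<notin> {x, glue D x}" "fst z \<noteq> fst C" for z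
    using that by (auto simp: add_curl_def)
  have darts: "d \<in> darts ?E \<longleftrightarrow> d \<in> darts D \<or> fst d = fst C" for d
    by (auto simp: in_darts_iff cr)
  have "involutive ?E"
  proof (rule involutiveI)
    show "finite (crossings ?E)" using involutive_finite[OF D] by (simp add: cr)
    show "glue ?E d = d" if "d \<notin> darts ?E" for d
    proof -
      have "d \<notin> darts D" using that darts by blast
      then have "glue D d = d" "d \<notin> {x, glue D x}"
        using glue_outside[OF D] in_D by auto
      then show ?thesis using that other[of d] by (auto simp: darts)
    qed
    show "glue ?E d \<in> darts ?E \<and> glue ?E d \<noteq> d \<and> glue ?E (glue ?E d) = d" if "d \<in> darts ?E" for d
    proof (cases "d \<in> darts D")
      case True
      show ?thesis
      proof (cases "d \<in> {x, glue D x}")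
        case True
        then show ?thesis by (auto simp: darts)
      next
        case False
        have "fst z \<noteq> fst C" if "z \<in> darts D" for z
          using that fresh by (auto simp: in_darts_iff)
        moreover have "glue D d \<notin> {x, glue D x}"
          using False glue_eq_iff[OF D, of d] glue_inject[OF D, of d] by auto
        ultimately have "glue ?E d = glue D d" "glue ?E (glue D d) = d"
          using other[of d] other[of "glue D d"] False True D by auto
        then show ?thesis using True D glue_neq by (auto simp: darts)
      qed
    next
      case False
      then have "fst d = fst C" using that darts by blast
      then show ?thesis using same_crossing_turn[of d C] by (auto simp: darts)
    qed
  qed
  then show ?thesis
  proof unfold_locales
    show "glue ?E z = glue D z" if "z \<in> darts D" "z \<notin> {x, glue D x}" for z
    proof (rule other[OF that(2)])
      have "fst z \<in> crossings D" using that(1) by (simp add: in_darts_iff)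
      then show "fst z \<noteq> fst C" using fresh by metis
    qed
  qed (use D fresh x cr in simp_all)
qed

section \<open>Third Reidemeister moves\<close>

lemma orbit_conj_involution:
  assumes "\<And>z. p (p z) = z"
  shows "orbit (\<lambda>z. p (f (p z))) z = p ` orbit f (p z)"
proof
  show "orbit (\<lambda>z. p (f (p z))) z \<subseteq> p ` orbit f (p z)"
  proof
    fix w assume "w \<in> orbit (\<lambda>z. p (f (p z))) z"
    then show "w \<in> p ` orbit f (p z)"
      by induction (auto simp: assms intro: orbit.intros)
  qed
  show "p ` orbit f (p z) \<subseteq> orbit (\<lambda>z. p (f (p z))) z"
  proof (rule image_subsetI)
    fix w assume "w \<in> orbit f (p z)"
    then show "p w \<in> orbit (\<lambda>z. p (f (p z))) z"
    proof induction
      case (step w)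
      from orbit.step[OF step.IH] show ?case by (simp add: assms)
    qed (rule orbit.base)
  qed
qed

lemma card_orbits_conj_involution:
  assumes p: "\<And>z. p (p z) = z" and X: "p ` X \<subseteq> X"
  shows "card (orbit (\<lambda>z. p (f (p z))) ` X) = card (orbit f ` X)"
proof -
  have "x \<in> p ` X" if "x \<in> X" for x
    using that X p by (metis image_eqI image_subset_iff)
  then have "p ` X = X" using X by blast
  have "orbit (\<lambda>z. p (f (p z))) ` X = (`) p ` orbit f ` p ` X"
    by (auto simp: orbit_conj_involution[of p, OF p])
  also have "\<dots> = (`) p ` orbit f ` X" using \<open>p ` X = X\<close> by simp
  finally have eq: "orbit (\<lambda>z. p (f (p z))) ` X = (`) p ` orbit f ` X" .
  have "inj p" by (rule injI) (metis p)
  then have "inj ((`) p)" by (intro injI) (simp add: inj_image_eq_iff)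
  then show ?thesis
    unfolding eq by (meson card_image inj_on_subset subset_UNIV)
qed

text \<open>The equations for \<open>glue\<close> say in terms of gluing that \<open>a\<close>,
  \<open>b\<close>, \<open>c\<close> run around a triangular face. Only the plane graph is fixed
  here; the levels of the strands enter in \<open>R3_move\<close>.\<close>

locale R3_triangle =
  fixes D :: diagram and a b c :: dart
  assumes invD: "involutive D"
    and in_D: "a \<in> darts D" "b \<in> darts D" "c \<in> darts D"
    and distinct: "fst a \<noteq> fst b" "fst b \<noteq> fst c" "fst a \<noteq> fst c"
    and glue: "glue D a = turn b 1" "glue D b = turn c 1" "glue D c = turn a 1"
begin

definition p :: "dart \<Rightarrow> dart" where
  "p = triangle_swap D ({a, b, c} \<union> glue D ` {a, b, c})"

definition E :: diagram where
  "E = D\<lparr>glue := p \<circ> glue D \<circ> p\<rparr>"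

lemma glue' [simp]: "glue D a = turn b 1" "glue D b = turn c 1" "glue D c = turn a 1"
  "glue D (turn b 1) = a" "glue D (turn c 1) = b" "glue D (turn a 1) = c"
  using glue by (simp_all) (metis glue glue_glue[OF invD])+

lemma neq [simp]: "a \<noteq> b" "b \<noteq> a" "a \<noteq> c" "c \<noteq> a" "b \<noteq> c" "c \<noteq> b"
  "a \<noteq> turn b n" "a \<noteq> turn c n" "b \<noteq> turn a n" "b \<noteq> turn c n" "c \<noteq> turn a n" "c \<noteq> turn b n"
  "turn b n \<noteq> a" "turn c n \<noteq> a" "turn a n \<noteq> b" "turn c n \<noteq> b" "turn a n \<noteq> c" "turn b n \<noteq> c"
  "turn a m \<noteq> turn b n" "turn b n \<noteq> turn a m" "turn a m \<noteq> turn c n" "turn c n \<noteq> turn a m"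
  "turn b m \<noteq> turn c n" "turn c n \<noteq> turn b m"
  using distinct by (metis fst_turn)+

lemma p_simps [simp]:
  "p a = turn b 3" "p b = turn c 3" "p c = turn a 3"
  "p (turn a 1) = turn c 2" "p (turn b 1) = turn a 2" "p (turn c 1) = turn b 2"
  "p (turn a 2) = turn b 1" "p (turn b 2) = turn c 1" "p (turn c 2) = turn a 1"
  "p (turn a 3) = c" "p (turn b 3) = a" "p (turn c 3) = b"
  by (simp_all add: p_def triangle_swap_def opposite_turn)

lemma p_other: "d \<notin> {a, b, c} \<Longrightarrow> (\<And>n. d \<notin> {turn a n, turn b n, turn c n}) \<Longrightarrow> p d = d"
proof -
  assume d: "d \<notin> {a, b, c}" "\<And>n. d \<notin> {turn a n, turn b n, turn c n}"
  have "opposite d \<notin> {a, b, c} \<union> glue D ` {a, b, c}"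
  proof
    assume "opposite d \<in> {a, b, c} \<union> glue D ` {a, b, c}"
    then obtain n where "turn d 2 \<in> {turn a n, turn b n, turn c n}"
      by (auto simp: opposite_turn) (metis turn_0)+
    then have "turn d 2 = turn a n \<or> turn d 2 = turn b n \<or> turn d 2 = turn c n" by simp
    moreover have "d = turn (turn d 2) 2" by simp
    ultimately have "d = turn a (n + 2) \<or> d = turn b (n + 2) \<or> d = turn c (n + 2)" by (metis turn_turn)
    then show False using d(2)[of "n + 2"] by simp
  qed
  then show ?thesis using d(1) d(2)[of 1] by (simp add: p_def triangle_swap_def)
qed

lemma dart_cases:
  obtains "d \<in> {a, turn a 1, turn a 2, turn a 3}" | "d \<in> {b, turn b 1, turn b 2, turn b 3}"
    | "d \<in> {c, turn c 1, turn c 2, turn c 3}"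
    | "fst d \<noteq> fst a" "fst d \<noteq> fst b" "fst d \<noteq> fst c" "p d = d"
proof (cases "fst d = fst a \<or> fst d = fst b \<or> fst d = fst c")
  case True
  then show ?thesis
    using that same_crossing_turn[of d a] same_crossing_turn[of d b] same_crossing_turn[of d c] by blast
next
  case False
  then have "d \<notin> {a, b, c}" "d \<notin> {turn a n, turn b n, turn c n}" for n by auto
  then have "p d = d" by (rule p_other)
  then show ?thesis using that(4) False by blast
qed

lemma p_p [simp]: "p (p d) = d"
  by (rule dart_cases[of d]) auto

text \<open>Strands stay straight through the exchange; this is what carries connectivity
  over.\<close>

lemma p_turn2: "p (turn d 2) = turn (p d) 2"
proof (rule dart_cases[of d])
  assume "fst d \<noteq> fst a" "fst d \<noteq> fst b" "fst d \<noteq> fst c" "p d = d"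
  then show ?thesis
    by (cases rule: dart_cases[of "turn d 2"]) (auto dest: arg_cong[of _ _ fst])
qed auto

lemma p_in [simp]: "p d \<in> darts D \<longleftrightarrow> d \<in> darts D"
  using in_D by (rule_tac dart_cases[of d]) auto

lemma darts_E [simp]: "darts E = darts D"
  by (simp add: E_def darts_def)

lemma glue_E: "glue E d = p (glue D (p d))"
  by (simp add: E_def)

lemma invE: "involutive E"
proof (rule involutiveI)
  show "finite (crossings E)" using involutive_finite[OF invD] by (simp add: E_def)
  show "glue E d = d" if "d \<notin> darts E" for d
    using that glue_outside[OF invD, of "p d"] by (simp add: glue_E)
  show "glue E d \<in> darts E \<and> glue E d \<noteq> d \<and> glue E (glue E d) = d" if "d \<in> darts E" for d
    using that invD glue_neq[OF invD, of "p d"] by (auto simp: glue_E glue_glue) (metis p_p)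
qed

lemma connected:
  assumes conn: "connected_diagram D"
  shows "connected_diagram E"
  unfolding connected_diagram_def
proof (intro allI impI)
  fix S assume S: "S \<subseteq> darts E" "S \<noteq> {}" "glue E ` S \<subseteq> S" "\<forall>d\<in>S. turn d 2 \<in> S"
  then obtain s where s: "s \<in> S" by blast
  have "p ` S = darts D"
  proof (rule connected_diagramD[OF conn])
    show "p ` S \<subseteq> darts D" using S(1) by auto
    show "p s \<in> p ` S" using s by blast
    show "glue D d \<in> p ` S" if d: "d \<in> p ` S" for d
    proof -
      obtain e where e: "e \<in> S" "d = p e" using d by blast
      then have "p (glue D d) \<in> S" using S(3) by (auto simp: glue_E)
      then show ?thesis by (metis image_eqI p_p)
    qed
    show "turn d 2 \<in> p ` S" if "d \<in> p ` S" for d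
      using that S(4) by (auto simp: p_turn2[symmetric])
  qed
  then have "e \<in> S" if "e \<in> darts D" for e
    using that by (metis (no_types, lifting) imageE p_in p_p)
  then show "S = darts E" using S(1) by auto
qed

text \<open>Off the sides of the triangle, an edge arrives at one of the six outward darts of its
  corners or at a crossing that the move does not touch.\<close>

lemma side_free:
  assumes "d \<in> darts D - {a, b, c, turn a 1, turn b 1, turn c 1}"
  obtains "glue D d = turn a 2" | "glue D d = turn b 2" | "glue D d = turn c 2"
    | "glue D d = turn a 3" | "glue D d = turn b 3" | "glue D d = turn c 3"
    | "fst (glue D d) \<notin> {fst a, fst b, fst c}" "p (glue D d) = glue D d"
proof (rule dart_cases[of "glue D d"])
  have d: "d = glue D (glue D d)" using glue_glue[OF invD] by simp
  assume 1: "glue D d \<in> {a, turn a 1, turn a 2, turn a 3}"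
  show thesis using 1 that d assms by (metis (no_types, lifting) DiffD2 glue' insert_iff empty_iff)
next
  have d: "d = glue D (glue D d)" using glue_glue[OF invD] by simp
  assume 1: "glue D d \<in> {b, turn b 1, turn b 2, turn b 3}"
  show thesis using 1 that d assms by (metis (no_types, lifting) DiffD2 glue' insert_iff empty_iff)
next
  have d: "d = glue D (glue D d)" using glue_glue[OF invD] by simp
  assume 1: "glue D d \<in> {c, turn c 1, turn c 2, turn c 3}"
  show thesis using 1 that d assms by (metis (no_types, lifting) DiffD2 glue' insert_iff empty_iff)
qed (use that in auto)

text \<open>
  The six ends of strands that leave the triangle are met in the same cyclic order before and after
  the move, so both face permutations have the same first return map to the darts that are not on
  a side of the triangle.
\<close>

lemma card_faces: "card (orbit (face_step E) ` darts E) = card (orbit (face_step D) ` darts D)"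
proof -
  let ?f = "face_step D"
  let ?sides = "{a, b, c, turn a 1, turn b 1, turn c 1}"
  \<comment> \<open>Conjugation by \<open>p\<close> brings the faces of \<open>E\<close> back to the
    positions of \<open>D\<close>, so that the gluing of \<open>D\<close> occurs in both face
    permutations.\<close>
  define f' where "f' = (\<lambda>d. p (face_step E (p d)))"
  define Y where "Y = darts D - ?sides"
  \<comment> \<open>In \<open>D\<close> a face arriving at \<open>turn a 2\<close> runs along a side
    and leaves by \<open>turn c 3\<close>, while one arriving at \<open>turn a 3\<close> only
    touches the corner. After the move it is the other way round; once the darts of the sides are
    skipped, no difference remains.\<close>
  define r where "r = (\<lambda>d. if glue D d = turn a 2 then turn c 3 else if glue D d = turn b 2 then turn a 3
    else if glue D d = turn c 2 then turn b 3 else ?f d)"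
  have fin: "finite (darts D)" using involutive_finite[OF invD] by simp
  have f': "f' d = p (turn (p (glue D d)) 3)" for d
    by (simp add: f'_def face_step_turn glue_E)
  have f: "?f d = turn (glue D d) 3" for d by (simp add: face_step_turn)
  have glue_Y: "glue D d \<in> Y" if "d \<in> Y" for d
    using that invD unfolding Y_def by (auto simp: glue_eq_iff)
  have Y_out [simp]: "turn a 2 \<in> Y" "turn b 2 \<in> Y" "turn c 2 \<in> Y" "turn a 3 \<in> Y" "turn b 3 \<in> Y" "turn c 3 \<in> Y"
    using in_D by (auto simp: Y_def)
  have Y_sides: "a \<notin> Y" "b \<notin> Y" "c \<notin> Y" "turn a 1 \<notin> Y" "turn b 1 \<notin> Y" "turn c 1 \<notin> Y"
    by (auto simp: Y_def)
  have YD: "Y \<subseteq> darts D" by (auto simp: Y_def)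
  have far: "turn d n \<in> Y" if "d \<in> darts D" "fst d \<notin> {fst a, fst b, fst c}" for d n
    using that by (auto simp: Y_def dest: arg_cong[of _ _ fst])
  have rY: "r d \<in> Y" if d: "d \<in> Y" for d
    using d[unfolded Y_def]
  proof (cases rule: side_free)
    case 7
    then show ?thesis using far[of "glue D d" 3] d YD invD by (auto simp: r_def f)
  qed (simp_all add: r_def f)
  have inj_r: "inj_on r Y"
  proof (rule inj_onI)
    fix d e assume d: "d \<in> Y" and e: "e \<in> Y" and eq: "r d = r e"
    define q where "q = (\<lambda>u. if u = turn a 2 then c else if u = turn b 2 then a else if u = turn c 2 then b else u)"
    have rq: "r z = turn (q (glue D z)) 3" for z by (simp add: r_def q_def f)
    have "u = v" if "u \<in> Y" "v \<in> Y" "q u = q v" for u v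
      using that Y_sides(1-3) unfolding q_def by (metis neq(1,3,5))
    then have "glue D d = glue D e"
      using eq glue_Y[OF d] glue_Y[OF e] by (simp add: rq turn_inject)
    then show "d = e" by (simp add: glue_inject[OF invD])
  qed
  have o1: "?f z \<in> orbit ?f z" "?f (?f z) \<in> orbit ?f z" for z
    by (blast intro: orbit.intros)+
  have o2: "f' z \<in> orbit f' z" "f' (f' z) \<in> orbit f' z" for z
    by (blast intro: orbit.intros)+
  define \<pi> where "\<pi> = (\<lambda>d. if d \<in> Y then d else if d = turn a 1 then glue D (turn a 2)
    else if d = turn b 1 then glue D (turn b 2) else glue D (turn c 2))"
  define \<pi>' where "\<pi>' = (\<lambda>d. if d \<in> Y then d else if d = b then glue D (turn a 3)
    else if d = c then glue D (turn b 3) else glue D (turn c 3))"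
  have glue_out: "glue D (turn a 2) \<in> Y" "glue D (turn b 2) \<in> Y" "glue D (turn c 2) \<in> Y"
    "glue D (turn a 3) \<in> Y" "glue D (turn b 3) \<in> Y" "glue D (turn c 3) \<in> Y"
    using glue_Y by auto
  have old: "?f d = r d" "f' d = r d" if "d \<in> Y" "fst (glue D d) \<notin> {fst a, fst b, fst c}" for d
  proof -
    have "p (glue D d) = glue D d" "p (turn (glue D d) 3) = turn (glue D d) 3"
      using that(2) by (auto intro!: p_other dest: arg_cong[of _ _ fst])
    moreover have "glue D d \<notin> {turn a 2, turn b 2, turn c 2}" using that(2) by auto
    ultimately show "?f d = r d" "f' d = r d" by (simp_all add: r_def f f')
  qed
  have f_sides: "?f (turn a 1) = turn c 3" "?f (turn b 1) = turn a 3" "?f (turn c 1) = turn b 3"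
    by (simp_all add: f)
  have f'_sides: "f' a = turn c 2" "f' b = turn a 2" "f' c = turn b 2"
    by (simp_all add: f')
  have Y_cases: thesis
    if d: "d \<in> Y" and "d = glue D (turn a 2) \<Longrightarrow> thesis" "d = glue D (turn b 2) \<Longrightarrow> thesis"
      "d = glue D (turn c 2) \<Longrightarrow> thesis" "d = glue D (turn a 3) \<Longrightarrow> thesis"
      "d = glue D (turn b 3) \<Longrightarrow> thesis" "d = glue D (turn c 3) \<Longrightarrow> thesis"
      "?f d = r d \<Longrightarrow> f' d = r d \<Longrightarrow> thesis" for d thesis
    using d[unfolded Y_def]
  proof (cases rule: side_free)
    case 7 then show thesis using old[OF d] that(8) by blast
  qed (use that in \<open>simp_all add: glue_eq_iff[OF invD]\<close>)
  note gg = glue_glue[OF invD]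
  have f_ends: "?f (glue D (turn a 2)) = turn a 1" "?f (glue D (turn b 2)) = turn b 1"
    "?f (glue D (turn c 2)) = turn c 1" "?f (glue D (turn a 3)) = turn a 2"
    "?f (glue D (turn b 3)) = turn b 2" "?f (glue D (turn c 3)) = turn c 2"
    by (simp_all add: f gg)
  have f'_ends: "f' (glue D (turn a 2)) = turn c 3" "f' (glue D (turn b 2)) = turn a 3"
    "f' (glue D (turn c 2)) = turn b 3" "f' (glue D (turn a 3)) = b"
    "f' (glue D (turn b 3)) = c" "f' (glue D (turn c 3)) = a"
    by (simp_all add: f' gg)
  have r_ends: "r (glue D (turn a 2)) = turn c 3" "r (glue D (turn b 2)) = turn a 3"
    "r (glue D (turn c 2)) = turn b 3" "r (glue D (turn a 3)) = turn a 2"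
    "r (glue D (turn b 3)) = turn b 2" "r (glue D (turn c 3)) = turn c 2"
    by (simp_all add: r_def f gg)
  have f_closed: "?f ` (Y \<union> {turn a 1, turn b 1, turn c 1}) \<subseteq> Y \<union> {turn a 1, turn b 1, turn c 1}"
  proof (rule image_subsetI)
    fix d assume "d \<in> Y \<union> {turn a 1, turn b 1, turn c 1}"
    then consider "d \<in> Y" | "d \<in> {turn a 1, turn b 1, turn c 1}" by blast
    then show "?f d \<in> Y \<union> {turn a 1, turn b 1, turn c 1}"
    proof cases
      case 1
      then show ?thesis by (rule Y_cases) (use rY[OF 1] in \<open>simp_all add: f_ends\<close>)
    qed (auto simp: f_sides)
  qed
  have f'_closed: "f' ` (Y \<union> {a, b, c}) \<subseteq> Y \<union> {a, b, c}"
  proof (rule image_subsetI)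
    fix d assume "d \<in> Y \<union> {a, b, c}"
    then consider "d \<in> Y" | "d \<in> {a, b, c}" by blast
    then show "f' d \<in> Y \<union> {a, b, c}"
    proof cases
      case 1
      then show ?thesis by (rule Y_cases) (use rY[OF 1] in \<open>simp_all add: f'_ends\<close>)
    qed (auto simp: f'_sides)
  qed
  have 1: "card (orbit ?f ` (Y \<union> {turn a 1, turn b 1, turn c 1})) = card (orbit r ` Y)"
  proof (rule card_orbits_first_return[where \<pi> = \<pi>])
    show "finite (Y \<union> {turn a 1, turn b 1, turn c 1})"
      using fin YD finite_subset by auto
    show "inj_on ?f (Y \<union> {turn a 1, turn b 1, turn c 1})" using inj_face_step[OF invD] .
    show "?f ` (Y \<union> {turn a 1, turn b 1, turn c 1}) \<subseteq> Y \<union> {turn a 1, turn b 1, turn c 1}"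
      using f_closed .
    show "inj_on r Y" "r ` Y \<subseteq> Y" "Y \<subseteq> Y \<union> {turn a 1, turn b 1, turn c 1}"
      using inj_r rY by auto
    show "\<pi> d = d" if "d \<in> Y" for d using that by (simp add: \<pi>_def)
    show "r d \<in> orbit ?f d" if "d \<in> Y" for d
      using that
    proof (rule Y_cases)
      assume "?f d = r d" then show ?thesis using o1(1)[of d] by simp
    qed (use o1 f_ends f_sides r_ends in metis)+
    show "\<pi> (?f z) = \<pi> z \<or> \<pi> (?f z) = r (\<pi> z)" if "z \<in> Y \<union> {turn a 1, turn b 1, turn c 1}" for z
    proof (cases "z \<in> Y")
      case True
      then show ?thesis
      proof (rule Y_cases)
        assume "?f z = r z" then show ?thesis using True rY by (simp add: \<pi>_def)
      qed (use glue_out Y_sides in \<open>simp_all add: \<pi>_def f_ends r_ends\<close>)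
    next
      case False
      then have "z \<in> {turn a 1, turn b 1, turn c 1}" using that by blast
      then show ?thesis using Y_sides by (elim insertE emptyE) (simp_all add: \<pi>_def f_sides r_ends)
    qed
    show "\<pi> z \<in> Y \<and> z \<in> orbit ?f (\<pi> z)" if "z \<in> Y \<union> {turn a 1, turn b 1, turn c 1}" for z
    proof (cases "z \<in> Y")
      case True
      then show ?thesis using finite_inj_self_in_orbit[OF fin inj_face_step[OF invD] face_step_image[OF invD], of z]
          YD by (auto simp: \<pi>_def)
    next
      case False
      then have "z \<in> {turn a 1, turn b 1, turn c 1}" using that by blast
      then show ?thesis
        using Y_sides glue_out o1(1)[of "\<pi> z"] by (elim insertE emptyE) (simp_all add: \<pi>_def f_ends)
    qed
  qed
  have inj_f': "inj_on f' X" for X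
    unfolding f'_def by (rule inj_onI) (metis p_p inj_face_step[OF invE] inj_eq)
  have f'D: "f' ` darts D \<subseteq> darts D"
    unfolding f'_def by (rule image_subsetI) (use face_step_in[OF invE] in simp)
  have 2: "card (orbit f' ` (Y \<union> {a, b, c})) = card (orbit r ` Y)"
  proof (rule card_orbits_first_return[where \<pi> = \<pi>'])
    show "finite (Y \<union> {a, b, c})"
      using fin YD finite_subset by auto
    show "inj_on f' (Y \<union> {a, b, c})" using inj_f' .
    show "f' ` (Y \<union> {a, b, c}) \<subseteq> Y \<union> {a, b, c}"
      using f'_closed .
    show "inj_on r Y" "r ` Y \<subseteq> Y" "Y \<subseteq> Y \<union> {a, b, c}"
      using inj_r rY by auto
    show "\<pi>' d = d" if "d \<in> Y" for d using that by (simp add: \<pi>'_def)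
    show "r d \<in> orbit f' d" if "d \<in> Y" for d
      using that
    proof (rule Y_cases)
      assume "f' d = r d" then show ?thesis using o2(1)[of d] by simp
    qed (use o2 f'_ends f'_sides r_ends in metis)+
    show "\<pi>' (f' z) = \<pi>' z \<or> \<pi>' (f' z) = r (\<pi>' z)" if "z \<in> Y \<union> {a, b, c}" for z
    proof (cases "z \<in> Y")
      case True
      then show ?thesis
      proof (rule Y_cases)
        assume "f' z = r z" then show ?thesis using True rY by (simp add: \<pi>'_def)
      qed (use glue_out Y_sides in \<open>simp_all add: \<pi>'_def f'_ends r_ends\<close>)
    next
      case False
      then have "z \<in> {a, b, c}" using that by blast
      then show ?thesis using Y_sides by (elim insertE emptyE) (simp_all add: \<pi>'_def f'_sides r_ends)
    qed
    show "\<pi>' z \<in> Y \<and> z \<in> orbit f' (\<pi>' z)" if "z \<in> Y \<union> {a, b, c}" for z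
    proof (cases "z \<in> Y")
      case True
      then show ?thesis using finite_inj_self_in_orbit[OF fin inj_f' f'D, of z] YD by (auto simp: \<pi>'_def)
    next
      case False
      then have "z \<in> {a, b, c}" using that by blast
      then show ?thesis
        using Y_sides glue_out o2(1)[of "\<pi>' z"] by (elim insertE emptyE) (simp_all add: \<pi>'_def f'_ends)
    qed
  qed
  \<comment> \<open>What remains is the triangle itself, which is one face before and one after the
    move.\<close>
  have f_cycle: "?f a = b" "?f b = c" "?f c = a" by (simp_all add: f)
  have f'_cycle: "f' (turn a 1) = turn b 1" "f' (turn b 1) = turn c 1" "f' (turn c 1) = turn a 1"
    by (simp_all add: f')
  have "card (orbit ?f ` ((Y \<union> {turn a 1, turn b 1, turn c 1}) \<union> {a, b, c}))
    = card (orbit ?f ` (Y \<union> {turn a 1, turn b 1, turn c 1})) + card (orbit ?f ` {a, b, c})"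
  proof (rule card_orbits_Un)
    show "?f ` (Y \<union> {turn a 1, turn b 1, turn c 1}) \<subseteq> Y \<union> {turn a 1, turn b 1, turn c 1}"
      using f_closed .
  qed (use fin YD Y_sides finite_subset in \<open>auto simp: f_cycle\<close>)
  moreover have "card (orbit f' ` ((Y \<union> {a, b, c}) \<union> {turn a 1, turn b 1, turn c 1}))
    = card (orbit f' ` (Y \<union> {a, b, c})) + card (orbit f' ` {turn a 1, turn b 1, turn c 1})"
  proof (rule card_orbits_Un)
    show "f' ` (Y \<union> {a, b, c}) \<subseteq> Y \<union> {a, b, c}"
      using f'_closed .
  qed (use fin YD Y_sides finite_subset in \<open>auto simp: f'_cycle\<close>)
  moreover have "(Y \<union> {turn a 1, turn b 1, turn c 1}) \<union> {a, b, c} = darts D"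
    "(Y \<union> {a, b, c}) \<union> {turn a 1, turn b 1, turn c 1} = darts D"
    using in_D by (auto simp: Y_def)
  moreover have "card (orbit ?f ` {a, b, c}) = 1" "card (orbit f' ` {turn a 1, turn b 1, turn c 1}) = 1"
    using orbit_three_cycle[OF f_cycle] orbit_three_cycle[OF f'_cycle] .
  ultimately have "card (orbit ?f ` darts D) = card (orbit f' ` darts D)"
    using 1 2 by metis
  also have "\<dots> = card (orbit (face_step E) ` darts D)"
    unfolding f'_def by (rule card_orbits_conj_involution) auto
  finally show ?thesis by simp
qed

lemma classical:
  assumes "classical_diagram D"
  shows "classical_diagram E"
proof -
  have "crossings E = crossings D" by (simp add: E_def)
  then show ?thesis
    using assms card_faces connected invE by (auto simp: classical_diagram_iff)
qed

lemma R3_move: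
  assumes "over d" "over (glue D d)" "d \<in> {a, b, c}"
  shows "R3_move D (fst a) (fst b) (fst c) E"
  unfolding R3_move_def
proof (intro conjI exI)
  show "face_step D a = b" "face_step D b = c" "face_step D c = a"
    by (simp_all add: face_step_turn)
  show "\<exists>d\<in>{a, b, c}. over d \<and> over (glue D d)" using assms by blast
  show "{fst a, fst b, fst c} \<subseteq> crossings D" using in_D by (simp add: in_darts_iff)
qed (use distinct in \<open>simp_all add: E_def p_def Let_def\<close>)

end

section \<open>Weak parities along moves\<close>

lemma diagram_morphism_snoc:
  assumes "diagram_morphism D ms D'" "elementary_morphism m D' D''"
  shows "diagram_morphism D (ms @ [(m, D'')]) D''"
  using assms
proof induction
  case (Nil D)
  then show ?case
    by (auto simp: elementary_morphism_def intro!: diagram_morphism.intros)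
qed (auto intro: diagram_morphism.Cons)

lemma diagram_morphism_classical:
  "diagram_morphism D ms D' \<Longrightarrow> classical_diagram D \<and> classical_diagram D'"
  by (induction rule: diagram_morphism.induct) (auto simp: elementary_morphism_def)

text \<open>The effect of \<open>triangle_swap\<close> on the old darts for the triangle
  \<open>turn C 1\<close>, \<open>P\<close>, \<open>W\<close>, written without the intermediate
  diagram in which the triangle lies.\<close>

definition slide_map :: "dart \<Rightarrow> dart \<Rightarrow> dart \<Rightarrow> dart \<Rightarrow> dart" where
  "slide_map C W P z =
     (if z = C then W else if z = turn C 1 then turn P 3 else if z = turn C 2 then turn W 2
      else if z = turn C 3 then turn P 1 else if z = W then C else if z = turn W 1 then turn P 2
      else if z = turn W 2 then turn C 2 else if z = turn W 3 then P else z)"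

locale knot_weak_parity =
  fixes K :: "diagram set" and \<psi> :: "diagram \<Rightarrow> nat \<Rightarrow> int"
  assumes K: "K \<in> classical_knots" and weak_parity: "weak_parity K \<psi>"
begin

lemma K_reachable:
  obtains D0 where "classical_diagram D0" "K = {D'. \<exists>ms. diagram_morphism D0 ms D'}"
  using K by (auto simp: classical_knots_def knot_equivalence_def elim!: quotientE)

lemma K_classical: "D \<in> K \<Longrightarrow> classical_diagram D"
  by (rule K_reachable) (use diagram_morphism_classical in blast)

lemma K_involutive: "D \<in> K \<Longrightarrow> involutive D"
  using K_classical classical_diagram_iff by blast

lemma K_step:
  assumes "D \<in> K" "classical_diagram D'" "realizes m D D'"
  shows "D' \<in> K" "elementary_morphism m D D'"
proof -
  show m: "elementary_morphism m D D'"
    using assms K_classical by (simp add: elementary_morphism_def)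
  then show "D' \<in> K"
    using assms(1) by (rule_tac K_reachable) (use diagram_morphism_snoc in blast)
qed

lemma parity_values: "D \<in> K \<Longrightarrow> v \<in> crossings D \<Longrightarrow> \<psi> D v = 0 \<or> \<psi> D v = 1"
  using weak_parity by (auto simp: weak_parity_def)

lemma parity_0:
  assumes "D \<in> K" "D' \<in> K" "elementary_morphism m D D'" "v \<in> crossings D - participants m"
  shows "\<psi> D v = \<psi> D' (the (induced m D v))"
  using weak_parity assms unfolding weak_parity_def by blast

text \<open>Membership in the knot is asked of either end, as the lemma serves for pushing a strand
  as well as for taking a bigon away.\<close>

lemma parity_R2:
  assumes R2: "R2_pair D E x y P Q" and "D \<in> K \<or> E \<in> K"
    and split: "turn Q 3 \<notin> orbit (face_step E) P"
  shows "D \<in> K" "E \<in> K" "\<psi> E (fst P) = \<psi> E (fst Q)"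
    and "\<And>v. v \<in> crossings D \<Longrightarrow> \<psi> E v = \<psi> D v"
proof -
  interpret R2_pair D E x y P Q by (rule R2)
  have cl: "classical_diagram D" "classical_diagram E"
    using assms(2) K_classical classical_iff[OF split] by blast+
  have "realizes (R2_dec (fst P) (fst Q)) E D" "realizes (R2_inc (fst P) (fst Q)) D E"
    using R2_decreasing by simp_all
  then show DE: "D \<in> K" "E \<in> K" using assms(2) K_step cl by blast+
  then have m: "elementary_morphism (R2_dec (fst P) (fst Q)) E D"
    using \<open>realizes (R2_dec _ _) E D\<close> K_step cl by blast
  then show "\<psi> E (fst P) = \<psi> E (fst Q)"
    using weak_parity DE unfolding weak_parity_def by blast
  show "\<psi> E v = \<psi> D v" if "v \<in> crossings D" for v
  proof -
    have "v \<in> crossings E - {fst P, fst Q}" using that fresh crossings_E by auto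
    then show ?thesis using parity_0[OF DE(2,1) m, of v] by simp
  qed
qed

lemma parity_R1:
  assumes R1: "R1_curl D E x C" and "D \<in> K"
  shows "E \<in> K" "\<And>v. v \<in> crossings D \<Longrightarrow> \<psi> E v = \<psi> D v"
proof -
  interpret R1_curl D E x C by (rule R1)
  have cl: "classical_diagram E" using classical K_classical assms(2) by blast
  have "realizes (R1_inc (fst C)) D E" using R1_decreasing by simp
  then have E: "E \<in> K" and m: "elementary_morphism (R1_inc (fst C)) D E"
    using K_step assms(2) cl by blast+
  show "E \<in> K" by (rule E)
  show "\<psi> E v = \<psi> D v" if "v \<in> crossings D" for v
  proof -
    have "v \<in> crossings D - {fst C}" using that fresh by auto
    then show ?thesis using parity_0[OF assms(2) E m, of v] by simp
  qed
qed

lemma parity_R3: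
  assumes R3: "R3_triangle D a b c" and "D \<in> K" and "over d" "over (glue D d)" "d \<in> {a, b, c}"
  defines "D' \<equiv> R3_triangle.E D a b c"
  shows "D' \<in> K" "\<And>v. v \<in> crossings D \<Longrightarrow> \<psi> D' v = \<psi> D v"
    and "\<psi> D (fst a) + \<psi> D (fst b) + \<psi> D (fst c) \<noteq> 1"
proof -
  interpret R3_triangle D a b c by (rule R3)
  let ?m = "R3 (fst a) (fst b) (fst c)"
  have cl: "classical_diagram D'" unfolding D'_def using classical K_classical assms(2) by blast
  have "realizes ?m D D'" unfolding D'_def using R3_move assms by simp
  then have E: "D' \<in> K" and m: "elementary_morphism ?m D D'"
    using K_step assms(2) cl by blast+
  have *: "(\<forall>x\<in>{fst a, fst b, fst c}. \<psi> D x = \<psi> D' (the (induced ?m D x))) \<and>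
      \<psi> D (fst a) + \<psi> D (fst b) + \<psi> D (fst c) \<noteq> 1"
    using weak_parity assms(2) E m unfolding weak_parity_def by blast
  then show "\<psi> D (fst a) + \<psi> D (fst b) + \<psi> D (fst c) \<noteq> 1" by blast
  show "D' \<in> K" by (rule E)
  show "\<psi> D' v = \<psi> D v" if v: "v \<in> crossings D" for v
  proof -
    have "\<psi> D v = \<psi> D' (the (induced ?m D v))"
    proof (cases "v \<in> {fst a, fst b, fst c}")
      case False
      then show ?thesis using parity_0[OF assms(2) E m, of v] v by simp
    qed (use * in blast)
    then show ?thesis using v by simp
  qed
qed

text \<open>
  The strand over \<open>C\<close> is slid over the crossing of \<open>W\<close>, which is the next one on the under-strand: a
  second move creates \<open>P\<close> and \<open>Q\<close>, and a third move takes the triangle \<open>C\<close>, \<open>P\<close>, \<open>W\<close>.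
\<close>

lemma slide:
  assumes D: "D \<in> K" and CW: "C \<in> darts D" "W \<in> darts D" "fst C \<noteq> fst W" "snd C \<in> {0, 2}"
    and edge: "glue D (turn C 2) = W" "glue D (turn C 1) \<noteq> turn W 1"
    and fresh: "fst P \<notin> crossings D" "fst Q \<notin> crossings D" "fst P \<noteq> fst Q"
    and level: "snd P \<in> {0, 2}" "snd Q \<in> {0, 2}"
  defines "m \<equiv> slide_map C W P"
  obtains E where "E \<in> K" "crossings E = crossings D \<union> {fst P, fst Q}"
    and "\<psi> E (fst P) = \<psi> E (fst Q)" "\<And>v. v \<in> crossings D \<Longrightarrow> \<psi> E v = \<psi> D v"
    and "\<psi> D (fst C) + \<psi> E (fst P) + \<psi> D (fst W) \<noteq> 1"
    and "glue E (turn W 1) = turn Q 2" "glue E (turn C 1) = turn Q 1" "glue E (turn W 2) = C"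
      "glue E (turn C 3) = turn P 3" "glue E (turn W 3) = turn P 2"
      "glue E (turn Q 3) = m (glue D (turn C 1))" "glue E Q = m (glue D (turn W 1))"
    and "\<And>z. z \<in> darts D \<Longrightarrow>
      z \<notin> {turn C 1, glue D (turn C 1), turn W 1, glue D (turn W 1), turn C 2, W} \<Longrightarrow>
      glue E (m z) = m (glue D z)"
proof -
  have invD: "involutive D" using K_involutive D .
  note gg [simp] = glue_glue[OF invD]
  \<comment> \<open>The over-strand at \<open>C\<close> is pushed over the edge at
    \<open>turn W 1\<close>. The crossing \<open>P\<close> becomes the third corner of a triangle
    with \<open>C\<close> and \<open>W\<close>.\<close>
  define x where "x = turn C 1"
  define y where "y = glue D (turn W 1)"
  define N where "N = push D x y P Q"
  have neq: "turn C k \<noteq> turn W l" "turn W l \<noteq> turn C k" "C \<noteq> turn W l" "W \<noteq> turn C k"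
    "turn W l \<noteq> C" "turn C k \<noteq> W" "C \<noteq> W" "W \<noteq> C" for k l
    using CW(3) by (metis fst_turn)+
  have "R2_pair D N x y P Q"
    unfolding N_def
  proof (rule R2_pair_push[OF invD fresh level])
    show "x \<in> darts D" "y \<in> darts D" using CW invD by (simp_all add: x_def y_def)
    show "y \<noteq> x" using edge(2) by (metis gg x_def y_def)
    show "y \<noteq> glue D x" using neq(1) by (metis gg x_def y_def)
  qed
  then interpret R2: R2_pair D N x y P Q .
  have W_glue: "glue D W = turn C 2" using edge(1) by (metis gg)
  have gy: "glue D y = turn W 1" by (simp add: y_def)
  have W_old: "W \<notin> {x, glue D x, y, glue D y}"
  proof -
    have "W \<noteq> glue D x" using W_glue by (metis gg turn_eq_turn_iff x_def zero_neq_one one_add_one add_left_cancel add.right_neutral)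
    moreover have "W \<noteq> y" using W_glue neq(1) by (metis gg y_def)
    ultimately show ?thesis using neq by (auto simp: x_def gy)
  qed
  have NW: "glue N W = turn C 2"
    using R2.glue_E_old[OF CW(2) W_old] W_glue by simp
  \<comment> \<open>The face of \<open>P\<close> is the triangle, and \<open>turn Q 3\<close> is
    none of its three darts.\<close>
  have split: "turn Q 3 \<notin> orbit (face_step N) P"
  proof -
    have 1: "face_step N P = W" by (simp add: face_step_turn gy)
    have 2: "face_step N W = x" by (simp add: face_step_turn NW x_def)
    have "face_step N ` {P, W, x} \<subseteq> {P, W, x}" using 1 2 by simp
    then have "orbit (face_step N) P \<subseteq> {P, W, x}" by (rule orbit_closed_subset) simp
    then show ?thesis using CW(2) R2.xy(1) by auto
  qed
  note par = parity_R2[OF \<open>R2_pair D N x y P Q\<close> disjI1[OF D] split]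
  have tri: "R3_triangle N x P W"
  proof unfold_locales
    show "involutive N" by (rule R2.invE)
    show "x \<in> darts N" "P \<in> darts N" "W \<in> darts N" using CW by (simp_all add: R2.darts_E)
    show "fst x \<noteq> fst P" "fst P \<noteq> fst W" "fst x \<noteq> fst W"
      using CW fresh by (auto simp: x_def in_darts_iff)
    show "glue N x = turn P 1" "glue N P = turn W 1" "glue N W = turn x 1"
      by (simp_all add: gy NW) (simp add: x_def)
  qed
  interpret R3: R3_triangle N x P W by (rule tri)
  let ?E = R3.E
  have "glue N x = turn P 1" by simp
  \<comment> \<open>The side on the moving strand is the top one: its two ends are odd turns of
    under-darts.\<close>
  moreover have "over (turn C 1)" "over (turn P 1)"
    using CW(4) level(1) unfolding over_def turn_def by auto
  ultimately have "over x" "over (glue N x)" by (simp_all add: x_def)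
  note par3 = parity_R3[OF tri par(2) this, simplified]
  have cr: "crossings ?E = crossings D \<union> {fst P, fst Q}"
    by (simp add: R3.E_def R2.crossings_E)
  have p_new: "R3.p (turn Q n) = turn Q n" "R3.p Q = Q" for n
  proof -
    have "fst Q \<noteq> fst x" "fst Q \<noteq> fst W" using CW fresh by (auto simp: x_def in_darts_iff)
    then have "turn Q n \<notin> {x, P, W}" "turn Q n \<notin> {turn x k, turn P k, turn W k}" for n k
      using fresh by (metis empty_iff fst_turn insert_iff)+
    from R3.p_other[OF this] show "R3.p (turn Q n) = turn Q n" for n .
    from this[of 0] show "R3.p Q = Q" by simp
  qed
  have Cx: "C = turn x 3" "turn C 1 = x" "turn C 2 = turn x 1" "turn C 3 = turn x 2" by (simp_all add: x_def)
  have p_old: "R3.p z = m z" if "z \<in> darts D" for z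
  proof (rule R3.dart_cases[of z])
    assume "z \<in> {P, turn P 1, turn P 2, turn P 3}"
    then show ?thesis using that by auto
  next
    assume "z \<in> {x, turn x 1, turn x 2, turn x 3}"
    then show ?thesis unfolding m_def slide_map_def Cx by (elim insertE emptyE) simp_all
  next
    assume "z \<in> {W, turn W 1, turn W 2, turn W 3}"
    then show ?thesis unfolding m_def slide_map_def Cx by (elim insertE emptyE) simp_all
  next
    assume "fst z \<noteq> fst x" "fst z \<noteq> fst W" "R3.p z = z"
    then have "z \<noteq> C \<and> z \<noteq> turn C k \<and> z \<noteq> W \<and> z \<noteq> turn W k" for k by (auto simp: x_def)
    then show ?thesis using \<open>R3.p z = z\<close> by (simp add: m_def slide_map_def)
  qed
  show thesis
  proof (rule that[of ?E])
    show "?E \<in> K" by (rule par3(1))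
    show "crossings ?E = crossings D \<union> {fst P, fst Q}" by (rule cr)
    have cN: "crossings N = crossings D \<union> {fst P, fst Q}" by (rule R2.crossings_E)
    show "\<psi> ?E (fst P) = \<psi> ?E (fst Q)" using par(3) par3(2) cN by simp
    show "\<psi> ?E v = \<psi> D v" if "v \<in> crossings D" for v using par(4)[OF that] par3(2)[of v] that cN by simp
    show "\<psi> D (fst C) + \<psi> ?E (fst P) + \<psi> D (fst W) \<noteq> 1"
      using par3(3) par3(2)[of "fst P"] par(4)[of "fst C"] par(4)[of "fst W"] CW cN
      by (simp add: x_def in_darts_iff)
    show "glue ?E (turn W 1) = turn Q 2" "glue ?E (turn C 1) = turn Q 1" "glue ?E (turn W 2) = C"
      "glue ?E (turn C 3) = turn P 3" "glue ?E (turn W 3) = turn P 2"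
      by (simp_all add: R3.glue_E Cx p_new gy)
    show "glue ?E (turn Q 3) = m (glue D (turn C 1))" "glue ?E Q = m (glue D (turn W 1))"
      using p_old[OF R2.in_D(3)] p_old[OF R2.in_D(2)] by (simp_all add: R3.glue_E Cx p_new y_def)
    show "glue ?E (m z) = m (glue D z)" if z: "z \<in> darts D"
      "z \<notin> {turn C 1, glue D (turn C 1), turn W 1, glue D (turn W 1), turn C 2, W}" for z
    proof -
      have "glue N z = glue D z"
        using R2.glue_E_old z by (auto simp: x_def y_def)
      then show ?thesis using p_old[of z] p_old[of "glue D z"] z(1) invD
        by (metis R3.glue_E R3.p_p glue_in)
    qed
  qed
qed

lemma parity_unpush:
  assumes E: "E \<in> K"
    and PQ: "P \<in> darts E" "Q \<in> darts E" "fst P \<noteq> fst Q" "snd P \<in> {0, 2}" "snd Q \<in> {0, 2}"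
    and bigon: "glue E (turn P 3) = turn Q 1" "glue E (turn P 2) = turn Q 2"
    and outside: "\<And>d. d \<in> {P, turn P 1, Q, turn Q 3} \<Longrightarrow> fst (glue E d) \<notin> {fst P, fst Q}"
    and split: "turn Q 3 \<notin> orbit (face_step E) P"
  shows "\<psi> E (fst P) = \<psi> E (fst Q)"
    and "unpush E P Q \<in> K" "\<And>v. v \<in> crossings (unpush E P Q) \<Longrightarrow> \<psi> E v = \<psi> (unpush E P Q) v"
proof -
  have R2: "R2_pair (unpush E P Q) E (glue E (turn P 1)) (glue E Q) P Q"
    using R2_pair_unpush[OF K_involutive[OF E]] assms by blast
  note par = parity_R2[OF R2 disjI2[OF E] split]
  show "\<psi> E (fst P) = \<psi> E (fst Q)" "unpush E P Q \<in> K"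
    "\<And>v. v \<in> crossings (unpush E P Q) \<Longrightarrow> \<psi> E v = \<psi> (unpush E P Q) v"
    using par by auto
qed

end

section \<open>Tours around a tree of crossings\<close>

text \<open>As \<open>g\<close> only moves along \<open>f\<close>-orbits, each of its cycles lies in
  a single cycle of \<open>f\<close>.\<close>

lemma card_orbits_le:
  assumes "finite X" "inj_on f X" "f ` X \<subseteq> X" and "inj_on g Y" "g ` Y \<subseteq> Y" "Y \<subseteq> X"
    and "\<And>y. y \<in> Y \<Longrightarrow> g y \<in> orbit f y"
  shows "card (orbit f ` Y) \<le> card (orbit g ` Y)"
proof (rule card_image_le_if_finer)
  have finY: "finite Y" using assms(1,6) finite_subset by blast
  then show "finite Y" .
  fix x y assume xy: "x \<in> Y" "y \<in> Y" and eq: "orbit g x = orbit g y"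
  have "y \<in> orbit g x" using orbit_eq_iff[OF finY assms(4,5) xy] eq by blast
  then have "y \<in> orbit f x"
  proof induction
    case base show ?case using assms(7) xy by blast
  next
    case (step z)
    then have "z \<in> Y" using orbit_closed_subset[OF assms(5) xy(1)] by blast
    then show ?case using step.IH assms(7) orbit_trans by metis
  qed
  then show "orbit f x = orbit f y" using orbit_eq_iff[OF assms(1-3)] xy assms(6) by blast
qed

text \<open>A cycle that is not a fixed point has at least two elements, so \<open>card A\<close> is
  at least twice the number of cycles minus the number of fixed points.\<close>

lemma two_fixed_points:
  assumes "finite A" "inj_on k A" "k ` A \<subseteq> A" "card A + 2 \<le> 2 * card (orbit k ` A)"
  shows "2 \<le> card {a\<in>A. k a = a}"
proof -
  note k = assms(1-3)
  let ?O = "orbit k ` A" and ?S = "(\<lambda>a. {a}) ` {a\<in>A. k a = a}"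
  have sub: "orbit k a \<subseteq> A" if "a \<in> A" for a using orbit_closed_subset[OF k(3) that] .
  have self: "a \<in> orbit k a" if "a \<in> A" for a using finite_inj_self_in_orbit[OF k that] .
  have "A = \<Union> ?O" using sub self by blast
  also have "card \<dots> = (\<Sum>u\<in>?O. card u)"
  proof (rule card_Union_disjoint)
    show "pairwise disjnt ?O"
    proof (rule pairwiseI)
      fix P Q assume "P \<in> ?O" "Q \<in> ?O" "P \<noteq> Q"
      then obtain a b where ab: "a \<in> A" "b \<in> A" "P = orbit k a" "Q = orbit k b" by blast
      have "P = Q" if "c \<in> P" "c \<in> Q" for c
      proof -
        have "c \<in> A" using that ab sub by blast
        then show ?thesis using that ab orbit_eq_iff[OF k] by metis
      qed
      then show "disjnt P Q" using \<open>P \<noteq> Q\<close> by (auto simp: disjnt_def)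
    qed
    show "finite u" if "u \<in> ?O" for u using that sub k(1) finite_subset by blast
  qed
  finally have card_A: "card A = (\<Sum>u\<in>?O. card u)" .
  have "(\<Sum>u\<in>?O. 2 - (if u \<in> ?S then 1 else 0)) \<le> (\<Sum>u\<in>?O. card u)"
  proof (rule sum_mono)
    fix P assume "P \<in> ?O"
    then obtain a where a: "a \<in> A" "P = orbit k a" by blast
    have fin: "finite P" using a sub k(1) finite_subset by blast
    have aP: "a \<in> P" using a self by blast
    show "2 - (if P \<in> ?S then 1 else 0) \<le> card P"
    proof (cases "P \<in> ?S")
      case True
      then show ?thesis by auto
    next
      case False
      have "k a \<noteq> a"
      proof
        assume "k a = a"
        then have "P = {a}" using a orbit_eq_singleton_iff by metis
        then show False using False \<open>k a = a\<close> a(1) by blast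
      qed
      then have "card {a, k a} = 2" by simp
      moreover have "{a, k a} \<subseteq> P" using a aP by (auto intro: orbit.base)
      ultimately show ?thesis using card_mono[OF fin, of "{a, k a}"] by simp
    qed
  qed
  moreover have "(\<Sum>u\<in>?O. 2 - (if u \<in> ?S then 1 else 0)) + card ?S \<ge> 2 * card ?O"
  proof -
    have "(\<Sum>u\<in>?O. if u \<in> ?S then 1 else 0) = card (?O \<inter> ?S)"
      using k(1) by (simp add: sum.If_cases Int_def)
    also have "\<dots> \<le> card ?S" using k(1) by (intro card_mono) auto
    finally have 1: "(\<Sum>u\<in>?O. if u \<in> ?S then 1 else (0::nat)) \<le> card ?S" .
    have "(\<Sum>u\<in>?O. (2::nat)) = (\<Sum>u\<in>?O. (2 - (if u \<in> ?S then 1 else 0)) + (if u \<in> ?S then 1 else 0))"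
      by (rule sum.cong) auto
    also have "\<dots> = (\<Sum>u\<in>?O. 2 - (if u \<in> ?S then 1 else 0)) + (\<Sum>u\<in>?O. if u \<in> ?S then 1 else 0)"
      by (rule sum.distrib)
    finally show ?thesis using 1 by simp
  qed
  moreover have "card ?S = card {a\<in>A. k a = a}" by (rule card_image) simp
  ultimately show ?thesis using card_A assms(4) by linarith
qed

locale rooted_diagram =
  fixes D :: diagram and x0 :: dart
  assumes invD: "involutive D" and x0: "x0 \<in> darts D"
begin

text \<open>Steps along the boundary of a face, over edges that the contour does not cross. Darts in
  \<open>A\<close> have no successor, so a path follows the inner side of the contour and can go no
  further once it meets a crossed dart.\<close>

definition walk_step :: "nat set \<Rightarrow> dart set \<Rightarrow> (dart \<times> dart) set" where
  "walk_step T A = {(e, face_step D e) | e. e \<in> darts D \<and> fst e \<in> T \<and> e \<notin> A}"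

text \<open>
  A curve around the tree with vertices \<open>T\<close> crosses the darts in \<open>A\<close> in the cyclic order \<open>\<sigma>\<close>;
  between \<open>a\<close> and \<open>\<sigma> a\<close> it stays inside one face and follows its boundary.
\<close>

definition tour :: "nat set \<Rightarrow> dart set \<Rightarrow> (dart \<Rightarrow> dart) \<Rightarrow> bool" where
  "tour T A \<sigma> \<longleftrightarrow> T \<subseteq> crossings D \<and> A \<subseteq> darts D \<and> fst ` A \<subseteq> T \<and> x0 \<in> A \<and>
     \<sigma> ` A \<subseteq> A \<and> inj_on \<sigma> A \<and> (\<forall>S\<subseteq>A. S \<noteq> {} \<longrightarrow> \<sigma> ` S \<subseteq> S \<longrightarrow> S = A) \<and>
     (\<forall>d\<in>darts D. fst d \<in> T \<longrightarrow> d \<notin> A \<longrightarrow> glue D d \<notin> A \<and> fst (glue D d) \<in> T) \<and>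
     (\<forall>a\<in>A. (turn (\<sigma> a) 3, a) \<in> (walk_step T A)\<^sup>*)"

lemma walk_stepI:
  "e \<in> darts D \<Longrightarrow> fst e \<in> T \<Longrightarrow> e \<notin> A \<Longrightarrow> face_step D e = f \<Longrightarrow> (e, f) \<in> walk_step T A"
  by (metis (mono_tags, lifting) walk_step_def mem_Collect_eq)

lemma tourD:
  assumes "tour T A \<sigma>"
  shows "T \<subseteq> crossings D" "A \<subseteq> darts D" "fst ` A \<subseteq> T" "x0 \<in> A" "\<sigma> ` A \<subseteq> A" "inj_on \<sigma> A"
    and "\<And>S. S \<subseteq> A \<Longrightarrow> S \<noteq> {} \<Longrightarrow> \<sigma> ` S \<subseteq> S \<Longrightarrow> S = A"
    and "\<And>d. d \<in> darts D \<Longrightarrow> fst d \<in> T \<Longrightarrow> d \<notin> A \<Longrightarrow> glue D d \<notin> A \<and> fst (glue D d) \<in> T"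
    and "\<And>a. a \<in> A \<Longrightarrow> (turn (\<sigma> a) 3, a) \<in> (walk_step T A)\<^sup>*"
    and "finite A" "\<sigma> ` A = A"
proof -
  note t = assms[unfolded tour_def]
  show "T \<subseteq> crossings D" "A \<subseteq> darts D" "fst ` A \<subseteq> T" "x0 \<in> A" "\<sigma> ` A \<subseteq> A" "inj_on \<sigma> A"
    using t by simp_all
  show "S = A" if "S \<subseteq> A" "S \<noteq> {}" "\<sigma> ` S \<subseteq> S" for S
    using t that by simp
  show "glue D d \<notin> A \<and> fst (glue D d) \<in> T" if "d \<in> darts D" "fst d \<in> T" "d \<notin> A" for d
    using t that by simp
  show "(turn (\<sigma> a) 3, a) \<in> (walk_step T A)\<^sup>*" if "a \<in> A" for a
    using t that by simp
  show "finite A" using \<open>A \<subseteq> darts D\<close> involutive_finite(2)[OF invD] finite_subset by blast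
  then show "\<sigma> ` A = A" using \<open>\<sigma> ` A \<subseteq> A\<close> \<open>inj_on \<sigma> A\<close> by (simp add: endo_inj_surj)
qed

text \<open>\<open>\<sigma>\<close> is a single cycle and passes through \<open>x0\<close>, so it
  cannot close up on \<open>a\<close> and \<open>b\<close> alone.\<close>

lemma tour_no_short_cycle:
  assumes t: "tour T A \<sigma>" and "a \<in> A" "a \<noteq> x0" "b \<noteq> x0" "\<sigma> a = b"
  shows "a \<noteq> b" "\<sigma> b \<noteq> a"
proof -
  have b: "b \<in> A" using tourD(5)[OF t] assms by blast
  show "a \<noteq> b"
  proof
    assume "a = b"
    then have "{a} = A" using tourD(7)[OF t, of "{a}"] assms by auto
    then show False using tourD(4)[OF t] assms by blast
  qed
  show "\<sigma> b \<noteq> a"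
  proof
    assume "\<sigma> b = a"
    then have "{a, b} = A" using tourD(7)[OF t, of "{a, b}"] assms b by auto
    then show False using tourD(4)[OF t] assms by blast
  qed
qed

lemma tour_start: "tour {fst x0} {x0, turn x0 1, turn x0 2, turn x0 3} (\<lambda>a. turn a 1)"
  unfolding tour_def
proof (intro conjI ballI allI impI)
  let ?A = "{x0, turn x0 1, turn x0 2, turn x0 3}"
  show "S = ?A" if S: "S \<subseteq> ?A" "S \<noteq> {}" "(\<lambda>a. turn a 1) ` S \<subseteq> S" for S
  proof -
    have s: "turn a 1 \<in> S" if "a \<in> S" for a using that S(3) by blast
    obtain a where "a \<in> S" using S(2) by blast
    then have "a \<in> S" "turn a 1 \<in> S" "turn a 2 \<in> S" "turn a 3 \<in> S"
      using s[of a] s[of "turn a 1"] s[of "turn a 2"] by simp_all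
    moreover have "a \<in> ?A" using S(1) \<open>a \<in> S\<close> by blast
    ultimately have "?A \<subseteq> S" by auto
    then show ?thesis using S(1) by blast
  qed
  show "inj_on (\<lambda>a. turn a 1) ?A" by (rule inj_onI) (simp add: turn_inject)
  fix d assume d: "d \<in> darts D" "fst d \<in> {fst x0}" "d \<notin> ?A"
  then have False using same_crossing_turn[of d x0] by auto
  then show "glue D d \<notin> ?A" "fst (glue D d) \<in> {fst x0}" by auto
next
  show "(turn (turn a 1) 3, a) \<in> (walk_step {fst x0} {x0, turn x0 1, turn x0 2, turn x0 3})\<^sup>*" for a
    by simp
qed (use x0 in \<open>auto simp: in_darts_iff\<close>)

text \<open>With the leaf \<open>W\<close> the contour runs around the far end of the edge of
  \<open>d0\<close>: in the cyclic order \<open>d0\<close> gives way to the other three darts at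
  \<open>W\<close>, counterclockwise. The last claim ensures that every face boundary at the tree
  reaches the contour, so that no face is missed when the faces are counted.\<close>

lemma tour_grow:
  assumes t: "tour T A \<sigma>" and d0: "d0 \<in> A" "d0 \<noteq> x0" and a0: "a0 \<in> A" "\<sigma> a0 = d0"
    and W: "W = glue D d0" "fst W \<notin> T"
  defines "A' \<equiv> A - {d0} \<union> {turn W 1, turn W 2, turn W 3}"
    and "\<sigma>' \<equiv> \<sigma>(a0 := turn W 1, turn W 1 := turn W 2, turn W 2 := turn W 3, turn W 3 := \<sigma> d0)"
  shows "tour (insert (fst W) T) A' \<sigma>'" "card A' = card A + 2"
    and "\<And>e. e \<in> darts D \<Longrightarrow> fst e \<in> insert (fst W) T \<Longrightarrow>
      (\<And>e. e \<in> darts D \<Longrightarrow> fst e \<in> T \<Longrightarrow> \<exists>a\<in>A. (e, a) \<in> (walk_step T A)\<^sup>*) \<Longrightarrow>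
      \<exists>a\<in>A'. (e, a) \<in> (walk_step (insert (fst W) T) A')\<^sup>*"
proof -
  note tD = tourD[OF t]
  let ?T = "insert (fst W) T"
  have WD: "W \<in> darts D" using W(1) d0 tD(2) invD by auto
  have gW: "glue D W = d0" using W(1) glue_glue[OF invD] by simp
  have fst_A: "fst a \<in> T" if "a \<in> A" for a using that tD(3) by blast
  have W_A [simp]: "turn W n \<notin> A" "W \<notin> A" for n using fst_A[of "turn W n"] fst_A[of W] W(2) by auto
  have W_neq [simp]: "turn W n \<noteq> a" "a \<noteq> turn W n" "W \<noteq> a" "a \<noteq> W" if "a \<in> A" for a n
    using that W_A by metis+
  have "a0 \<noteq> d0" using tD(7)[of "{d0}"] d0 a0 tD(4) by auto
  have sA: "\<sigma> a \<in> A" if "a \<in> A" for a using that tD(5) by blast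
  have "\<sigma> d0 \<noteq> d0" using \<open>a0 \<noteq> d0\<close> tD(6) a0 d0 by (metis inj_onD)
  have s_old: "\<sigma>' a = \<sigma> a" "\<sigma> a \<noteq> d0" if "a \<in> A" "a \<noteq> a0" for a
    using that tD(6) a0 by (auto simp: \<sigma>'_def dest: inj_onD)
  have s_new: "\<sigma>' a0 = turn W 1" "\<sigma>' (turn W 1) = turn W 2" "\<sigma>' (turn W 2) = turn W 3" "\<sigma>' (turn W 3) = \<sigma> d0"
    using a0 by (simp_all add: \<sigma>'_def)
  have A'_cases: "a = a0 \<or> a = turn W 1 \<or> a = turn W 2 \<or> a = turn W 3 \<or> (a \<in> A \<and> a \<noteq> d0 \<and> a \<noteq> a0)" if "a \<in> A'" for a
    using that by (auto simp: A'_def)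
  have A'_in: "a0 \<in> A'" "turn W 1 \<in> A'" "turn W 2 \<in> A'" "turn W 3 \<in> A'" "\<sigma> d0 \<in> A'"
    "\<And>a. a \<in> A \<Longrightarrow> a \<noteq> d0 \<Longrightarrow> a \<in> A'"
    using a0 d0 sA \<open>a0 \<noteq> d0\<close> \<open>\<sigma> d0 \<noteq> d0\<close> by (auto simp: A'_def)
  have A'_out: "d0 \<notin> A'" "W \<notin> A'" using d0 by (auto simp: A'_def)
  have old_out: "e \<notin> A'" if "e \<notin> A" "fst e \<in> T" for e
    using that W(2) by (auto simp: A'_def)
  have steps: "(walk_step T A)\<^sup>* \<subseteq> (walk_step ?T A')\<^sup>*"
    by (rule rtrancl_mono) (use old_out in \<open>auto simp: walk_step_def\<close>)
  \<comment> \<open>The edge to the new leaf is now inside the contour and can be walked along on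
    both of its sides.\<close>
  have step_d0: "(d0, turn W 3) \<in> walk_step ?T A'"
    using A'_out fst_A[OF d0(1)] d0 tD(2) W(1) by (intro walk_stepI) (auto simp: face_step_turn)
  have step_W: "(W, turn d0 3) \<in> walk_step ?T A'"
    using A'_out WD gW by (intro walk_stepI) (auto simp: face_step_turn)
  show "tour ?T A' \<sigma>'"
    unfolding tour_def
  proof (intro conjI ballI allI impI)
    show "?T \<subseteq> crossings D" using tD(1) WD by (simp add: in_darts_iff)
    show "A' \<subseteq> darts D" using tD(2) WD by (auto simp: A'_def)
    show "fst ` A' \<subseteq> ?T" using fst_A by (auto simp: A'_def)
    show "x0 \<in> A'" using A'_in(6) tD(4) d0 by auto
    show "\<sigma>' ` A' \<subseteq> A'"
    proof (rule image_subsetI)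
      fix a assume "a \<in> A'"
      from A'_cases[OF this] show "\<sigma>' a \<in> A'"
        using s_new s_old A'_in sA by (elim disjE) simp_all
    qed
    show "inj_on \<sigma>' A'"
    proof (rule eq_card_imp_inj_on)
      show "finite A'" using tD(10) by (simp add: A'_def)
      have "c \<in> \<sigma>' ` A'" if c: "c \<in> A'" for c
      proof (cases "c \<in> {turn W 1, turn W 2, turn W 3}")
        case True
        then show ?thesis using s_new A'_in by (metis image_eqI insertE singletonD)
      next
        case False
        then have cA: "c \<in> A" "c \<noteq> d0" using c by (auto simp: A'_def)
        then obtain a where a: "a \<in> A" "c = \<sigma> a" using tD(11) by blast
        show ?thesis
        proof (cases "a = d0")
          case True
          then show ?thesis using a s_new(4) A'_in(4) by (metis image_eqI)
        next
          case False
          moreover have "a \<noteq> a0" using a cA a0 by blast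
          ultimately show ?thesis using a s_old(1)[OF a(1)] A'_in(6)[OF a(1)] by (metis image_eqI)
        qed
      qed
      then have "\<sigma>' ` A' = A'" using \<open>\<sigma>' ` A' \<subseteq> A'\<close> by blast
      then show "card (\<sigma>' ` A') = card A'" by simp
    qed
    show "S = A'" if S: "S \<subseteq> A'" "S \<noteq> {}" "\<sigma>' ` S \<subseteq> S" for S
    proof -
      have s: "\<sigma>' a \<in> S" if "a \<in> S" for a using that S(3) by blast
      have chain: "turn W 1 \<in> S \<Longrightarrow> turn W 2 \<in> S" "turn W 2 \<in> S \<Longrightarrow> turn W 3 \<in> S" "turn W 3 \<in> S \<Longrightarrow> \<sigma> d0 \<in> S"
        "a0 \<in> S \<Longrightarrow> turn W 1 \<in> S"
        using s s_new by metis+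
      \<comment> \<open>A closed set for the new order is turned into one for the old order;
        \<open>d0\<close> stands for the new darts, of which \<open>turn W 3\<close> is the
        last.\<close>
      define R where "R = (S \<inter> A) \<union> (if turn W 3 \<in> S then {d0} else {})"
      have "R = A"
      proof (rule tD(7))
        show "R \<subseteq> A" using d0 by (auto simp: R_def)
        show "R \<noteq> {}"
        proof -
          obtain a where "a \<in> S" using S(2) by blast
          then have "a \<in> A \<or> turn W 3 \<in> S" using S(1) A'_cases[of a] a0 chain by blast
          then show ?thesis using \<open>a \<in> S\<close> by (auto simp: R_def)
        qed
        show "\<sigma> ` R \<subseteq> R"
        proof (rule image_subsetI)
          fix a assume a: "a \<in> R"
          show "\<sigma> a \<in> R"
          proof (cases "a = d0")
            case True
            then have "turn W 3 \<in> S" using a S(1) A'_out by (auto simp: R_def split: if_splits)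
            then show ?thesis using True chain(3) sA d0 by (auto simp: R_def)
          next
            case False
            then have "a \<in> S" "a \<in> A" using a by (auto simp: R_def split: if_splits)
            show ?thesis
            proof (cases "a = a0")
              case True
              then have "turn W 3 \<in> S" using chain \<open>a \<in> S\<close> by blast
              then show ?thesis using True a0 by (simp add: R_def)
            next
              case False
              then show ?thesis using s[OF \<open>a \<in> S\<close>] s_old(1)[OF \<open>a \<in> A\<close> False] sA[OF \<open>a \<in> A\<close>]
                by (simp add: R_def)
            qed
          qed
        qed
      qed
      then have old: "a \<in> S" if "a \<in> A" "a \<noteq> d0" for a
        using that by (auto simp: R_def split: if_splits)
      then have "a0 \<in> S" using a0 \<open>a0 \<noteq> d0\<close> by blast
      then have "turn W 1 \<in> S" "turn W 2 \<in> S" "turn W 3 \<in> S" using chain by blast+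
      then show ?thesis using old S(1) by (auto simp: A'_def)
    qed
    fix d assume d: "d \<in> darts D" "fst d \<in> ?T" "d \<notin> A'"
    have *: "glue D d \<notin> A' \<and> fst (glue D d) \<in> ?T"
    proof (cases "fst d \<in> T")
      case True
      show ?thesis
      proof (cases "d = d0")
        case True
        then show ?thesis using A'_out W(1) by simp
      next
        case False
        then have "d \<notin> A" using d(3) A'_in(6) by blast
        then have "glue D d \<notin> A" "fst (glue D d) \<in> T" using tD(8) d(1) True by blast+
        then show ?thesis using old_out by simp
      qed
    next
      case False
      then have "fst d = fst W" using d(2) by simp
      then have "d = W" using same_crossing_turn[of d W] d(3) A'_in by auto
      then show ?thesis using gW A'_out fst_A[OF d0(1)] by simp
    qed
    then show "glue D d \<notin> A'" "fst (glue D d) \<in> ?T" by auto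
  next
    fix a assume "a \<in> A'"
    have gap: "(turn (\<sigma> c) 3, c) \<in> (walk_step ?T A')\<^sup>*" if "c \<in> A" for c
      using tD(9)[OF that] steps by blast
    from A'_cases[OF \<open>a \<in> A'\<close>] show "(turn (\<sigma>' a) 3, a) \<in> (walk_step ?T A')\<^sup>*"
    proof (elim disjE)
      assume "a = a0"
      then show ?thesis
        using gap[OF a0(1)] a0(2) step_W s_new(1) by (simp add: converse_rtrancl_into_rtrancl)
    next
      assume "a = turn W 3"
      then show ?thesis using gap[OF d0(1)] step_d0 s_new(4) by (simp add: rtrancl_into_rtrancl)
    qed (use s_new s_old gap in simp_all)
  qed
  have "card A' = card (A - {d0}) + card {turn W 1, turn W 2, turn W 3}"
    unfolding A'_def by (rule card_Un_disjoint) (use tD(10) in auto)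
  also have "card (A - {d0}) = card A - 1" using d0(1) tD(10) by simp
  finally have "card A' = card A - 1 + 3" by simp
  moreover have "card A \<noteq> 0" using d0(1) tD(10) by auto
  ultimately show "card A' = card A + 2" by linarith
  fix e assume e: "e \<in> darts D" "fst e \<in> ?T"
    and cover: "\<And>e. e \<in> darts D \<Longrightarrow> fst e \<in> T \<Longrightarrow> \<exists>a\<in>A. (e, a) \<in> (walk_step T A)\<^sup>*"
  have old: "\<exists>a\<in>A'. (e, a) \<in> (walk_step ?T A')\<^sup>*" if e: "e \<in> darts D" "fst e \<in> T" for e
  proof -
    obtain a where a: "a \<in> A" "(e, a) \<in> (walk_step ?T A')\<^sup>*" using cover[OF e] steps by blast
    show ?thesis
    proof (cases "a = d0")
      case True
      then show ?thesis using a(2) step_d0 A'_in(4) by (meson rtrancl_into_rtrancl)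
    qed (use a A'_in(6) in blast)
  qed
  show "\<exists>a\<in>A'. (e, a) \<in> (walk_step ?T A')\<^sup>*"
  proof (cases "fst e \<in> T")
    case False
    then have "fst e = fst W" using e by simp
    then consider "e = W" | "e \<in> {turn W 1, turn W 2, turn W 3}" using same_crossing_turn by blast
    then show ?thesis
    proof cases
      case 1
      have "turn d0 3 \<in> darts D" "fst (turn d0 3) \<in> T" using d0(1) tD(2) fst_A by auto
      then show ?thesis using old[of "turn d0 3"] step_W 1 by (meson converse_rtrancl_into_rtrancl)
    next
      case 2
      then show ?thesis using A'_in by blast
    qed
  qed (use e old in blast)
qed

text \<open>The contour is moved off an edge that it crosses twice in succession. The tree is as
  before, but the edge may now be walked along, which joins the stretches of boundary before and
  after the pair.\<close>

lemma tour_prune: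
  assumes t: "tour T A \<sigma>" and ab: "a \<in> A" "a \<noteq> x0" "b \<noteq> x0" "b = glue D a" "\<sigma> a = b"
    and z: "z \<in> A" "\<sigma> z = a"
  shows "tour T (A - {a, b}) (\<sigma>(z := \<sigma> b))" "b \<in> A" "z \<noteq> a" "z \<noteq> b" "card A = card (A - {a, b}) + 2"
proof -
  note tD = tourD[OF t]
  let ?A = "A - {a, b}" and ?s = "\<sigma>(z := \<sigma> b)"
  show b: "b \<in> A" using tD(5) ab(1,5) by auto
  note short = tour_no_short_cycle[OF t ab(1,2,3,5)]
  show "z \<noteq> b" using short(2) z(2) by metis
  show "z \<noteq> a" using short(1) z(2) ab(5) by metis
  have inj: "c = d" if "\<sigma> c = \<sigma> d" "c \<in> A" "d \<in> A" for c d using that tD(6) by (meson inj_onD)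
  have sb: "\<sigma> b \<noteq> a" "\<sigma> b \<noteq> b" using short inj[of a b] ab b by auto
  have sA: "\<sigma> c \<in> A" if "c \<in> A" for c using that tD(5) by blast
  have s_old: "\<sigma> c \<noteq> a" "\<sigma> c \<noteq> b" if "c \<in> ?A" "c \<noteq> z" for c
    using that inj[of c z] inj[of c a] z ab by auto
  have fst_A: "fst c \<in> T" if "c \<in> A" for c using that tD(3) by blast
  have ga: "glue D b = a" using ab glue_glue[OF invD] by simp
  have steps: "(walk_step T A)\<^sup>* \<subseteq> (walk_step T ?A)\<^sup>*"
    by (rule rtrancl_mono) (auto simp: walk_step_def)
  have step_b: "(b, turn a 3) \<in> walk_step T ?A"
    using b fst_A[OF b] tD(2) ga by (intro walk_stepI) (auto simp: face_step_turn)
  show "tour T ?A ?s"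
    unfolding tour_def
  proof (intro conjI ballI allI impI)
    show "T \<subseteq> crossings D" "?A \<subseteq> darts D" "fst ` ?A \<subseteq> T" "x0 \<in> ?A" using tD ab by auto
    show "?s ` ?A \<subseteq> ?A"
    proof (rule image_subsetI)
      fix c assume "c \<in> ?A"
      then show "?s c \<in> ?A" using s_old[of c] sA[of c] sA[OF b] sb by auto
    qed
    show "inj_on ?s ?A"
    proof (rule inj_onI)
      fix c d assume "c \<in> ?A" "d \<in> ?A" "?s c = ?s d"
      then show "c = d" using inj[of c d] inj[of b c] inj[of b d] b by (auto split: if_splits)
    qed
    show "S = ?A" if S: "S \<subseteq> ?A" "S \<noteq> {}" "?s ` S \<subseteq> S" for S
    proof -
      have s: "?s c \<in> S" if "c \<in> S" for c using that S(3) by blast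
      define R where "R = S \<union> (if z \<in> S then {a, b} else {})"
      have "R = A"
      proof (rule tD(7))
        show "R \<subseteq> A" "R \<noteq> {}" using S ab b by (auto simp: R_def)
        show "\<sigma> ` R \<subseteq> R"
        proof (rule image_subsetI)
          fix c assume "c \<in> R"
          then consider "c \<in> S" "c = z" | "c \<in> S" "c \<noteq> z" | "z \<in> S" "c = a" | "z \<in> S" "c = b"
            by (auto simp: R_def split: if_splits)
          then show "\<sigma> c \<in> R"
          proof cases
            case 1 then show ?thesis using z by (simp add: R_def)
          next
            case 2 then show ?thesis using s[of c] by (simp add: R_def)
          next
            case 3 then show ?thesis using ab by (simp add: R_def)
          next
            case 4 then show ?thesis using s[of z] by (simp add: R_def)
          qed
        qed
      qed
      then show ?thesis using S(1) by (auto simp: R_def split: if_splits)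
    qed
    fix d assume d: "d \<in> darts D" "fst d \<in> T" "d \<notin> ?A"
    have *: "glue D d \<notin> ?A \<and> fst (glue D d) \<in> T"
    proof (cases "d \<in> A")
      case True
      then show ?thesis using d(3) ab(1,4) b ga fst_A[OF ab(1)] fst_A[OF b] by auto
    next
      case False
      then show ?thesis using tD(8)[OF d(1,2)] by blast
    qed
    then show "glue D d \<notin> ?A" "fst (glue D d) \<in> T" by auto
  next
    fix c assume c: "c \<in> ?A"
    show "(turn (?s c) 3, c) \<in> (walk_step T ?A)\<^sup>*"
    proof (cases "c = z")
      case True
      have "(turn (\<sigma> b) 3, b) \<in> (walk_step T ?A)\<^sup>*" "(turn a 3, z) \<in> (walk_step T ?A)\<^sup>*"
        using tD(9)[OF b] tD(9)[OF z(1)] z(2) steps by auto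
      then have "(turn (\<sigma> b) 3, z) \<in> (walk_step T ?A)\<^sup>*"
        using step_b by (meson rtrancl_into_rtrancl rtrancl_trans)
      then show ?thesis using True by simp
    next
      case False
      then show ?thesis using c tD(9)[of c] steps by auto
    qed
  qed
  have "card A = card ?A + card {a, b}"
    using tD(10) ab b by (metis card_Diff_subset card_mono finite.emptyI finite.insertI insert_subset empty_subsetI le_add_diff_inverse2)
  then show "card A = card ?A + 2" using short by simp
qed

section \<open>Faces met by a tour around all crossings\<close>

text \<open>Between \<open>c\<close> and \<open>\<sigma> c\<close> the contour follows a face, whose
  boundary runs from \<open>turn (\<sigma> c) 3\<close> to \<open>c\<close>. For
  \<open>\<sigma> c = glue D a\<close> the first of these darts is \<open>face_step D a\<close>, so
  \<open>c\<close> is where the boundary of the face of \<open>a\<close> next meets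
  \<open>A\<close>.\<close>

definition first_return :: "dart set \<Rightarrow> (dart \<Rightarrow> dart) \<Rightarrow> dart \<Rightarrow> dart" where
  "first_return A \<sigma> a = inv_into A \<sigma> (glue D a)"

lemma first_return:
  assumes t: "tour (crossings D) A \<sigma>"
  shows "a \<in> A \<Longrightarrow> glue D a \<in> A" "a \<in> A \<Longrightarrow> first_return A \<sigma> a \<in> A"
    "a \<in> A \<Longrightarrow> \<sigma> (first_return A \<sigma> a) = glue D a" "inj_on (first_return A \<sigma>) A"
    "first_return A \<sigma> ` A \<subseteq> A"
    "a \<in> A \<Longrightarrow> c \<in> A \<Longrightarrow> \<sigma> c = glue D a \<Longrightarrow> first_return A \<sigma> a = c"
proof -
  note tD = tourD[OF t]
  show glue: "glue D a \<in> A" if "a \<in> A" for a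
  proof (rule ccontr)
    assume "glue D a \<notin> A"
    moreover have "glue D a \<in> darts D" using that tD(2) invD by auto
    ultimately have "glue D (glue D a) \<notin> A" using tD(8) by (simp add: in_darts_iff)
    then show False using that glue_glue[OF invD] by simp
  qed
  show in_A: "first_return A \<sigma> a \<in> A" if "a \<in> A" for a
    using glue[OF that] tD(11) unfolding first_return_def by (metis inv_into_into)
  show s: "\<sigma> (first_return A \<sigma> a) = glue D a" if "a \<in> A" for a
    using glue[OF that] tD(11) unfolding first_return_def by (metis f_inv_into_f)
  show "inj_on (first_return A \<sigma>) A"
    by (rule inj_onI) (metis s glue_inject[OF invD])
  show "first_return A \<sigma> ` A \<subseteq> A" using in_A by blast
  show "first_return A \<sigma> a = c" if "a \<in> A" "c \<in> A" "\<sigma> c = glue D a"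
    using that tD(6) unfolding first_return_def by (metis inv_into_f_f)
qed

lemma walk_in_orbit:
  "(e, d) \<in> (walk_step T A)\<^sup>* \<Longrightarrow> d = e \<or> d \<in> orbit (face_step D) e"
  by (induction rule: rtrancl_induct) (auto simp: walk_step_def intro: orbit.intros)

text \<open>By \<open>cover\<close> every face meets \<open>A\<close>, and a cycle of
  \<open>first_return\<close> stays in one face. With F = V + 2 this bounds the number of cycles
  from below.\<close>

lemma card_first_return_orbits:
  assumes t: "tour (crossings D) A \<sigma>"
    and cover: "\<And>e. e \<in> darts D \<Longrightarrow> \<exists>a\<in>A. (e, a) \<in> (walk_step (crossings D) A)\<^sup>*"
  shows "card (orbit (face_step D) ` darts D) \<le> card (orbit (first_return A \<sigma>) ` A)"
proof -
  note tD = tourD[OF t]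
  let ?f = "face_step D"
  have f: "finite (darts D)" "inj_on ?f (darts D)" "?f ` darts D \<subseteq> darts D"
    using involutive_finite(2)[OF invD] inj_face_step[OF invD] face_step_image[OF invD] by auto
  have "orbit ?f ` darts D \<subseteq> orbit ?f ` A"
  proof (rule image_subsetI)
    fix e assume e: "e \<in> darts D"
    obtain a where a: "a \<in> A" "(e, a) \<in> (walk_step (crossings D) A)\<^sup>*" using cover[OF e] by blast
    then have "a = e \<or> a \<in> orbit ?f e" using walk_in_orbit by blast
    then have "orbit ?f e = orbit ?f a"
      using orbit_eq_iff[OF f e, of a] a tD(2) by blast
    then show "orbit ?f e \<in> orbit ?f ` A" using a by blast
  qed
  then have "card (orbit ?f ` darts D) \<le> card (orbit ?f ` A)"
    using tD(10) by (intro card_mono) auto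
  also have "\<dots> \<le> card (orbit (first_return A \<sigma>) ` A)"
  proof (rule card_orbits_le[OF f first_return(4,5)[OF t] tD(2)])
    fix a assume a: "a \<in> A"
    have "(turn (glue D a) 3, first_return A \<sigma> a) \<in> (walk_step (crossings D) A)\<^sup>*"
      using tD(9)[OF first_return(2)[OF t a]] first_return(3)[OF t a] by simp
    then have "(?f a, first_return A \<sigma> a) \<in> (walk_step (crossings D) A)\<^sup>*"
      by (simp add: face_step_turn)
    from walk_in_orbit[OF this] show "first_return A \<sigma> a \<in> orbit ?f a"
      by (metis orbit.base orbit_trans)
  qed
  finally show ?thesis .
qed

text \<open>A fixed point of \<open>first_return\<close> is a dart whose edge is crossed twice in
  succession. The base edge may not be used, but it can supply both fixed points only if it is the
  only edge still crossed.\<close>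

lemma adjacent_pair:
  assumes t: "tour (crossings D) A \<sigma>" and "card A + 2 \<le> 2 * card (orbit (first_return A \<sigma>) ` A)"
    and "A \<noteq> {x0, glue D x0}"
  obtains a where "a \<in> A" "a \<noteq> x0" "glue D a \<noteq> x0" "\<sigma> a = glue D a"
proof (rule ccontr)
  assume none: "\<not> thesis"
  note tD = tourD[OF t]
  let ?F = "{a\<in>A. first_return A \<sigma> a = a}"
  have fix_iff: "\<sigma> a = glue D a" if "a \<in> ?F" for a
    using that first_return(3)[OF t, of a] by simp
  have "2 \<le> card ?F"
    by (rule two_fixed_points) (use tD(10) first_return[OF t] assms(2) in auto)
  moreover have "?F \<subseteq> {x0, glue D x0}"
  proof
    fix a assume a: "a \<in> ?F"
    then have "a = x0 \<or> glue D a = x0" using none that fix_iff by blast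
    then have "a = x0 \<or> a = glue D x0" using glue_glue[OF invD] by metis
    then show "a \<in> {x0, glue D x0}" by simp
  qed
  moreover have "card {x0, glue D x0} = 2" using glue_neq[OF invD x0] by (simp add: card_insert_if)
  ultimately have "?F = {x0, glue D x0}"
    using card_subset_eq[of "{x0, glue D x0}" ?F] card_mono[of "{x0, glue D x0}" ?F] by simp
  then have x: "x0 \<in> ?F" "glue D x0 \<in> ?F" by auto
  then have "\<sigma> ` {x0, glue D x0} \<subseteq> {x0, glue D x0}" using fix_iff glue_glue[OF invD] by auto
  then have "{x0, glue D x0} = A" using x tD(7)[of "{x0, glue D x0}"] by blast
  then show False using assms(3) by blast
qed

text \<open>Pruning takes away two darts and at most one cycle, the fixed point \<open>a\<close>, so
  the inequality that yields the next pair is preserved.\<close>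

lemma card_first_return_prune:
  assumes t: "tour (crossings D) A \<sigma>" and ab: "a \<in> A" "a \<noteq> x0" "b \<noteq> x0" "b = glue D a" "\<sigma> a = b"
    and z: "z \<in> A" "\<sigma> z = a"
  shows "card (orbit (first_return A \<sigma>) ` A)
    \<le> card (orbit (first_return (A - {a, b}) (\<sigma>(z := \<sigma> b))) ` (A - {a, b})) + 1"
proof -
  note tD = tourD[OF t] and pr = tour_prune[OF t ab z]
  let ?k = "first_return A \<sigma>" and ?A = "A - {a, b}" and ?s = "\<sigma>(z := \<sigma> b)"
  let ?k' = "first_return ?A ?s"
  note fr = first_return[OF t] and fr' = first_return[OF pr(1)]
  have kb: "?k b = z" using fr(6)[of b z] pr(2) z ab glue_glue[OF invD] by simp
  have zA: "z \<in> ?A" using z pr by blast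
  have "orbit ?k ` A \<subseteq> insert (orbit ?k a) (orbit ?k ` ?A)"
  proof (rule image_subsetI)
    fix c assume "c \<in> A"
    then consider "c = a" | "c = b" | "c \<in> ?A" by blast
    then show "orbit ?k c \<in> insert (orbit ?k a) (orbit ?k ` ?A)"
    proof cases
      case 2
      have "orbit ?k b = orbit ?k z"
        using orbit_eq_iff[OF tD(10) fr(4,5) pr(2) z(1)] kb by (metis orbit.base)
      then show ?thesis using 2 zA by blast
    qed auto
  qed
  then have "card (orbit ?k ` A) \<le> card (insert (orbit ?k a) (orbit ?k ` ?A))"
    using tD(10) by (intro card_mono) auto
  also have "\<dots> \<le> card (orbit ?k ` ?A) + 1" using tD(10) by (simp add: card_insert_if)
  also have "card (orbit ?k ` ?A) \<le> card (orbit ?k' ` ?A)"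
  proof (rule card_orbits_le[OF tD(10) fr(4,5) fr'(4,5)])
    fix c assume c: "c \<in> ?A"
    have cA: "c \<in> A" using c by blast
    show "?k' c \<in> orbit ?k c"
    proof (cases "?k' c = z")
      case True
      then have "\<sigma> b = glue D c" using fr'(3)[OF c] by simp
      then have "?k c = b" using fr(6)[OF cA pr(2)] by simp
      then show ?thesis using True kb by (metis orbit.base orbit.step)
    next
      case False
      then have "\<sigma> (?k' c) = glue D c" using fr'(3)[OF c] by simp
      then have "?k c = ?k' c" using fr(6)[OF cA] fr'(2)[OF c] by blast
      then show ?thesis by (metis orbit.base)
    qed
  qed blast
  finally show ?thesis by simp
qed

end

section \<open>Contours\<close>

locale contour = knot_weak_parity K \<psi> + rooted_diagram D x0 for K \<psi> D x0 +
  assumes D_K: "D \<in> K"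
begin

text \<open>
  In \<open>E\<close> the strand that leaves along \<open>x0\<close> first runs around the tree, over everything, and closes
  up at the edge of \<open>x0\<close>. It crosses the dart \<open>a\<close> at the crossing of \<open>I a\<close>, where \<open>I a\<close> points
  to \<open>a\<close>, and turning by 1, 2, 3 gives the darts that point backwards, outwards and forwards.
\<close>

definition fw :: "(dart \<Rightarrow> dart) \<Rightarrow> dart \<Rightarrow> dart" where
  "fw I a = (if a = x0 then x0 else turn (I a) 3)"

text \<open>The end of the edge of \<open>d\<close> on the far side of the contour. At
  \<open>x0\<close> this is the forward dart of the last crossing \<open>l\<close>, since there the
  strand of the contour takes up the old edge of \<open>x0\<close>.\<close>

definition out :: "dart set \<Rightarrow> (dart \<Rightarrow> dart) \<Rightarrow> dart \<Rightarrow> dart \<Rightarrow> dart" where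
  "out A I l d = (if d = x0 then fw I l else if d \<in> A then turn (I d) 2 else d)"

text \<open>Three families make up the edges of \<open>E\<close>: the stubs between the tree and the
  contour, the pieces of the contour, and the edges of \<open>D\<close> with crossed ends moved
  outward. The even labels put the contour on top.\<close>

definition traced :: "diagram \<Rightarrow> dart set \<Rightarrow> (dart \<Rightarrow> dart) \<Rightarrow> (dart \<Rightarrow> dart) \<Rightarrow> dart \<Rightarrow> bool" where
  "traced E A \<sigma> I l \<longleftrightarrow>
     crossings E = crossings D \<union> (\<lambda>a. fst (I a)) ` (A - {x0}) \<and>
     (\<forall>a\<in>A - {x0}. fst (I a) \<notin> crossings D \<and> snd (I a) \<in> {0, 2}) \<and>
     inj_on (\<lambda>a. fst (I a)) (A - {x0}) \<and> l \<in> A \<and> \<sigma> l = x0 \<and>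
     (\<forall>a\<in>A - {x0}. glue E a = I a) \<and>
     (\<forall>a\<in>A. \<sigma> a \<noteq> x0 \<longrightarrow> glue E (fw I a) = turn (I (\<sigma> a)) 1) \<and>
     (\<forall>d\<in>darts D. glue E (out A I l d) = out A I l (glue D d))"

lemma tracedD:
  assumes "traced E A \<sigma> I l"
  shows "crossings E = crossings D \<union> (\<lambda>a. fst (I a)) ` (A - {x0})"
    and "\<And>a. a \<in> A \<Longrightarrow> a \<noteq> x0 \<Longrightarrow> fst (I a) \<notin> crossings D"
    and "\<And>a. a \<in> A \<Longrightarrow> a \<noteq> x0 \<Longrightarrow> snd (I a) \<in> {0, 2}"
    and "\<And>a b. a \<in> A \<Longrightarrow> b \<in> A \<Longrightarrow> a \<noteq> x0 \<Longrightarrow> b \<noteq> x0 \<Longrightarrow> fst (I a) = fst (I b) \<Longrightarrow> a = b"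
    and "l \<in> A" "\<sigma> l = x0"
    and "\<And>a. a \<in> A \<Longrightarrow> a \<noteq> x0 \<Longrightarrow> glue E a = I a"
    and "\<And>a. a \<in> A \<Longrightarrow> \<sigma> a \<noteq> x0 \<Longrightarrow> glue E (fw I a) = turn (I (\<sigma> a)) 1"
    and "\<And>d. d \<in> darts D \<Longrightarrow> glue E (out A I l d) = out A I l (glue D d)"
    and "\<And>a. a \<in> A \<Longrightarrow> a \<noteq> x0 \<Longrightarrow> I a \<in> darts E"
    and "\<And>d. d \<in> darts D \<Longrightarrow> d \<in> darts E"
proof -
  note t = assms[unfolded traced_def]
  show cr: "crossings E = crossings D \<union> (\<lambda>a. fst (I a)) ` (A - {x0})" "l \<in> A" "\<sigma> l = x0"
    using t by simp_all
  show "fst (I a) \<notin> crossings D" "snd (I a) \<in> {0, 2}" "glue E a = I a" "I a \<in> darts E"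
    if "a \<in> A" "a \<noteq> x0" for a
    using t that by (auto simp: in_darts_iff)
  show "a = b" if "a \<in> A" "b \<in> A" "a \<noteq> x0" "b \<noteq> x0" "fst (I a) = fst (I b)" for a b
  proof -
    have "inj_on (\<lambda>a. fst (I a)) (A - {x0})" using t by simp
    from inj_onD[OF this that(5)] show ?thesis using that by simp
  qed
  show "glue E (fw I a) = turn (I (\<sigma> a)) 1" if "a \<in> A" "\<sigma> a \<noteq> x0" for a
    using t that by simp
  show "glue E (out A I l d) = out A I l (glue D d)" if "d \<in> darts D" for d
    using t that by simp
  show "d \<in> darts E" if "d \<in> darts D" for d
    using that cr(1) by (simp add: in_darts_iff)
qed

lemma two_fresh:
  assumes "finite (V :: nat set)"
  obtains p q where "p \<notin> V" "q \<notin> V" "p \<noteq> q"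
proof -
  obtain p where p: "p \<notin> V" using ex_new_if_finite[OF infinite_UNIV_nat assms] by blast
  have "finite (insert p V)" using assms by simp
  then obtain q where "q \<notin> insert p V" using ex_new_if_finite[OF infinite_UNIV_nat] by blast
  then show ?thesis using that p by blast
qed

text \<open>The contour crosses the edge of \<open>d0\<close> at \<open>C\<close>, next to the
  crossing of \<open>W\<close>. Sliding it on puts \<open>C\<close> on the edge beyond, at
  \<open>turn W 2\<close>, and the new \<open>P\<close> and \<open>Q\<close> on the sides, at
  \<open>turn W 3\<close> and \<open>turn W 1\<close>. The inequality is that of the triangle
  \<open>C\<close>, \<open>P\<close>, \<open>W\<close>.\<close>

lemma traced_grow:
  assumes t: "tour T A \<sigma>" and tr: "traced E A \<sigma> I l" and E: "E \<in> K"
    and d0: "d0 \<in> A" "d0 \<noteq> x0" and a0: "a0 \<in> A" "\<sigma> a0 = d0"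
    and W: "W = glue D d0" "fst W \<notin> T"
  obtains E' I' where "E' \<in> K"
    and "traced E' (A - {d0} \<union> {turn W 1, turn W 2, turn W 3})
      (\<sigma>(a0 := turn W 1, turn W 1 := turn W 2, turn W 2 := turn W 3, turn W 3 := \<sigma> d0)) I'
      (if l = d0 then turn W 3 else l)"
    and "\<And>v. v \<in> crossings E \<Longrightarrow> \<psi> E' v = \<psi> E v"
    and "\<And>a. a \<in> A \<Longrightarrow> I' a = I a" "I' (turn W 2) = I d0"
    and "\<psi> E' (fst (I' (turn W 1))) = \<psi> E' (fst (I' (turn W 3)))"
    and "\<psi> E (fst (I d0)) + \<psi> E' (fst (I' (turn W 1))) + \<psi> E (fst W) \<noteq> 1"
proof -
  note tD = tourD[OF t] and trD = tracedD[OF tr]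
  have invE: "involutive E" using K_involutive[OF E] .
  define C where "C = I d0"
  define A' where "A' = A - {d0} \<union> {turn W 1, turn W 2, turn W 3}"
  define \<sigma>' where "\<sigma>' = \<sigma>(a0 := turn W 1, turn W 1 := turn W 2, turn W 2 := turn W 3, turn W 3 := \<sigma> d0)"
  define l' where "l' = (if l = d0 then turn W 3 else l)"
  obtain p q where "p \<notin> crossings E" "q \<notin> crossings E" "p \<noteq> q"
    using two_fresh involutive_finite(1)[OF invE] .
  \<comment> \<open>The label 0 makes these under-darts, so the contour passes over.\<close>
  moreover define P :: dart where "P = (p, 0)"
  moreover define Q :: dart where "Q = (q, 0)"
  ultimately have PQ: "fst P \<notin> crossings E" "fst Q \<notin> crossings E" "fst P \<noteq> fst Q" "snd P \<in> {0, 2}" "snd Q \<in> {0, 2}"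
    by simp_all
  define m where "m = slide_map C W P"
  define I' where "I' = I(turn W 1 := turn Q 2, turn W 2 := C, turn W 3 := turn P 2)"

  have WD: "W \<in> darts D" using W(1) d0 tD(2) invD by auto
  have w: "fst W \<in> crossings D" using WD by (simp add: in_darts_iff)
  have gW: "glue D W = d0" using W(1) glue_glue[OF invD] by simp
  have fst_A: "fst a \<in> T" if "a \<in> A" for a using that tD(3) by blast
  have T_D: "v \<in> crossings D" if "v \<in> T" for v using that tD(1) by blast
  have W_A: "turn W n \<notin> A" "W \<notin> A" for n using fst_A[of "turn W n"] fst_A[of W] W(2) by auto
  have "x0 \<in> A" "\<sigma> d0 \<in> A" using tD d0 by auto
  have "a0 \<noteq> d0" using tD(7)[of "{d0}"] d0 a0 tD(4) by auto
  have sig_inj: "a = b" if "\<sigma> a = \<sigma> b" "a \<in> A" "b \<in> A" for a b using that tD(6) by (meson inj_onD)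
  have l: "l \<noteq> a0" "l \<noteq> x0"
    using trD(6) a0 d0 tD(7)[of "{x0}"] tD(4) by auto
  have CD: "fst C \<notin> crossings D" using trD(2) d0 by (simp add: C_def)
  have CE: "C \<in> darts E" using trD(10) d0 by (simp add: C_def)
  have neq_new: "fst (I a) \<noteq> fst C" if "a \<in> A" "a \<noteq> x0" "a \<noteq> d0" for a
    using that trD(4)[of a d0] d0 by (auto simp: C_def)
  have neq_D: "fst (I a) \<noteq> v" "v \<noteq> fst (I a)" if "a \<in> A" "a \<noteq> x0" "v \<in> crossings D" for a v
    using trD(2)[OF that(1,2)] that(3) by metis+
  have PQ_D: "fst P \<notin> crossings D" "fst Q \<notin> crossings D" "fst P \<noteq> fst C" "fst Q \<noteq> fst C"
    "fst P \<noteq> fst W" "fst Q \<noteq> fst W"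
    using PQ trD(1) CE w by (auto simp: in_darts_iff)
  have CW: "fst C \<noteq> fst W" using CD w by auto
  have neq: "turn C i \<noteq> turn W j" "turn W j \<noteq> turn C i" "C \<noteq> turn W j" "W \<noteq> turn C i"
    "turn W j \<noteq> C" "turn C i \<noteq> W" "C \<noteq> W" "W \<noteq> C" for i j
    using CW by (metis fst_turn)+
  have m_simps: "m C = W" "m (turn C 1) = turn P 3" "m (turn C 2) = turn W 2" "m (turn C 3) = turn P 1"
    "m W = C" "m (turn W 1) = turn P 2" "m (turn W 2) = turn C 2" "m (turn W 3) = P"
    by (simp_all add: m_def slide_map_def neq)
  have m_fix: "m z = z" if "fst z \<noteq> fst C" "fst z \<noteq> fst W" for z
    using that by (auto simp: m_def slide_map_def)
  have fst_fw: "fst (fw I a) \<noteq> fst W" if "a \<in> A" for a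
    using that neq_D(1)[of a "fst W"] w W(2) fst_A[of x0] \<open>x0 \<in> A\<close> by (auto simp: fw_def)
  have fst_fw_C: "fst (fw I a) \<noteq> fst C" if "a \<in> A" "a \<noteq> d0" for a
    using that neq_new[of a] CD x0 by (auto simp: fw_def in_darts_iff)
  have fw_inj: "a = b" if "fw I a = fw I b" "a \<in> A" "b \<in> A" for a b
  proof -
    have "fst (fw I a) = fst (fw I b)" using that by simp
    then show ?thesis
      using that(2,3) trD(2)[of a] trD(2)[of b] trD(4)[of a b] x0
      by (auto simp: fw_def in_darts_iff split: if_splits)
  qed
  have back_C: "glue E (turn C 1) = fw I a0"
    using trD(8)[OF a0(1)] a0 d0 by (metis C_def glue_eq_iff[OF invE])
  have out_C: "glue E (turn C 2) = W"
    using trD(9)[of d0] d0 tD(2) W_A(2) \<open>x0 \<in> A\<close> W(1) by (auto simp: out_def C_def)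
  have back_W: "glue E (turn C 1) \<noteq> turn W 1"
    using back_C fst_fw[OF a0(1)] by (metis fst_turn)
  have WE: "W \<in> darts E" using trD(11) WD .
  obtain E' where E': "E' \<in> K" "crossings E' = crossings E \<union> {fst P, fst Q}"
    and psi: "\<psi> E' (fst P) = \<psi> E' (fst Q)" "\<And>v. v \<in> crossings E \<Longrightarrow> \<psi> E' v = \<psi> E v"
      "\<psi> E (fst C) + \<psi> E' (fst P) + \<psi> E (fst W) \<noteq> 1"
    and eqs: "glue E' (turn W 1) = turn Q 2" "glue E' (turn C 1) = turn Q 1" "glue E' (turn W 2) = C"
      "glue E' (turn C 3) = turn P 3" "glue E' (turn W 3) = turn P 2"
      "glue E' (turn Q 3) = m (glue E (turn C 1))" "glue E' Q = m (glue E (turn W 1))"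
    and gen: "\<And>z. z \<in> darts E \<Longrightarrow>
      z \<notin> {turn C 1, glue E (turn C 1), turn W 1, glue E (turn W 1), turn C 2, W} \<Longrightarrow>
      glue E' (m z) = m (glue E z)"
    unfolding m_def
    by (rule slide[OF E CE WE CW _ out_C back_W PQ(1,2,3,4,5)])
      (use trD(3)[OF d0] in \<open>simp_all add: C_def\<close>)
  have invE': "involutive E'" using K_involutive[OF E'(1)] .
  have gen': "glue E' (m z) = m (glue E z)"
    if "z \<in> darts E" "z \<noteq> turn C 1" "z \<noteq> fw I a0" "z \<noteq> turn W 1" "glue E z \<noteq> turn W 1" "z \<noteq> turn C 2" "z \<noteq> W" for z
  proof (rule gen[OF that(1)])
    have "z \<noteq> glue E (turn W 1)" using that(5) glue_glue[OF invE] by metis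
    then show "z \<notin> {turn C 1, glue E (turn C 1), turn W 1, glue E (turn W 1), turn C 2, W}"
      using that back_C by simp
  qed
  have \<sigma>_old: "\<sigma>' a = \<sigma> a" "\<sigma> a \<noteq> d0" if "a \<in> A" "a \<noteq> a0" for a
    using that sig_inj[of a a0] a0 W_A by (auto simp: \<sigma>'_def)
  have \<sigma>_new: "\<sigma>' a0 = turn W 1" "\<sigma>' (turn W 1) = turn W 2" "\<sigma>' (turn W 2) = turn W 3" "\<sigma>' (turn W 3) = \<sigma> d0"
    using a0 W_A by (auto simp: \<sigma>'_def)
  have I_old: "I' a = I a" if "a \<in> A" for a
    using that W_A by (auto simp: I'_def)
  have I_new: "I' (turn W 1) = turn Q 2" "I' (turn W 2) = C" "I' (turn W 3) = turn P 2"
    by (simp_all add: I'_def)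
  have Wx: "turn W n \<noteq> x0" "W \<noteq> x0" for n using W_A \<open>x0 \<in> A\<close> by auto
  have fw_old: "fw I' a = fw I a" if "a \<in> A" for a using I_old[OF that] by (simp add: fw_def)
  have fw_new: "fw I' (turn W 1) = turn Q 1" "fw I' (turn W 2) = turn C 3" "fw I' (turn W 3) = turn P 1"
    using Wx by (simp_all add: fw_def I_new)
  have A'_cases: "a \<in> A' \<Longrightarrow> a = turn W 1 \<or> a = turn W 2 \<or> a = turn W 3 \<or> (a \<in> A \<and> a \<noteq> d0)" for a
    by (auto simp: A'_def)
  have fw_E: "fw I a \<in> darts E" if "a \<in> A" for a
    using that trD(10)[of a] trD(11)[of x0] x0 by (auto simp: fw_def)
  have m_old: "m a = a" if "a \<in> A" for a
    using that fst_A[OF that] CD T_D W(2) by (intro m_fix) auto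
  have m_I: "m (turn (I a) n) = turn (I a) n" "m (I a) = I a" if "a \<in> A" "a \<noteq> x0" "a \<noteq> d0" for a n
    using neq_new[OF that] neq_D(1)[OF that(1,2) w] by (auto intro!: m_fix)
  have m_fw: "m (fw I a) = fw I a" if "a \<in> A" "a \<noteq> d0" for a
    using m_fix fst_fw[OF that(1)] fst_fw_C[OF that] by blast

  \<comment> \<open>\<open>S1\<close>, \<open>S2\<close> and \<open>S3\<close> are the clauses of
    \<open>traced\<close> for the stubs, the contour and the outer edges.\<close>
  have S1: "glue E' a = I' a" if "a \<in> A'" "a \<noteq> x0" for a
    using A'_cases[OF that(1)]
  proof (elim disjE conjE)
    assume a: "a \<in> A" "a \<noteq> d0"
    have ga: "glue E a = I a" using trD(7) a(1) that(2) .
    have fa: "fst a \<in> crossings D" using fst_A[OF a(1)] T_D by blast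
    have "glue E' (m a) = m (glue E a)"
    proof (rule gen')
      show "a \<in> darts E" using trD(11) a tD(2) by blast
      show "a \<noteq> turn C 1" "a \<noteq> turn C 2" using fa CD by auto
      show "a \<noteq> fw I a0"
        using a that(2) neq_D(2)[of a0 "fst a"] fa a0(1) by (auto simp: fw_def)
      show "a \<noteq> turn W 1" "a \<noteq> W" using W_A a by auto
      show "glue E a \<noteq> turn W 1" using ga neq_D(1)[OF a(1) that(2) w] by (metis fst_turn)
    qed
    then show ?thesis using ga m_old[OF a(1)] m_I(2)[OF a(1) that(2) a(2)] I_old[OF a(1)] by simp
  qed (use eqs I_new in simp_all)
  have S2: "glue E' (fw I' a) = turn (I' (\<sigma>' a)) 1" if "a \<in> A'" "\<sigma>' a \<noteq> x0" for a
    using A'_cases[OF that(1)]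
  proof (elim disjE conjE)
    assume a: "a = turn W 1"
    have "glue E' (turn Q 1) = turn C 1" using eqs(2) glue_glue[OF invE'] by metis
    then show ?thesis by (simp add: a fw_new \<sigma>_new I_new)
  next
    assume a: "a = turn W 2"
    show ?thesis using eqs(4) by (simp add: a fw_new \<sigma>_new I_new)
  next
    assume a: "a = turn W 3"
    have sd: "\<sigma> d0 \<noteq> x0" "\<sigma> d0 \<noteq> d0"
      using that(2) sig_inj[of d0 a0] a0 d0 \<open>a0 \<noteq> d0\<close> by (auto simp: a \<sigma>_new)
    have g: "glue E (turn C 3) = turn (I (\<sigma> d0)) 1"
      using trD(8)[OF d0(1) sd(1)] d0(2) by (simp add: fw_def C_def)
    have "glue E' (m (turn C 3)) = m (glue E (turn C 3))"
    proof (rule gen')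
      show "turn C 3 \<noteq> fw I a0" using fst_fw_C[OF a0(1) \<open>a0 \<noteq> d0\<close>] by (metis fst_turn)
      show "glue E (turn C 3) \<noteq> turn W 1"
        using g neq_D(1)[OF \<open>\<sigma> d0 \<in> A\<close> sd(1) w] by (metis fst_turn)
    qed (use CE neq in simp_all)
    then show ?thesis
      using m_I(1)[OF \<open>\<sigma> d0 \<in> A\<close> sd] I_old[OF \<open>\<sigma> d0 \<in> A\<close>] by (simp add: a fw_new \<sigma>_new g m_simps)
  next
    assume a: "a \<in> A" "a \<noteq> d0"
    show ?thesis
    proof (cases "a = a0")
      case True
      have "glue E' (turn Q 3) = fw I a0" using eqs(6) back_C m_fw[OF a0(1) \<open>a0 \<noteq> d0\<close>] by simp
      then have "glue E' (fw I a0) = turn Q 3" using glue_glue[OF invE'] by metis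
      then show ?thesis by (simp add: True \<sigma>_new I_new fw_old[OF a0(1)])
    next
      case False
      have sa: "\<sigma>' a = \<sigma> a" "\<sigma> a \<noteq> d0" "\<sigma> a \<in> A" "\<sigma> a \<noteq> x0"
        using \<sigma>_old[OF a(1) False] that(2) tD(5) a(1) by (simp_all add: image_subset_iff)
      have g: "glue E (fw I a) = turn (I (\<sigma> a)) 1" using trD(8)[OF a(1) sa(4)] .
      have "glue E' (m (fw I a)) = m (glue E (fw I a))"
      proof (rule gen')
        show "fw I a \<in> darts E" using fw_E[OF a(1)] .
        show "fw I a \<noteq> turn C 1" "fw I a \<noteq> turn C 2" using fst_fw_C[OF a] by (metis fst_turn)+
        show "fw I a \<noteq> turn W 1" "fw I a \<noteq> W" using fst_fw[OF a(1)] by (metis fst_turn)+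
        show "fw I a \<noteq> fw I a0" using fw_inj[of a a0] a(1) a0(1) False by blast
        show "glue E (fw I a) \<noteq> turn W 1" using g neq_D(1)[OF sa(3,4) w] by (metis fst_turn)
      qed
      then show ?thesis
        using m_fw[OF a] m_I(1)[OF sa(3,4,2)] I_old[OF sa(3)] by (simp add: g sa(1) fw_old[OF a(1)])
    qed
  qed

  have out_D: "out A I l d \<in> darts E" if "d \<in> darts D" for d
    using that trD(5) fw_E[of l] trD(10)[of d] trD(11)[of d] by (auto simp: out_def)
  have turn_I: "a = b \<and> i = j" if "turn (I a) i = turn (I b) j" "a \<in> A" "b \<in> A" "a \<noteq> x0" "b \<noteq> x0" for a b i j
  proof -
    have "a = b" using trD(4)[OF that(2-5)] that(1) by (metis fst_turn)
    then show ?thesis using that(1) by simp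
  qed
  have out_inj: "d = e" if "out A I l d = out A I l e" "d \<in> darts D" "e \<in> darts D" for d e
  proof -
    have "fst (out A I l d) = fst (out A I l e)" using that by simp
    then show ?thesis
      using that l trD(5) trD(2)[of d] trD(2)[of e] trD(2)[of l]
        turn_I[of d 2 e 2] turn_I[of d 2 l 3] turn_I[of l 3 e 2]
      by (auto simp: out_def fw_def in_darts_iff split: if_splits)
  qed
  have out_W: "out A I l W = W" "out A I l (turn W n) = turn W n" for n
    using W_A Wx by (simp_all add: out_def)
  have out_d0: "out A I l d0 = turn C 2" using d0 by (simp add: out_def C_def)
  have in_A': "turn W 1 \<in> A'" "turn W 2 \<in> A'" "turn W 3 \<in> A'" "d0 \<notin> A'" "W \<notin> A'"
    using W_A d0 by (auto simp: A'_def)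
  have A'_old: "e \<in> A' \<longleftrightarrow> e \<in> A" if "e \<noteq> d0" "e \<noteq> turn W 1" "e \<noteq> turn W 2" "e \<noteq> turn W 3" for e
    using that by (auto simp: A'_def)
  \<comment> \<open>Sliding carries outer ends to outer ends. The darts left out are the two of the
    edge of \<open>d0\<close>, which is now inside the contour, and \<open>turn W 1\<close>, beyond
    which \<open>Q\<close> was inserted.\<close>
  have m_out: "m (out A I l e) = out A' I' l' e" if e: "e \<in> darts D" "e \<noteq> d0" "e \<noteq> W" "e \<noteq> turn W 1" for e
  proof -
    consider "e = turn W 2" | "e = turn W 3" | "e = x0" | "e \<in> A" "e \<noteq> x0" | "e \<notin> A" "e \<noteq> turn W 2" "e \<noteq> turn W 3"
      by blast
    then show ?thesis
    proof cases
      case 1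
      then show ?thesis using out_W(2)[of 2] Wx in_A' m_simps(7) by (simp add: out_def[of A'] I_new)
    next
      case 2
      then show ?thesis using out_W(2)[of 3] Wx in_A' m_simps(8) by (simp add: out_def[of A'] I_new)
    next
      case 3
      show ?thesis
      proof (cases "l = d0")
        case True
        then show ?thesis
          using 3 d0 m_simps(4) by (simp add: out_def l'_def fw_new) (simp add: fw_def C_def[symmetric])
      next
        case False
        then show ?thesis using 3 m_fw[OF trD(5)] fw_old[OF trD(5)] by (simp add: out_def l'_def)
      qed
    next
      case 4
      then have "e \<noteq> turn W 2" "e \<noteq> turn W 3" using W_A by auto
      then show ?thesis
        using 4 m_I(1)[OF 4 e(2)] e A'_old[of e] I_old[OF 4(1)] by (simp add: out_def)
    next
      case 5
      then have "fst e \<noteq> fst W" using same_crossing_turn[of e W] e by auto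
      moreover have "fst e \<noteq> fst C" using e(1) CD by (auto simp: in_darts_iff)
      moreover have "e \<noteq> x0" using 5 \<open>x0 \<in> A\<close> by auto
      ultimately show ?thesis using 5 e m_fix[of e] A'_old[of e] by (simp add: out_def)
    qed
  qed
  have out'_W1: "out A' I' l' (turn W 1) = Q" using Wx in_A' by (simp add: out_def I_new)
  have out'_W: "out A' I' l' W = W" and out'_d0: "out A' I' l' d0 = d0"
    using in_A' Wx d0 by (simp_all add: out_def)
  have S3_W1: "glue E' (out A' I' l' (turn W 1)) = out A' I' l' (glue D (turn W 1))"
  proof -
    have "turn W 1 \<in> darts D" using WD by simp
    then have "glue E (turn W 1) = out A I l (glue D (turn W 1))"
      using trD(9)[of "turn W 1"] out_W by simp
    moreover have "glue D (turn W 1) \<noteq> d0" "glue D (turn W 1) \<noteq> W" "glue D (turn W 1) \<noteq> turn W 1"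
      using gW W(1) glue_glue[OF invD] glue_neq[OF invD \<open>turn W 1 \<in> darts D\<close>] W_A d0 by (metis turn_eq_self_iff(1) zero_neq_one)+
    ultimately show ?thesis using m_out[of "glue D (turn W 1)"] eqs(7) out'_W1 WD invD by simp
  qed
  have S3_d0: "glue E' d0 = W"
  proof -
    have ga: "glue E d0 = C" using trD(7) d0 by (simp add: C_def)
    have fa: "fst d0 \<in> crossings D" using fst_A[OF d0(1)] T_D by blast
    have "glue E' (m d0) = m (glue E d0)"
    proof (rule gen')
      show "d0 \<in> darts E" using trD(11) d0 tD(2) by blast
      show "d0 \<noteq> turn C 1" "d0 \<noteq> turn C 2" using fa CD by auto
      show "d0 \<noteq> fw I a0"
        using d0 neq_D(2)[of a0 "fst d0"] fa a0(1) by (auto simp: fw_def)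
      show "d0 \<noteq> turn W 1" "d0 \<noteq> W" using W_A d0 by auto
      show "glue E d0 \<noteq> turn W 1" using ga neq by simp
    qed
    then show ?thesis using ga m_old[OF d0(1)] m_simps by simp
  qed
  have S3: "glue E' (out A' I' l' d) = out A' I' l' (glue D d)" if d: "d \<in> darts D" for d
  proof -
    consider "d = turn W 1" | "glue D d = turn W 1" | "d = d0" | "d = W"
      | "d \<noteq> turn W 1" "glue D d \<noteq> turn W 1" "d \<noteq> d0" "d \<noteq> W" by blast
    then show ?thesis
    proof cases
      case 1
      then show ?thesis using S3_W1 by simp
    next
      case 2
      then have "glue D (turn W 1) = d" using glue_glue[OF invD] by metis
      then show ?thesis using S3_W1 2 glue_eq_iff[OF invE'] by metis
    next
      case 3
      then show ?thesis using S3_d0 out'_W out'_d0 W(1) by simp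
    next
      case 4
      then show ?thesis using S3_d0 out'_W out'_d0 gW glue_eq_iff[OF invE'] by metis
    next
      case 5
      have gd: "glue D d \<noteq> d0" "glue D d \<noteq> W" "glue D d \<in> darts D"
        using 5 gW W(1) glue_glue[OF invD] d invD by (metis, metis, simp)
      have fst_out: "out A I l d \<noteq> fw I a0"
        using l fw_inj[of l a0] a0 trD(5) d W_A 5 trD(2)[of a0] trD(2)[of d] x0 turn_I[of d 2 a0 3] \<open>x0 \<in> A\<close>
        by (auto simp: out_def fw_def in_darts_iff split: if_splits)
      have "glue E' (m (out A I l d)) = m (glue E (out A I l d))"
      proof (rule gen')
        show "out A I l d \<in> darts E" using out_D d .
        show "out A I l d \<noteq> turn C 1"
          using l 5 d0 trD(5) d CD turn_I[of d 2 d0 1] turn_I[of l 3 d0 1] \<open>x0 \<in> A\<close>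
          by (auto simp: out_def fw_def C_def in_darts_iff split: if_splits)
        show "out A I l d \<noteq> fw I a0" by (rule fst_out)
        have "turn W 1 \<in> darts D" using WD by simp
        then show "out A I l d \<noteq> turn W 1" "out A I l d \<noteq> W"
          using out_W out_inj[of d W] out_inj[of d "turn W 1"] d WD 5 by metis+
        show "out A I l d \<noteq> turn C 2"
          using out_d0 out_inj[of d d0] d d0 tD(2) 5 by (metis subsetD)
        show "glue E (out A I l d) \<noteq> turn W 1"
          using trD(9)[OF d] out_W(2)[of 1] out_inj[of "glue D d" "turn W 1"] gd(3) \<open>turn W 1 \<in> darts D\<close> 5(2)
          by metis
      qed
      then show ?thesis using m_out[of d] m_out[of "glue D d"] trD(9)[OF d] d gd 5 by simp
    qed
  qed
  have "traced E' A' \<sigma>' I' l'"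
    unfolding traced_def
  proof (intro conjI ballI impI)
    have "A' - {x0} = (A - {x0, d0}) \<union> {turn W 1, turn W 2, turn W 3}"
      using Wx(1)[of 1] Wx(1)[of 2] Wx(1)[of 3] by (auto simp: A'_def)
    then have "(\<lambda>a. fst (I' a)) ` (A' - {x0}) = (\<lambda>a. fst (I' a)) ` (A - {x0, d0}) \<union> {fst Q, fst C, fst P}"
      by (simp add: image_Un I_new)
    also have "(\<lambda>a. fst (I' a)) ` (A - {x0, d0}) = (\<lambda>a. fst (I a)) ` (A - {x0, d0})"
      by (rule image_cong) (use I_old in simp_all)
    also have "(\<lambda>a. fst (I a)) ` (A - {x0, d0}) \<union> {fst Q, fst C, fst P} = (\<lambda>a. fst (I a)) ` (A - {x0}) \<union> {fst P, fst Q}"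
      using d0 by (auto simp: C_def)
    finally show "crossings E' = crossings D \<union> (\<lambda>a. fst (I' a)) ` (A' - {x0})"
      using E'(2) trD(1) by auto
    have A'_x0: "a \<in> A' - {x0} \<Longrightarrow> a = turn W 1 \<or> a = turn W 2 \<or> a = turn W 3 \<or> (a \<in> A \<and> a \<noteq> d0 \<and> a \<noteq> x0)" for a
      using A'_cases[of a] by blast
    show "fst (I' a) \<notin> crossings D" if "a \<in> A' - {x0}" for a
      using A'_x0[OF that] trD(2)[of a] PQ_D CD I_old[of a] by (auto simp: I_new)
    have even: "snd (turn d 2) \<in> {0, 2}" if "snd d \<in> {0, 2}" for d :: dart
      using that by (auto simp: turn_def)
    show "snd (I' a) \<in> {0, 2}" if "a \<in> A' - {x0}" for a
      using A'_x0[OF that]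
    proof (elim disjE conjE)
      assume "a \<in> A" "a \<noteq> x0"
      then show ?thesis using trD(3)[of a] I_old[of a] by simp
    next
      assume "a = turn W 2"
      then show ?thesis using trD(3)[OF d0] by (simp add: I_new C_def)
    qed (use even[OF PQ(4)] even[OF PQ(5)] in \<open>simp_all add: I_new\<close>)
    show "inj_on (\<lambda>a. fst (I' a)) (A' - {x0})"
    proof (rule inj_onI)
      fix a b assume a: "a \<in> A' - {x0}" and b: "b \<in> A' - {x0}" and eq: "fst (I' a) = fst (I' b)"
      have old: "fst (I' c) = fst (I c)" "fst (I' c) \<notin> {fst P, fst Q, fst C}"
        if "c \<in> A" "c \<noteq> d0" "c \<noteq> x0" for c
        using I_old[OF that(1)] trD(10)[OF that(1,3)] PQ(1,2) neq_new[OF that(1,3,2)]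
        by (auto simp: in_darts_iff)
      have new: "fst (I' c) \<in> {fst P, fst Q, fst C}" if "c \<in> {turn W 1, turn W 2, turn W 3}" for c
        using that by (auto simp: I_new)
      consider "a \<in> A" "a \<noteq> d0" "a \<noteq> x0" "b \<in> A" "b \<noteq> d0" "b \<noteq> x0"
        | "a \<in> {turn W 1, turn W 2, turn W 3}" "b \<in> {turn W 1, turn W 2, turn W 3}"
        using A'_x0[OF a] A'_x0[OF b] old(2)[of a] old(2)[of b] new[of a] new[of b] eq by auto
      then show "a = b"
      proof cases
        case 1
        then show ?thesis using eq old(1)[of a] old(1)[of b] trD(4)[of a b] by simp
      next
        case 2
        have "fst Q \<noteq> fst C" "fst P \<noteq> fst C" "fst Q \<noteq> fst P" using PQ_D PQ by simp_all
        then show ?thesis using 2 eq by (elim insertE emptyE) (simp_all add: I_new)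
      qed
    qed
    show "l' \<in> A'" using trD(5) by (simp add: l'_def A'_def)
    show "\<sigma>' l' = x0"
      using \<sigma>_new(4) \<sigma>_old(1)[OF trD(5)] l trD(6) by (auto simp: l'_def)
  qed (use S1 S2 S3 in auto)
  then show thesis
    using that[of E' I'] E'(1) psi I_old I_new unfolding A'_def \<sigma>'_def l'_def C_def by simp
qed

text \<open>The crossings at \<open>a\<close> and \<open>b\<close> are joined both by a piece of the
  contour and by the edge between them. This is a bigon with the contour over at both
  corners.\<close>

lemma traced_prune:
  assumes t: "tour T A \<sigma>" and tr: "traced E A \<sigma> I l" and E: "E \<in> K"
    and ab: "a \<in> A" "a \<noteq> x0" "b \<noteq> x0" "b = glue D a" "\<sigma> a = b" and z: "z \<in> A" "\<sigma> z = a"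
  obtains E' where "E' \<in> K"
    and "traced E' (A - {a, b}) (\<sigma>(z := \<sigma> b)) I (if l = b then z else l)"
    and "\<And>v. v \<in> crossings E' \<Longrightarrow> \<psi> E' v = \<psi> E v"
    and "\<psi> E (fst (I a)) = \<psi> E (fst (I b))"
proof -
  note tD = tourD[OF t] and trD = tracedD[OF tr] and pr = tour_prune[OF t ab z]
  have invE: "involutive E" using K_involutive[OF E] .
  have b: "b \<in> A" and zab: "z \<noteq> a" "z \<noteq> b" using pr by blast+
  have short: "a \<noteq> b" "\<sigma> b \<noteq> a" using tour_no_short_cycle[OF t ab(1,2,3,5)] by blast+
  have sig_inj: "c = d" if "\<sigma> c = \<sigma> d" "c \<in> A" "d \<in> A" for c d using that tD(6) by (meson inj_onD)
  have sb: "\<sigma> b \<noteq> b" using sig_inj[of a b] ab b short by auto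
  have sA: "\<sigma> c \<in> A" if "c \<in> A" for c using that tD(5) by blast
  have ga: "glue D b = a" using ab glue_glue[OF invD] by simp
  have x0A: "x0 \<in> A" by (rule tD(4))
  have AD: "c \<in> darts D" "fst c \<in> crossings D" if "c \<in> A" for c using that tD(2) by (auto simp: in_darts_iff)
  have turn_I: "c = d \<and> i = j" if "turn (I c) i = turn (I d) j" "c \<in> A" "d \<in> A" "c \<noteq> x0" "d \<noteq> x0" for c d i j
  proof -
    have "c = d" using trD(4)[OF that(2-5)] that(1) by (metis fst_turn)
    then show ?thesis using that(1) by simp
  qed
  have old_I: "d \<noteq> turn (I c) i" "turn (I c) i \<noteq> d" "d \<noteq> I c" "I c \<noteq> d"
    if "fst d \<in> crossings D" "c \<in> A" "c \<noteq> x0" for c d i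
    using that trD(2)[OF that(2,3)] by auto
  have l: "l \<noteq> z" using trD(6) z ab by auto
  have fw_z: "glue E (fw I z) = turn (I a) 1" using trD(8)[OF z(1)] z ab by simp
  have x_eq: "glue E (turn (I a) 1) = fw I z" using fw_z glue_glue[OF invE] by metis
  have ends: "glue E (I a) = a" "glue E (I b) = b"
    using trD(7)[OF ab(1,2)] trD(7)[OF b ab(3)] glue_glue[OF invE] by metis+
  have bigon: "glue E (turn (I a) 3) = turn (I b) 1" "glue E (turn (I a) 2) = turn (I b) 2"
    using trD(8)[OF ab(1)] trD(9)[OF AD(1)[OF ab(1)]] ab b by (simp_all add: fw_def out_def)
  have gx0: "glue D x0 \<noteq> a" "glue D x0 \<noteq> b" "glue D x0 \<noteq> x0" "glue D x0 \<in> darts D"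
    using ab ga glue_glue[OF invD] glue_neq[OF invD x0] x0 invD by (metis, metis, simp, simp)
  define x' where "x' = glue E (turn (I b) 3)"
  have x'_glue: "glue E x' = turn (I b) 3" unfolding x'_def by (rule glue_glue[OF invE])
  \<comment> \<open>Beyond \<open>b\<close> the strand goes on to the next crossing of the contour
    or, if \<open>b\<close> was the last, along the old edge of \<open>x0\<close>.\<close>
  have x'_next: "x' = turn (I (\<sigma> b)) 1" if "\<sigma> b \<noteq> x0"
    using trD(8)[OF b that] ab(3) by (simp add: x'_def fw_def)
  have x'_last: "l = b" "x' = out A I l (glue D x0)" if "\<sigma> b = x0"
  proof -
    show "l = b" using sig_inj[of l b] trD(5,6) b that by simp
    then show "x' = out A I l (glue D x0)"
      using trD(9)[OF x0] ab(3) by (simp add: x'_def out_def fw_def)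
  qed
  have fst_fw: "fst (fw I c) \<noteq> fst (I d)" if "c \<in> A" "d \<in> A" "d \<noteq> x0" "c \<noteq> d" for c d
    using that trD(4)[of c d] trD(2)[of d] AD(2)[OF x0A] by (auto simp: fw_def)
  have fst_out: "fst (out A I l d) \<noteq> fst (I c)" if "d \<noteq> x0" "d \<in> darts D" "c \<in> A" "c \<noteq> x0" "c \<noteq> d" for c d
    using that trD(4)[of c d] trD(2)[of c] by (auto simp: out_def in_darts_iff)
  have outside: "fst (glue E d) \<notin> {fst (I a), fst (I b)}"
    if "d \<in> {I a, turn (I a) 1, I b, turn (I b) 3}" for d
  proof -
    have "fst (I a) \<notin> crossings D" "fst (I b) \<notin> crossings D" using trD(2) ab b by blast+
    then have 1: "fst a \<notin> {fst (I a), fst (I b)}" "fst b \<notin> {fst (I a), fst (I b)}"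
      using AD(2)[OF ab(1)] AD(2)[OF b] by (metis empty_iff insert_iff)+
    have 2: "fst (fw I z) \<notin> {fst (I a), fst (I b)}"
      using fst_fw[OF z(1) ab(1,2) zab(1)] fst_fw[OF z(1) b ab(3) zab(2)] by simp
    have 3: "fst x' \<notin> {fst (I a), fst (I b)}"
    proof (cases "\<sigma> b = x0")
      case True
      then show ?thesis
        using x'_last(2) fst_out[OF gx0(3,4) ab(1,2)] fst_out[OF gx0(3,4) b ab(3)] gx0 by simp
    next
      case False
      then show ?thesis
        using x'_next trD(4)[OF sA[OF b] ab(1) False ab(2)] trD(4)[OF sA[OF b] b False ab(3)] short sb by auto
    qed
    show ?thesis using that 1 2 3 ends x_eq x'_def by auto
  qed
  \<comment> \<open>The face of \<open>I a\<close> is the strip between the contour and the tree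
    before \<open>a\<close>: its darts are among \<open>I a\<close>, \<open>fw I z\<close> and the
    walk \<open>R\<close> from \<open>turn a 3\<close>. The corner \<open>turn (I b) 3\<close> lies
    on the other side of the contour.\<close>
  have split: "turn (I b) 3 \<notin> orbit (face_step E) (I a)"
  proof -
    define R where "R = {e. (turn a 3, e) \<in> (walk_step T A)\<^sup>*}"
    define S where "S = {I a, fw I z} \<union> R"
    have R_D: "e \<in> darts D \<and> fst e \<in> T" if "e \<in> R" for e
    proof -
      have "(turn a 3, e) \<in> (walk_step T A)\<^sup>*" using that by (simp add: R_def)
      then show ?thesis
      proof (induction rule: rtrancl_induct)
        case base
        then show ?case using AD(1)[OF ab(1)] tD(3) ab(1) by auto
      next
        case (step y w)
        then have "w = face_step D y" "y \<in> darts D" "fst y \<in> T" "y \<notin> A"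
          by (auto simp: walk_step_def)
        then show ?case using tD(8)[of y] invD by (simp add: face_step_turn)
      qed
    qed
    \<comment> \<open>\<open>walk_step\<close> is deterministic and stops at \<open>A\<close>, so
      the walk meets \<open>A\<close> only at its end \<open>z\<close>.\<close>
    have R_A: "e = z" if "e \<in> R" "e \<in> A" for e
    proof -
      have "single_valued (walk_step T A)" unfolding single_valued_def walk_step_def by blast
      moreover have "(turn a 3, z) \<in> (walk_step T A)\<^sup>*" using tD(9)[OF z(1)] z(2) by simp
      ultimately have "(e, z) \<in> (walk_step T A)\<^sup>* \<or> (z, e) \<in> (walk_step T A)\<^sup>*"
        using that(1) single_valued_confluent unfolding R_def by fast
      moreover have "e \<notin> Domain (walk_step T A)" "z \<notin> Domain (walk_step T A)"
        using that(2) z(1) unfolding walk_step_def by fast+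
      ultimately show ?thesis by (metis Not_Domain_rtrancl)
    qed
    have "face_step E ` S \<subseteq> S"
    proof (rule image_subsetI)
      fix e assume "e \<in> S"
      then consider "e = I a" | "e = fw I z" | "e \<in> R" "e \<in> A" | "e \<in> R" "e \<notin> A" by (auto simp: S_def)
      then show "face_step E e \<in> S"
      proof cases
        case 1
        then show ?thesis using ends by (simp add: face_step_turn S_def R_def)
      next
        case 2
        then show ?thesis using fw_z by (simp add: face_step_turn S_def)
      next
        case 3
        then have "e = z" using R_A by blast
        then show ?thesis
        proof (cases "z = x0")
          case True
          then show ?thesis using \<open>e = z\<close> fw_z by (simp add: face_step_turn S_def fw_def)
        next
          case False
          then show ?thesis using \<open>e = z\<close> trD(7)[OF z(1)] by (simp add: face_step_turn S_def fw_def)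
        qed
      next
        case 4
        have eD: "e \<in> darts D" "fst e \<in> T" using R_D[OF 4(1)] by blast+
        have "glue D e \<notin> A" using tD(8)[OF eD 4(2)] by blast
        then have "glue E e = glue D e"
          using trD(9)[OF eD(1)] 4(2) x0A by (auto simp: out_def split: if_splits)
        then have "face_step E e = face_step D e" by (simp add: face_step_turn)
        moreover have "(e, face_step D e) \<in> walk_step T A" using walk_stepI eD 4(2) by blast
        ultimately show ?thesis using 4(1) by (simp add: S_def R_def rtrancl_into_rtrancl)
      qed
    qed
    then have "orbit (face_step E) (I a) \<subseteq> S" by (rule orbit_closed_subset) (simp add: S_def)
    moreover have "turn (I b) 3 \<notin> S"
    proof -
      have "turn (I b) 3 \<noteq> I a" using turn_I[of b 3 a 0] b ab short by auto
      moreover have "turn (I b) 3 \<noteq> fw I z" using fst_fw[OF z(1) b ab(3) zab(2)] by (metis fst_turn)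
      moreover have "turn (I b) 3 \<notin> R" using R_D[of "turn (I b) 3"] trD(2)[OF b ab(3)] by (auto simp: in_darts_iff)
      ultimately show ?thesis by (simp add: S_def)
    qed
    ultimately show ?thesis by blast
  qed
  have IE: "I a \<in> darts E" "I b \<in> darts E" "fst (I a) \<noteq> fst (I b)"
    using trD(10) ab b trD(4)[OF ab(1) b ab(2,3)] short by blast+
  define E' where "E' = unpush E (I a) (I b)"
  note par = parity_unpush[OF E IE trD(3)[OF ab(1,2)] trD(3)[OF b ab(3)] bigon outside split, folded E'_def]
  have "R2_pair E' E (glue E (turn (I a) 1)) (glue E (I b)) (I a) (I b)"
    unfolding E'_def by (rule R2_pair_unpush[OF invE IE trD(3)[OF ab(1,2)] trD(3)[OF b ab(3)] bigon outside])
  then interpret R2: R2_pair E' E "fw I z" b "I a" "I b" by (simp add: x_eq ends)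
  have E'_x: "glue E' (fw I z) = x'" "glue E' x' = fw I z"
  proof -
    show "glue E' (fw I z) = x'" unfolding x'_def using R2.glue_E'(8) by simp
    then show "glue E' x' = fw I z" using glue_glue[OF R2.invD] by metis
  qed
  have E'_b: "glue E' b = a" "glue E' a = b"
  proof -
    show "glue E' b = a" using R2.glue_E'(10) ends by simp
    then show "glue E' a = b" using glue_glue[OF R2.invD] by metis
  qed
  have E'_old: "glue E' d = glue E d"
    if "d \<in> darts E" "fst d \<noteq> fst (I a)" "fst d \<noteq> fst (I b)" "d \<noteq> fw I z" "d \<noteq> x'" "d \<noteq> a" "d \<noteq> b" for d
    using R2.glue_E_old[of d] that R2.darts_E[of d] E'_x E'_b by auto
  let ?A = "A - {a, b}" and ?s = "\<sigma>(z := \<sigma> b)" and ?l = "if l = b then z else l"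
  have zA: "z \<in> ?A" using z zab by blast
  have fw_inj: "c = d" if "fw I c = fw I d" "c \<in> A" "d \<in> A" for c d
    using that turn_I[of c 3 d 3] old_I(1,2)[of x0 c 3] old_I(1,2)[of x0 d 3] AD(2)[OF x0A]
    by (auto simp: fw_def split: if_splits)
  have fw_E: "fw I c \<in> darts E" if "c \<in> A" for c
    using that trD(10)[of c] trD(11)[of x0] x0 by (auto simp: fw_def)
  have fw_old: "fw I c \<noteq> d" if "c \<in> A" "d \<in> A" "d \<noteq> x0" for c d
    using that old_I(2)[of d c 3] AD(2)[of d] by (auto simp: fw_def)
  have S1: "glue E' c = I c" if c: "c \<in> ?A" "c \<noteq> x0" for c
  proof -
    have cA: "c \<in> A" "c \<noteq> a" "c \<noteq> b" using c by auto
    have "glue E' c = glue E c"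
    proof (rule E'_old)
      show "c \<in> darts E" using trD(11) AD(1) cA by blast
      show "fst c \<noteq> fst (I a)" "fst c \<noteq> fst (I b)"
        using trD(2)[OF ab(1,2)] trD(2)[OF b ab(3)] AD(2)[OF cA(1)] by metis+
      show "c \<noteq> fw I z" using fw_old[OF z(1) cA(1) c(2)] by blast
      show "c \<noteq> x'"
      proof
        assume "c = x'"
        then have "I c = turn (I b) 3" using x'_glue trD(7)[OF cA(1) c(2)] by simp
        then show False using turn_I[of c 0 b 3] cA b c ab by simp
      qed
    qed (use cA in auto)
    then show ?thesis using trD(7)[OF cA(1) c(2)] by simp
  qed
  have S2: "glue E' (fw I c) = turn (I (?s c)) 1" if c: "c \<in> ?A" "?s c \<noteq> x0" for c
  proof (cases "c = z")
    case True
    then show ?thesis using c(2) E'_x x'_next by simp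
  next
    case False
    have cA: "c \<in> A" "c \<noteq> a" "c \<noteq> b" "\<sigma> c \<noteq> x0" using c False by auto
    have g: "glue E (fw I c) = turn (I (\<sigma> c)) 1" using trD(8) cA by blast
    have "glue E' (fw I c) = glue E (fw I c)"
    proof (rule E'_old)
      show "fw I c \<in> darts E" using fw_E cA by blast
      show "fst (fw I c) \<noteq> fst (I a)" "fst (fw I c) \<noteq> fst (I b)"
        using fst_fw[OF cA(1) ab(1,2) cA(2)] fst_fw[OF cA(1) b ab(3) cA(3)] .
      show "fw I c \<noteq> fw I z" using fw_inj[of c z] cA z False by blast
      show "fw I c \<noteq> x'"
      proof
        assume "fw I c = x'"
        then have "turn (I (\<sigma> c)) 1 = turn (I b) 3" using g x'_glue by simp
        then show False using turn_I[of "\<sigma> c" 1 b 3] sA[OF cA(1)] cA(4) b ab by simp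
      qed
      show "fw I c \<noteq> a" "fw I c \<noteq> b" using fw_old cA ab b by blast+
    qed
    then show ?thesis using g False by simp
  qed
  have out_eq: "out ?A I ?l d = out A I l d" if "d \<noteq> a" "d \<noteq> b" "d = x0 \<Longrightarrow> l \<noteq> b" for d
    using that by (auto simp: out_def)
  have out_ab: "out ?A I ?l a = a" "out ?A I ?l b = b" using ab by (simp_all add: out_def)
  have S3_x0: "glue E' (out ?A I ?l x0) = out ?A I ?l (glue D x0)" if "l = b"
  proof -
    have "\<sigma> b = x0" using that trD(6) by simp
    then have "x' = out A I l (glue D x0)" by (rule x'_last)
    then show ?thesis using that E'_x out_eq[OF gx0(1,2)] gx0(3) by (simp add: out_def[of ?A I _ x0])
  qed
  have S3: "glue E' (out ?A I ?l d) = out ?A I ?l (glue D d)" if d: "d \<in> darts D" for d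
  proof -
    consider "d = a" | "d = b" | "l = b" "d = x0" | "l = b" "glue D d = x0"
      | "d \<noteq> a" "d \<noteq> b" "d = x0 \<Longrightarrow> l \<noteq> b" "glue D d = x0 \<Longrightarrow> l \<noteq> b" by blast
    then show ?thesis
    proof cases
      case 1
      then show ?thesis using out_ab E'_b ab by simp
    next
      case 2
      then show ?thesis using out_ab E'_b ga by simp
    next
      case 3
      then show ?thesis using S3_x0 by simp
    next
      case 4
      then have "glue D x0 = d" using glue_glue[OF invD] by metis
      then show ?thesis using S3_x0[OF 4(1)] 4 glue_glue[OF R2.invD] by metis
    next
      case 5
      have gd: "glue D d \<noteq> a" "glue D d \<noteq> b" using 5 ab ga glue_glue[OF invD] by metis+
      have out_d: "out A I l d \<noteq> c" if "c \<in> A" "c \<noteq> x0" for c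
        using fw_old[OF trD(5) that] that old_I(2)[of c d 2] AD(2)[OF that(1)] by (auto simp: out_def)
      have out_fw: "out A I l e \<noteq> fw I c" if "e \<in> darts D" "c \<in> A" "e = x0 \<Longrightarrow> l \<noteq> c" for e c
        using that fw_inj[of l c] trD(5) turn_I[of e 2 c 3] old_I(2)[of x0 e 2] old_I(1)[of e c 3] AD(2)[OF x0A] x0A
        by (auto simp: out_def fw_def in_darts_iff split: if_splits)
      have fst_d: "fst (out A I l d) \<noteq> fst (I c)" if "c \<in> A" "c \<noteq> x0" "c \<noteq> d" "d = x0 \<Longrightarrow> l \<noteq> c" for c
      proof (cases "d = x0")
        case True
        then show ?thesis using fst_fw[OF trD(5) that(1,2)] that(4) by (simp add: out_def)
      next
        case False
        then show ?thesis using fst_out[OF False d that(1,2,3)] by simp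
      qed
      have "l \<noteq> a" using trD(6) ab by auto
      have "glue E' (out A I l d) = glue E (out A I l d)"
      proof (rule E'_old)
        show "out A I l d \<in> darts E"
          using d fw_E[OF trD(5)] trD(10)[of d] trD(11)[of d] by (auto simp: out_def)
        show "fst (out A I l d) \<noteq> fst (I a)" "fst (out A I l d) \<noteq> fst (I b)"
          using fst_d[OF ab(1,2)] fst_d[OF b ab(3)] 5 \<open>l \<noteq> a\<close> by blast+
        show "out A I l d \<noteq> fw I z" using out_fw[OF d z(1)] l by blast
        show "out A I l d \<noteq> x'"
        proof
          assume "out A I l d = x'"
          then have "out A I l (glue D d) = fw I b"
            using trD(9)[OF d] x'_glue ab(3) by (simp add: fw_def)
          then show False using out_fw[of "glue D d" b] d invD b 5 by simp
        qed
        show "out A I l d \<noteq> a" "out A I l d \<noteq> b" using out_d ab b by blast+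
      qed
      then show ?thesis using trD(9)[OF d] out_eq[of d] out_eq[of "glue D d"] 5 gd by simp
    qed
  qed
  have "traced E' ?A ?s I ?l"
    unfolding traced_def
  proof (intro conjI ballI impI)
    have "crossings E' = crossings E - {fst (I a), fst (I b)}" by (simp add: E'_def unpush_def)
    also have "\<dots> = crossings D \<union> (\<lambda>c. fst (I c)) ` (?A - {x0})"
    proof -
      have "(\<lambda>c. fst (I c)) ` (A - {x0}) = (\<lambda>c. fst (I c)) ` (?A - {x0}) \<union> {fst (I a), fst (I b)}"
        using ab b by auto
      moreover have "fst (I a) \<notin> (\<lambda>c. fst (I c)) ` (?A - {x0})" "fst (I b) \<notin> (\<lambda>c. fst (I c)) ` (?A - {x0})"
        using trD(4)[OF ab(1) _ ab(2)] trD(4)[OF b _ ab(3)] by fast+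
      moreover have "fst (I a) \<notin> crossings D" "fst (I b) \<notin> crossings D" using trD(2) ab b by blast+
      ultimately show ?thesis using trD(1) by auto
    qed
    finally show "crossings E' = crossings D \<union> (\<lambda>c. fst (I c)) ` (?A - {x0})" .
    show "fst (I c) \<notin> crossings D" "snd (I c) \<in> {0, 2}" if "c \<in> ?A - {x0}" for c
      using that trD(2,3)[of c] by blast+
    show "inj_on (\<lambda>c. fst (I c)) (?A - {x0})"
      by (rule inj_onI) (use trD(4) in blast)
    show "?l \<in> ?A" using trD(5) zA \<open>\<sigma> l = x0\<close> ab l by auto
    show "?s ?l = x0" using trD(6) l by auto
  qed (use S1 S2 S3 in auto)
  then show thesis using that[of E'] par by simp
qed

text \<open>A curl on the edge of \<open>x0\<close> makes the strand cross itself at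
  \<open>C\<close>, and the even label of \<open>C\<close> puts the returning strand on top. Slid
  over the crossing of \<open>x0\<close>, the loop surrounds that crossing. Since \<open>x0\<close>
  is over, the new crossing \<open>Q\<close> and the crossing of \<open>x0\<close> bound a bigon
  that a second move could remove, which fixes the parity on both under-darts.\<close>

lemma traced_start:
  assumes x0_over: "snd x0 = 1"
  obtains E I where "E \<in> K"
    and "traced E {x0, turn x0 1, turn x0 2, turn x0 3} (\<lambda>a. turn a 1) I (turn x0 3)"
    and "\<And>v. v \<in> crossings D \<Longrightarrow> \<psi> E v = \<psi> D v"
    and "\<psi> E (fst (I (turn x0 1))) = \<psi> D (fst x0)" "\<psi> E (fst (I (turn x0 3))) = \<psi> D (fst x0)"
proof -
  obtain c where "c \<notin> crossings D"
    using ex_new_if_finite[OF infinite_UNIV_nat involutive_finite(1)[OF invD]] by blast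
  moreover define C :: dart where "C = (c, 0)"
  ultimately have CD: "fst C \<notin> crossings D" "snd C \<in> {0, 2}" by simp_all
  define B where "B = add_curl D x0 C"
  have curl: "R1_curl D B x0 C" unfolding B_def by (rule R1_curl_add_curl[OF invD CD(1) x0])
  interpret R1: R1_curl D B x0 C by (rule curl)
  note par1 = parity_R1[OF curl D_K]
  obtain p q where "p \<notin> crossings B" "q \<notin> crossings B" "p \<noteq> q"
    using two_fresh involutive_finite(1)[OF R1.invE] .
  moreover define P :: dart where "P = (p, 0)"
  moreover define Q :: dart where "Q = (q, 0)"
  ultimately have PQ: "fst P \<notin> crossings B" "fst Q \<notin> crossings B" "fst P \<noteq> fst Q" "snd P \<in> {0, 2}" "snd Q \<in> {0, 2}" by simp_all
  define m where "m = slide_map C x0 P"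
  have x0_cr: "fst x0 \<in> crossings D" using x0 by (simp add: in_darts_iff)
  have CW: "fst C \<noteq> fst x0" using CD(1) x0_cr by metis
  have neq: "turn C i \<noteq> turn x0 j" "turn x0 j \<noteq> turn C i" "C \<noteq> turn x0 j" "x0 \<noteq> turn C i"
    "turn x0 j \<noteq> C" "turn C i \<noteq> x0" "C \<noteq> x0" "x0 \<noteq> C" for i j
    using CW by (metis fst_turn)+
  have PQ_D: "fst P \<notin> crossings D" "fst Q \<notin> crossings D" "fst P \<noteq> fst C" "fst Q \<noteq> fst C"
    "fst P \<noteq> fst x0" "fst Q \<noteq> fst x0"
    using PQ x0_cr by (auto simp: R1.crossings_E)
  have m_simps: "m C = x0" "m (turn C 1) = turn P 3" "m (turn C 2) = turn x0 2" "m (turn C 3) = turn P 1"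
    "m x0 = C" "m (turn x0 1) = turn P 2" "m (turn x0 2) = turn C 2" "m (turn x0 3) = P"
    by (simp_all add: m_def slide_map_def neq)
  have m_fix: "m z = z" if "fst z \<noteq> fst C" "fst z \<noteq> fst x0" for z
    using that by (auto simp: m_def slide_map_def)
  obtain E where E: "E \<in> K" "crossings E = crossings B \<union> {fst P, fst Q}"
    and psi: "\<psi> E (fst P) = \<psi> E (fst Q)" "\<And>v. v \<in> crossings B \<Longrightarrow> \<psi> E v = \<psi> B v"
      "\<psi> B (fst C) + \<psi> E (fst P) + \<psi> B (fst x0) \<noteq> 1"
    and eqs: "glue E (turn x0 1) = turn Q 2" "glue E (turn C 1) = turn Q 1" "glue E (turn x0 2) = C"
      "glue E (turn C 3) = turn P 3" "glue E (turn x0 3) = turn P 2"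
      "glue E (turn Q 3) = m (glue B (turn C 1))" "glue E Q = m (glue B (turn x0 1))"
    and gen: "\<And>z. z \<in> darts B \<Longrightarrow>
      z \<notin> {turn C 1, glue B (turn C 1), turn x0 1, glue B (turn x0 1), turn C 2, x0} \<Longrightarrow>
      glue E (m z) = m (glue B z)"
    unfolding m_def
    by (rule slide[OF par1(1) _ _ CW CD(2) _ _ PQ]) (use x0 neq in \<open>simp_all add: R1.darts_E\<close>)
  have invE: "involutive E" using K_involutive[OF E(1)] .
  define I where "I = (\<lambda>_. C)(turn x0 1 := turn Q 2, turn x0 2 := C, turn x0 3 := turn P 2)"
  have I: "I (turn x0 1) = turn Q 2" "I (turn x0 2) = C" "I (turn x0 3) = turn P 2"
    by (simp_all add: I_def)
  let ?A = "{x0, turn x0 1, turn x0 2, turn x0 3}" and ?s = "\<lambda>a. turn a 1" and ?l = "turn x0 3"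
  have fw: "fw I x0 = x0" "fw I (turn x0 1) = turn Q 1" "fw I (turn x0 2) = turn C 3" "fw I (turn x0 3) = turn P 1"
    by (simp_all add: fw_def I)
  have out: "out ?A I ?l x0 = turn P 1" "out ?A I ?l (turn x0 1) = Q" "out ?A I ?l (turn x0 2) = turn C 2"
    "out ?A I ?l (turn x0 3) = P"
    by (simp_all add: out_def fw I)
  have E_x0: "glue E x0 = turn Q 3"
    using eqs(6) m_simps(1) glue_eq_iff[OF invE] by simp
  \<comment> \<open>In \<open>B\<close> the old edge of \<open>x0\<close> starts behind the curl, at
    \<open>turn C 3\<close>.\<close>
  define o1 where "o1 = (\<lambda>d. if d = x0 then turn C 3 else d)"
  have B_o1: "glue B (o1 d) = o1 (glue D d)" if d: "d \<in> darts D" for d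
    using d
  proof (cases rule: R1.glue_E_cases)
    case 3
    then have "glue D d \<noteq> x0" using glue_glue[OF invD] by (metis insertCI)
    then show ?thesis using 3 by (simp add: o1_def)
  qed (simp_all add: o1_def glue_glue[OF invD])
  have m_o1: "m (o1 d) = out ?A I ?l d" if d: "d \<in> darts D" "d \<noteq> turn x0 1" for d
  proof -
    consider "d = x0" | "d = turn x0 2" | "d = turn x0 3" | "fst d \<noteq> fst x0"
      using same_crossing_turn[of d x0] d by blast
    then show ?thesis
    proof cases
      case 4
      then have "d \<notin> ?A" by auto
      moreover have "fst d \<noteq> fst C" using d CD by (metis in_darts_iff)
      ultimately show ?thesis using m_fix[of d] 4 by (auto simp: o1_def out_def)
    qed (use out m_simps in \<open>simp_all add: o1_def\<close>)
  qed
  have S3_1: "glue E (out ?A I ?l (turn x0 1)) = out ?A I ?l (glue D (turn x0 1))"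
  proof -
    have x1: "turn x0 1 \<in> darts D" using x0 by simp
    have "glue B (turn x0 1) = o1 (glue D (turn x0 1))" using B_o1[OF x1] by (simp add: o1_def)
    then show ?thesis
      using m_o1[of "glue D (turn x0 1)"] glue_neq[OF invD x1] x0 invD eqs(7) out by simp
  qed
  have S3: "glue E (out ?A I ?l d) = out ?A I ?l (glue D d)" if d: "d \<in> darts D" for d
  proof -
    consider "d = turn x0 1" | "glue D d = turn x0 1" | "d \<noteq> turn x0 1" "glue D d \<noteq> turn x0 1" by blast
    then show ?thesis
    proof cases
      case 1
      then show ?thesis using S3_1 by simp
    next
      case 2
      then have "glue D (turn x0 1) = d" using glue_glue[OF invD] by metis
      then show ?thesis using S3_1 2 glue_glue[OF invE] by metis
    next
      case 3
      have D_C: "e \<noteq> turn C n" "e \<noteq> C" if "e \<in> darts D" for e n using that by simp_all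
      have "glue E (m (o1 d)) = m (glue B (o1 d))"
      proof (rule gen)
        show "o1 d \<in> darts B" using d by (simp add: o1_def R1.darts_E)
        have "o1 d \<noteq> glue B (turn x0 1)"
        proof
          assume "o1 d = glue B (turn x0 1)"
          then have "o1 (glue D d) = turn x0 1" using B_o1[OF d] glue_glue[OF R1.invE] by metis
          then show False using 3(2) neq by (auto simp: o1_def split: if_splits)
        qed
        then show "o1 d \<notin> {turn C 1, glue B (turn C 1), turn x0 1, glue B (turn x0 1), turn C 2, x0}"
          using D_C[OF d] 3(1) neq by (auto simp: o1_def)
      qed
      then show ?thesis using B_o1[OF d] m_o1[OF d 3(1)] m_o1[of "glue D d"] d invD 3(2) by simp
    qed
  qed
  have tr: "traced E ?A ?s I ?l"
    unfolding traced_def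
  proof (intro conjI ballI impI)
    have A_x0: "?A - {x0} = {turn x0 1, turn x0 2, turn x0 3}" by auto
    show "crossings E = crossings D \<union> (\<lambda>a. fst (I a)) ` (?A - {x0})"
      unfolding A_x0 using E(2) by (auto simp: I R1.crossings_E)
    show "fst (I a) \<notin> crossings D" if "a \<in> ?A - {x0}" for a
    proof -
      have "a = turn x0 1 \<or> a = turn x0 2 \<or> a = turn x0 3" using that unfolding A_x0 by simp
      then show ?thesis by (elim disjE) (use PQ_D CD in \<open>simp_all add: I\<close>)
    qed
    have even: "snd (turn d 2) \<in> {0, 2}" if "snd d \<in> {0, 2}" for d :: dart
      using that by (auto simp: turn_def)
    show "snd (I a) \<in> {0, 2}" if "a \<in> ?A - {x0}" for a
    proof -
      have "a = turn x0 1 \<or> a = turn x0 2 \<or> a = turn x0 3" using that unfolding A_x0 by simp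
      then show ?thesis
        by (elim disjE) (use even[OF PQ(4)] even[OF PQ(5)] CD(2) in \<open>simp_all add: I\<close>)
    qed
    show "inj_on (\<lambda>a. fst (I a)) (?A - {x0})"
      unfolding A_x0 using PQ_D PQ(3) by (auto simp: inj_on_def I)
    show "glue E a = I a" if "a \<in> ?A - {x0}" for a
    proof -
      have "a = turn x0 1 \<or> a = turn x0 2 \<or> a = turn x0 3" using that unfolding A_x0 by simp
      then show ?thesis by (elim disjE) (use eqs in \<open>simp_all add: I\<close>)
    qed
    show "glue E (fw I a) = turn (I (turn a 1)) 1" if "a \<in> ?A" "turn a 1 \<noteq> x0" for a
    proof -
      have "glue E (turn Q 1) = turn C 1" using eqs(2) glue_glue[OF invE] by metis
      moreover have "a = x0 \<or> a = turn x0 1 \<or> a = turn x0 2" using that by auto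
      ultimately show ?thesis using E_x0 eqs(4) by (elim disjE) (simp_all add: fw I)
    qed
  qed (use S3 in auto)
  have Q_eqs: "glue E (turn Q 3) = x0" "glue E (turn Q 2) = turn x0 1" "glue E (turn Q 1) = turn C 1"
    using E_x0 eqs(1,2) glue_glue[OF invE] by metis+
  \<comment> \<open>The two crossings bound a bigon: the contour runs from \<open>x0\<close>
    straight to \<open>Q\<close>, and the strand below \<open>Q\<close> comes from
    \<open>turn x0 1\<close>.\<close>
  have "\<psi> E (fst Q) = \<psi> E (fst (turn x0 3))"
  proof (rule parity_unpush(1)[OF E(1)])
    show "Q \<in> darts E" "turn x0 3 \<in> darts E" using E(2) x0_cr by (simp_all add: in_darts_iff R1.crossings_E)
    show "fst Q \<noteq> fst (turn x0 3)" using PQ_D by simp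
    show "snd Q \<in> {0, 2}" "snd (turn x0 3) \<in> {0, 2}" using PQ x0_over by (simp_all add: turn_def)
    show "glue E (turn Q 3) = turn (turn x0 3) 1" "glue E (turn Q 2) = turn (turn x0 3) 2" using Q_eqs by simp_all
    have out_fst: "fst (out ?A I ?l d) \<notin> {fst Q, fst x0}" if d: "d \<in> darts D" "d \<noteq> turn x0 1" for d
    proof -
      consider "d = x0" | "d = turn x0 2" | "d = turn x0 3" | "fst d \<noteq> fst x0"
        using same_crossing_turn[of d x0] d by blast
      then show ?thesis
      proof cases
        case 4
        then have "d \<notin> ?A" by auto
        then have "out ?A I ?l d = d" by (auto simp: out_def)
        moreover have "fst d \<noteq> fst Q" using d PQ_D by (metis in_darts_iff)
        ultimately show ?thesis using 4 by simp
      qed (use out PQ_D PQ(3) CW in auto)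
    qed
    have x1: "turn x0 1 \<in> darts D" using x0 by simp
    have "fst (glue E Q) \<notin> {fst Q, fst x0}"
      using S3_1 out out_fst[of "glue D (turn x0 1)"] glue_neq[OF invD x1] x0 invD by simp
    moreover have "glue E (turn (turn x0 3) 3) = C" "glue E (turn x0 3) = turn P 2" using eqs by simp_all
    ultimately show "fst (glue E d) \<notin> {fst Q, fst (turn x0 3)}"
      if "d \<in> {Q, turn Q 1, turn x0 3, turn (turn x0 3) 3}" for d
      using that Q_eqs PQ_D PQ(3) CW by auto
    show "turn (turn x0 3) 3 \<notin> orbit (face_step E) Q"
    proof
      \<comment> \<open>The face of \<open>turn x0 2\<close> is a small triangle whose other corners
        are at \<open>C\<close> and \<open>P\<close>, so it has no corner at
        \<open>Q\<close>.\<close>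
      let ?S = "{turn x0 2, turn C 3, turn P 2}"
      assume "turn (turn x0 3) 3 \<in> orbit (face_step E) Q"
      then have "turn x0 2 \<in> orbit (face_step E) Q" by simp
      moreover have fin: "finite (darts E)" "inj_on (face_step E) (darts E)" "face_step E ` darts E \<subseteq> darts E"
        using involutive_finite(2)[OF invE] inj_face_step[OF invE] face_step_image[OF invE] by auto
      have "Q \<in> darts E" "turn x0 2 \<in> darts E" using E(2) x0_cr by (simp_all add: in_darts_iff R1.crossings_E)
      ultimately have "orbit (face_step E) Q = orbit (face_step E) (turn x0 2)" "Q \<in> orbit (face_step E) Q"
        using orbit_eq_iff[OF fin] finite_inj_self_in_orbit[OF fin] by blast+
      then have "Q \<in> orbit (face_step E) (turn x0 2)" by simp
      moreover have "orbit (face_step E) (turn x0 2) \<subseteq> ?S"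
      proof (rule orbit_closed_subset)
        have "glue E (turn P 2) = turn x0 3" using eqs(5) glue_glue[OF invE] by metis
        then show "face_step E ` ?S \<subseteq> ?S" using eqs by (simp add: face_step_turn)
      qed simp
      ultimately have "fst Q \<in> {fst x0, fst C, fst P}" by auto
      then show False using PQ_D PQ(3) by auto
    qed
  qed
  moreover have "\<psi> E v = \<psi> D v" if "v \<in> crossings D" for v
    using psi(2)[of v] par1(2)[OF that] that by (simp add: R1.crossings_E)
  ultimately show thesis
    using that[OF E(1) tr] psi(1) x0_cr by (simp add: I)
qed

end

section \<open>Weak parities are constant on every diagram\<close>

context contour
begin

text \<open>
  \<open>H d\<close> is the parity of the crossing that the contour makes, at some moment, with the dart \<open>d\<close>.
\<close>

definition heights :: "diagram \<Rightarrow> nat set \<Rightarrow> dart set \<Rightarrow> (dart \<Rightarrow> dart) \<Rightarrow> (dart \<Rightarrow> dart) \<Rightarrow> (dart \<Rightarrow> int) \<Rightarrow> bool" where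
  "heights E T A \<sigma> I H \<longleftrightarrow>
     (\<forall>v\<in>crossings D. \<psi> E v = \<psi> D v) \<and>
     (\<forall>a\<in>A. a \<noteq> x0 \<longrightarrow> \<psi> E (fst (I a)) = H a) \<and>
     (\<forall>d\<in>darts D. fst d \<in> T \<longrightarrow> fst d \<noteq> fst x0 \<longrightarrow>
        H (turn d 2) = H d \<and> H d + H (turn d 1) + \<psi> D (fst d) \<noteq> 1) \<and>
     (\<forall>d\<in>darts D. fst d \<in> T \<longrightarrow> d \<notin> A \<longrightarrow> H (glue D d) = H d) \<and>
     H (turn x0 1) = \<psi> D (fst x0) \<and> H (turn x0 3) = \<psi> D (fst x0)"

lemma heightsD:
  assumes "heights E T A \<sigma> I H"
  shows "\<And>v. v \<in> crossings D \<Longrightarrow> \<psi> E v = \<psi> D v"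
    and "\<And>a. a \<in> A \<Longrightarrow> a \<noteq> x0 \<Longrightarrow> \<psi> E (fst (I a)) = H a"
    and "\<And>d. d \<in> darts D \<Longrightarrow> fst d \<in> T \<Longrightarrow> fst d \<noteq> fst x0 \<Longrightarrow> H (turn d 2) = H d"
    and "\<And>d. d \<in> darts D \<Longrightarrow> fst d \<in> T \<Longrightarrow> fst d \<noteq> fst x0 \<Longrightarrow> H d + H (turn d 1) + \<psi> D (fst d) \<noteq> 1"
    and "\<And>d. d \<in> darts D \<Longrightarrow> fst d \<in> T \<Longrightarrow> d \<notin> A \<Longrightarrow> H (glue D d) = H d"
    and "H (turn x0 1) = \<psi> D (fst x0)" "H (turn x0 3) = \<psi> D (fst x0)"
  using assms unfolding heights_def by simp_all

lemma connD: "connected_diagram D"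
  using K_classical[OF D_K] by (simp add: classical_diagram_iff)

text \<open>The darts at \<open>T\<close> are even in number, and those whose edge stays in
  \<open>T\<close> come in pairs, so an even number of edges leaves \<open>T\<close>. By
  connectivity it is not 0, hence the base dart cannot be the only one.\<close>

lemma leaving_edge:
  assumes t: "tour T A \<sigma>" and "T \<noteq> crossings D"
  obtains d0 where "d0 \<in> A" "d0 \<noteq> x0" "fst (glue D d0) \<notin> T"
proof -
  note tD = tourD[OF t]
  define S where "S = {d \<in> darts D. fst d \<in> T}"
  define L where "L = {d \<in> S. fst (glue D d) \<notin> T}"
  have LA: "L \<subseteq> A" using tD(8) by (auto simp: L_def S_def)
  have finS: "finite S" using involutive_finite(2)[OF invD] by (simp add: S_def)
  have "L \<noteq> {}"
  proof
    assume "L = {}"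
    have "S = darts D"
    proof (rule connected_diagramD[OF connD])
      show "S \<subseteq> darts D" by (auto simp: S_def)
      show "x0 \<in> S" using x0 tD(3,4) by (auto simp: S_def)
      show "glue D d \<in> S" if d: "d \<in> S" for d
      proof -
        have "d \<notin> L" using \<open>L = {}\<close> by blast
        then show ?thesis using d invD by (simp add: L_def S_def)
      qed
      show "turn d 2 \<in> S" if "d \<in> S" for d using that by (simp add: S_def)
    qed
    then have "(v, 0) \<in> S" if "v \<in> crossings D" for v
      using that by (simp add: in_darts_iff)
    then have "v \<in> T" if "v \<in> crossings D" for v
      using that by (force simp: S_def)
    then show False using tD(1) assms(2) by blast
  qed
  have "even (card S)"
  proof (rule even_card_involution[OF finS])
    show "turn s 2 \<in> S \<and> turn (turn s 2) 2 = s \<and> turn s 2 \<noteq> s" if "s \<in> S" for s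
      using that by (simp add: S_def)
  qed
  moreover have "even (card (S - L))"
  proof (rule even_card_involution[where f = "glue D"])
    show "glue D s \<in> S - L \<and> glue D (glue D s) = s \<and> glue D s \<noteq> s" if "s \<in> S - L" for s
      using that invD glue_neq[OF invD] glue_glue[OF invD] by (simp add: S_def L_def)
  qed (use finS in simp)
  moreover have "card S = card (S - L) + card L"
  proof -
    have "L \<subseteq> S" by (auto simp: L_def)
    then show ?thesis using finS by (metis card_Diff_subset card_mono finite_subset le_add_diff_inverse2)
  qed
  ultimately have "even (card L)" by presburger
  then have "L \<noteq> {x0}" by auto
  then obtain d0 where "d0 \<in> L" "d0 \<noteq> x0" using \<open>L \<noteq> {}\<close> by blast
  then show thesis using that[of d0] LA by (auto simp: L_def)
qed

text \<open>Induction on the number of crossings outside the tree. The equation for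
  \<open>card A\<close> holds with four darts around one crossing, and each further crossing adds
  two.\<close>

lemma heights_grow:
  assumes t: "tour T A \<sigma>" and tr: "traced E A \<sigma> I l" and E: "E \<in> K" and h: "heights E T A \<sigma> I H"
    and card: "card A = 2 * card T + 2"
    and cover: "\<And>e. e \<in> darts D \<Longrightarrow> fst e \<in> T \<Longrightarrow> \<exists>a\<in>A. (e, a) \<in> (walk_step T A)\<^sup>*"
  obtains E' A' \<sigma>' I' l' H' where "tour (crossings D) A' \<sigma>'" "traced E' A' \<sigma>' I' l'" "E' \<in> K"
    "heights E' (crossings D) A' \<sigma>' I' H'" "card A' = 2 * card (crossings D) + 2"
    "\<And>e. e \<in> darts D \<Longrightarrow> \<exists>a\<in>A'. (e, a) \<in> (walk_step (crossings D) A')\<^sup>*"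
proof -
  have "\<exists>E' A' \<sigma>' I' l' H'. tour (crossings D) A' \<sigma>' \<and> traced E' A' \<sigma>' I' l' \<and> E' \<in> K \<and>
    heights E' (crossings D) A' \<sigma>' I' H' \<and> card A' = 2 * card (crossings D) + 2 \<and>
    (\<forall>e\<in>darts D. \<exists>a\<in>A'. (e, a) \<in> (walk_step (crossings D) A')\<^sup>*)"
    using assms
  proof (induction "card (crossings D - T)" arbitrary: T A \<sigma> E I l H rule: less_induct)
    case less
    note t = less.prems(1) and tr = less.prems(2) and hD = heightsD[OF less.prems(4)]
    note tD = tourD[OF t] and trD = tracedD[OF tr]
    show ?case
    proof (cases "T = crossings D")
      case True
      then show ?thesis using less.prems by (metis in_darts_iff)
    next
      case False
      then obtain d0 where d0: "d0 \<in> A" "d0 \<noteq> x0" "fst (glue D d0) \<notin> T" using leaving_edge[OF t] by blast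
      define W where "W = glue D d0"
      have W: "W = glue D d0" "fst W \<notin> T" using d0 by (simp_all add: W_def)
      obtain a0 where a0: "a0 \<in> A" "\<sigma> a0 = d0" using tD(11) d0(1) by (metis imageE)
      define A' where "A' = A - {d0} \<union> {turn W 1, turn W 2, turn W 3}"
      define \<sigma>' where "\<sigma>' = \<sigma>(a0 := turn W 1, turn W 1 := turn W 2, turn W 2 := turn W 3, turn W 3 := \<sigma> d0)"
      let ?T = "insert (fst W) T"
      note grow = tour_grow[OF t d0(1,2) a0 W, folded A'_def \<sigma>'_def]
      obtain E' I' where E': "E' \<in> K" "traced E' A' \<sigma>' I' (if l = d0 then turn W 3 else l)"
        and psi: "\<And>v. v \<in> crossings E \<Longrightarrow> \<psi> E' v = \<psi> E v"
        and I': "\<And>a. a \<in> A \<Longrightarrow> I' a = I a" "I' (turn W 2) = I d0"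
        and r: "\<psi> E' (fst (I' (turn W 1))) = \<psi> E' (fst (I' (turn W 3)))"
          "\<psi> E (fst (I d0)) + \<psi> E' (fst (I' (turn W 1))) + \<psi> E (fst W) \<noteq> 1"
        using traced_grow[OF t tr less.prems(3) d0(1,2) a0 W] unfolding A'_def \<sigma>'_def by metis
      define r where "r = \<psi> E' (fst (I' (turn W 1)))"
      \<comment> \<open>The sliding contour meets the edge of \<open>d0\<close> and later the dart
        \<open>turn W 2\<close> at the same crossing, so \<open>d0\<close>, \<open>W\<close> and
        \<open>turn W 2\<close> share one value. The other strand at \<open>W\<close> gets
        \<open>r\<close> on both sides.\<close>
      define H' where "H' = (\<lambda>d. if d = turn W 1 \<or> d = turn W 3 then r else if d = W \<or> d = turn W 2 then H d0 else H d)"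
      have WD: "W \<in> darts D" using W(1) d0 tD(2) invD by auto
      have gW: "glue D W = d0" using W(1) glue_glue[OF invD] by simp
      have x0T: "fst x0 \<in> T" "fst d0 \<in> T" using tD(3,4) d0(1) by auto
      have H'_old: "H' d = H d" if "fst d \<in> T" for d
        using that W(2) by (auto simp: H'_def)
      have H'_new: "H' W = H d0" "H' (turn W 1) = r" "H' (turn W 2) = H d0" "H' (turn W 3) = r"
        by (simp_all add: H'_def)
      have H_d0: "\<psi> E (fst (I d0)) = H d0" using hD(2) d0 by blast
      have W_cr: "fst W \<in> crossings D" using WD by (simp add: in_darts_iff)
      have tri: "H d0 + r + \<psi> D (fst W) \<noteq> 1"
        using r(2) H_d0 hD(1)[OF W_cr] by (simp add: r_def)
      have W_cases: "d = W \<or> d = turn W 1 \<or> d = turn W 2 \<or> d = turn W 3" if "fst d \<in> ?T" "fst d \<notin> T" for d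
        using that same_crossing_turn[of d W] by auto
      have "heights E' ?T A' \<sigma>' I' H'"
        unfolding heights_def
      proof (intro conjI ballI impI)
        show "\<psi> E' v = \<psi> D v" if "v \<in> crossings D" for v
          using psi[of v] hD(1)[OF that] trD(1) that by auto
        show "\<psi> E' (fst (I' a)) = H' a" if a: "a \<in> A'" "a \<noteq> x0" for a
        proof (cases "a \<in> A")
          case True
          have "fst (I a) \<in> crossings E" using trD(10)[OF True a(2)] by (simp add: in_darts_iff)
          moreover have "fst a \<in> T" using True tD(3) by blast
          ultimately show ?thesis using I'(1)[OF True] psi hD(2)[OF True a(2)] H'_old by simp
        next
          case False
          have "fst (I d0) \<in> crossings E" using trD(10)[OF d0(1,2)] by (simp add: in_darts_iff)
          then have "\<psi> E' (fst (I' (turn W 2))) = H d0" using psi I'(2) H_d0 by simp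
          moreover have "a = turn W 1 \<or> a = turn W 2 \<or> a = turn W 3" using a(1) False by (auto simp: A'_def)
          ultimately show ?thesis using H'_new r(1) by (elim disjE) (simp_all add: r_def)
        qed
        fix d assume d: "d \<in> darts D" "fst d \<in> ?T"
        show "H' (turn d 2) = H' d" if "fst d \<noteq> fst x0"
        proof (cases "fst d \<in> T")
          case True
          then show ?thesis using hD(3)[OF d(1) True that] H'_old by simp
        next
          case False
          from W_cases[OF d(2) False] show ?thesis by (elim disjE) (simp_all add: H'_new)
        qed
        show "H' d + H' (turn d 1) + \<psi> D (fst d) \<noteq> 1" if "fst d \<noteq> fst x0"
        proof (cases "fst d \<in> T")
          case True
          then show ?thesis using hD(4)[OF d(1) True that] H'_old by simp
        next
          case False
          from W_cases[OF d(2) False] show ?thesis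
            using tri by (elim disjE) (simp_all add: H'_new add.commute)
        qed
        show "H' (glue D d) = H' d" if dA: "d \<notin> A'"
        proof -
          consider "d = d0" | "d = W" | "d \<notin> A" "fst d \<in> T"
            using W_cases[OF d(2)] dA unfolding A'_def by blast
          then show ?thesis
          proof cases
            case 1 then show ?thesis using W(1) H'_new H'_old x0T by simp
          next
            case 2 then show ?thesis using gW H'_new H'_old x0T by simp
          next
            case 3
            then show ?thesis using hD(5)[OF d(1)] tD(8)[OF d(1)] H'_old by simp
          qed
        qed
      next
        show "H' (turn x0 1) = \<psi> D (fst x0)" "H' (turn x0 3) = \<psi> D (fst x0)"
          using hD(6,7) H'_old x0T by simp_all
      qed
      moreover have "card (crossings D - ?T) < card (crossings D - T)"
        using W_cr W(2) involutive_finite(1)[OF invD] by (intro psubset_card_mono) auto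
      moreover have "card A' = 2 * card ?T + 2"
      proof -
        have "finite T" using tD(1) involutive_finite(1)[OF invD] finite_subset by blast
        then show ?thesis using grow(2) less.prems(5) W(2) by simp
      qed
      ultimately show ?thesis
        using less.hyps[OF _ grow(1) E'(2,1)] grow(3) less.prems(6) by blast
    qed
  qed
  then show thesis using that by blast
qed

text \<open>No value of \<open>H\<close> changes. Each pruned pair turns its equal parities into
  \<open>H (glue D a) = H a\<close>, until the base edge is the only one without this
  equation.\<close>

lemma heights_prune:
  assumes t: "tour (crossings D) A \<sigma>" and tr: "traced E A \<sigma> I l" and E: "E \<in> K"
    and h: "heights E (crossings D) A \<sigma> I H"
    and card: "card A + 2 \<le> 2 * card (orbit (first_return A \<sigma>) ` A)"
  obtains E' \<sigma>' where "heights E' (crossings D) {x0, glue D x0} \<sigma>' I H"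
proof -
  have "\<exists>E' \<sigma>'. heights E' (crossings D) {x0, glue D x0} \<sigma>' I H"
    using assms
  proof (induction "card A" arbitrary: A \<sigma> E l rule: less_induct)
    case less
    note t = less.prems(1) and tr = less.prems(2) and hD = heightsD[OF less.prems(4)]
    note tD = tourD[OF t]
    show ?case
    proof (cases "A = {x0, glue D x0}")
      case True
      then show ?thesis using less.prems(4) by blast
    next
      case False
      obtain a where a: "a \<in> A" "a \<noteq> x0" "glue D a \<noteq> x0" "\<sigma> a = glue D a"
        using adjacent_pair[OF t less.prems(5) False] .
      define b where "b = glue D a"
      have ab: "a \<in> A" "a \<noteq> x0" "b \<noteq> x0" "b = glue D a" "\<sigma> a = b" using a by (simp_all add: b_def)
      obtain z where z: "z \<in> A" "\<sigma> z = a" using tD(11) a(1) by (metis imageE)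
      note prune = tour_prune[OF t ab z]
      obtain E' where E': "E' \<in> K" "traced E' (A - {a, b}) (\<sigma>(z := \<sigma> b)) I (if l = b then z else l)"
        and psi: "\<And>v. v \<in> crossings E' \<Longrightarrow> \<psi> E' v = \<psi> E v" "\<psi> E (fst (I a)) = \<psi> E (fst (I b))"
        using traced_prune[OF t tr less.prems(3) ab z] by metis
      note tr' = tracedD[OF E'(2)]
      have Hab: "H b = H a" using psi(2) hD(2)[OF ab(1,2)] hD(2)[OF prune(2) ab(3)] by simp
      have gb: "glue D b = a" using ab glue_glue[OF invD] by simp
      have "heights E' (crossings D) (A - {a, b}) (\<sigma>(z := \<sigma> b)) I H"
        unfolding heights_def
      proof (intro conjI ballI impI)
        show "\<psi> E' v = \<psi> D v" if "v \<in> crossings D" for v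
          using psi(1)[of v] tr'(1) hD(1)[OF that] that by auto
        show "\<psi> E' (fst (I c)) = H c" if "c \<in> A - {a, b}" "c \<noteq> x0" for c
          using psi(1)[of "fst (I c)"] tr'(10)[OF that] hD(2)[of c] that by (simp add: in_darts_iff)
        show "H (glue D d) = H d" if d: "d \<in> darts D" "fst d \<in> crossings D" "d \<notin> A - {a, b}" for d
        proof -
          consider "d = a" | "d = b" | "d \<notin> A" using d(3) by blast
          then show ?thesis
            by cases (use Hab gb ab(4) hD(5)[OF d(1,2)] in simp_all)
        qed
      qed (use hD in simp_all)
      moreover have "card (A - {a, b}) < card A" using prune(5) by simp
      moreover have "card (A - {a, b}) + 2 \<le> 2 * card (orbit (first_return (A - {a, b}) (\<sigma>(z := \<sigma> b))) ` (A - {a, b}))"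
        using card_first_return_prune[OF t ab z] less.prems(5) prune(5) by linarith
      ultimately show ?thesis using less.hyps[OF _ prune(1) E'(2,1)] by blast
    qed
  qed
  then show thesis using that by blast
qed

text \<open>
  The knot passes \<open>fst x0\<close> twice. Along both of the two parts into which this divides the knot \<open>H\<close>
  is constant, and each part has one of the ends \<open>turn x0 1\<close> and \<open>turn x0 3\<close>.
\<close>

lemma heights_constant:
  assumes h: "heights E (crossings D) {x0, glue D x0} \<sigma> I H" and d: "d \<in> darts D" "d \<noteq> x0"
  shows "H d = \<psi> D (fst x0)"
proof (rule ccontr)
  assume ne: "H d \<noteq> \<psi> D (fst x0)"
  note hD = heightsD[OF h]
  define S where "S = {d \<in> darts D. d \<noteq> x0 \<and> H d \<noteq> \<psi> D (fst x0)}"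
  have dS: "d \<in> S" using d ne by (simp add: S_def)
  have finS: "finite S" using involutive_finite(2)[OF invD] by (simp add: S_def)
  have not_S: "turn x0 1 \<notin> S" "turn x0 3 \<notin> S" "x0 \<notin> S" using hD(6,7) by (simp_all add: S_def)
  have x1: "turn x0 1 \<in> darts D" "turn x0 1 \<noteq> x0" using x0 by simp_all
  let ?o = "turn x0 2" and ?g = "glue D x0"
  have SD: "e \<in> darts D" "fst e \<in> crossings D" if "e \<in> S" for e using that by (auto simp: S_def in_darts_iff)
  \<comment> \<open>The dart \<open>?o\<close> is the one exception, because its opposite
    \<open>x0\<close> is left out of \<open>S\<close>; for the same reason \<open>?g\<close> is the
    one exception for \<open>glue\<close>.\<close>
  have opp: "turn e 2 \<in> S" if e: "e \<in> S" "e \<noteq> ?o" for e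
  proof -
    have "fst e \<noteq> fst x0"
      using same_crossing_turn[of e x0] e not_S by metis
    then have "H (turn e 2) = H e" "turn e 2 \<noteq> x0" using hD(3)[OF SD[OF e(1)]] by auto
    then show ?thesis using e(1) by (simp add: S_def)
  qed
  have glue: "glue D e \<in> S" if e: "e \<in> S" "e \<noteq> ?g" for e
  proof -
    have "e \<noteq> x0" using e not_S by blast
    then have "H (glue D e) = H e" using hD(5)[OF SD[OF e(1)]] e(2) by simp
    moreover have "glue D e \<noteq> x0" using e(2) glue_glue[OF invD] by metis
    ultimately show ?thesis using e(1) invD by (simp add: S_def)
  qed
  have glue_inv: "glue D (glue D e) = e" "glue D e \<noteq> e" if "e \<in> S" for e
    using glue_glue[OF invD] glue_neq[OF invD SD(1)[OF that]] by simp_all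
  consider "?o \<in> S" "?g \<in> S" | "?o \<notin> S" "?g \<notin> S" | "?o \<in> S" "?g \<notin> S" | "?o \<notin> S" "?g \<in> S" by blast
  then show False
  proof cases
    case 1
    \<comment> \<open>Adding \<open>x0\<close> repairs both exceptions at once, and the single
      component forces all darts into the set, among them \<open>turn x0 1\<close>.\<close>
    have "insert x0 S = darts D"
    proof (rule connected_diagramD[OF connD])
      show "insert x0 S \<subseteq> darts D" using x0 SD by blast
      show "d \<in> insert x0 S" using dS by blast
      show "glue D e \<in> insert x0 S" if "e \<in> insert x0 S" for e
        using that 1 glue[of e] glue_glue[OF invD, of x0] by auto
      show "turn e 2 \<in> insert x0 S" if "e \<in> insert x0 S" for e
        using that 1 opp[of e] by (cases "e = ?o") auto
    qed
    then show False using x1 not_S by blast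
  next
    case 2
    have "S = darts D"
    proof (rule connected_diagramD[OF connD _ dS])
      show "S \<subseteq> darts D" using SD by blast
      show "glue D e \<in> S" "turn e 2 \<in> S" if "e \<in> S" for e
        using that glue[of e] opp[of e] 2 by metis+
    qed
    then show False using x1 not_S by blast
  next
    case 3
    \<comment> \<open>One pairing matches all of \<open>S\<close>, the other all except a single
      dart, which contradicts parity.\<close>
    have "even (card S)"
      by (rule even_card_involution[OF finS, of "glue D"]) (use 3 glue glue_inv in metis)
    moreover have "even (card (S - {?o}))"
    proof (rule even_card_involution[where f = "\<lambda>e. turn e 2"])
      show "turn e 2 \<in> S - {?o} \<and> turn (turn e 2) 2 = e \<and> turn e 2 \<noteq> e" if e: "e \<in> S - {?o}" for e
      proof -
        have "turn e 2 \<in> S" "e \<noteq> x0" using e opp[of e] not_S by auto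
        then show ?thesis by (simp add: turn_inject)
      qed
    qed (use finS in simp)
    moreover have "card S = card (S - {?o}) + 1" using card_Suc_Diff1[OF finS 3(1)] by simp
    ultimately show False by presburger
  next
    case 4
    have "even (card S)"
    proof (rule even_card_involution[OF finS])
      show "turn e 2 \<in> S \<and> turn (turn e 2) 2 = e \<and> turn e 2 \<noteq> e" if "e \<in> S" for e
        using that 4(1) opp[of e] by auto
    qed
    moreover have "even (card (S - {?g}))"
    proof (rule even_card_involution[where f = "glue D"])
      show "glue D e \<in> S - {?g} \<and> glue D (glue D e) = e \<and> glue D e \<noteq> e" if e: "e \<in> S - {?g}" for e
      proof -
        have "glue D e \<in> S" "e \<noteq> x0" using e glue[of e] not_S by auto
        then show ?thesis using e glue_inv[of e] glue_inv[of "glue D e"] glue_glue[OF invD, of x0] by auto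
      qed
    qed (use finS in simp)
    moreover have "card S = card (S - {?g}) + 1" using card_Suc_Diff1[OF finS 4(2)] by simp
    ultimately show False by presburger
  qed
qed

lemma parity_zero_spreads:
  assumes "snd x0 = 1" "\<psi> D (fst x0) = 0" "w \<in> crossings D"
  shows "\<psi> D w = 0"
proof (cases "w = fst x0")
  case False
  let ?A0 = "{x0, turn x0 1, turn x0 2, turn x0 3}"
  obtain E I where E: "E \<in> K" "traced E ?A0 (\<lambda>a. turn a 1) I (turn x0 3)"
    and psi: "\<And>v. v \<in> crossings D \<Longrightarrow> \<psi> E v = \<psi> D v"
      "\<psi> E (fst (I (turn x0 1))) = \<psi> D (fst x0)" "\<psi> E (fst (I (turn x0 3))) = \<psi> D (fst x0)"
    using traced_start[OF assms(1)] by metis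
  define H where "H = (\<lambda>a. \<psi> E (fst (I a)))"
  have "heights E {fst x0} ?A0 (\<lambda>a. turn a 1) I H"
    unfolding heights_def
  proof (intro conjI ballI impI)
    show "H (glue D d) = H d" if "d \<in> darts D" "fst d \<in> {fst x0}" "d \<notin> ?A0" for d
      using that same_crossing_turn[of d x0] by auto
  qed (use psi in \<open>auto simp: H_def\<close>)
  moreover have "card ?A0 = 2 * card {fst x0} + 2" by simp
  moreover have "\<exists>a\<in>?A0. (e, a) \<in> (walk_step {fst x0} ?A0)\<^sup>*" if "e \<in> darts D" "fst e \<in> {fst x0}" for e
    using that same_crossing_turn[of e x0] by auto
  ultimately obtain E' A' \<sigma>' I' l' H' where 1: "tour (crossings D) A' \<sigma>'" "traced E' A' \<sigma>' I' l'" "E' \<in> K"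
    "heights E' (crossings D) A' \<sigma>' I' H'" "card A' = 2 * card (crossings D) + 2"
    "\<And>e. e \<in> darts D \<Longrightarrow> \<exists>a\<in>A'. (e, a) \<in> (walk_step (crossings D) A')\<^sup>*"
    using heights_grow[OF tour_start E(2,1)] by metis
  have "crossings D \<noteq> {}" using assms(3) by blast
  then have "card (orbit (face_step D) ` darts D) = card (crossings D) + 2"
    using K_classical[OF D_K] by (simp add: classical_diagram_iff)
  \<comment> \<open>Here 2 V + 4 = 2 F, which is just what \<open>two_fixed_points\<close> asks
    for.\<close>
  then have "card A' + 2 \<le> 2 * card (orbit (first_return A' \<sigma>') ` A')"
    using card_first_return_orbits[OF 1(1,6)] 1(5) by simp
  then obtain E'' \<sigma>'' where h: "heights E'' (crossings D) {x0, glue D x0} \<sigma>'' I' H'"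
    using heights_prune[OF 1(1,2,3,4)] by blast
  \<comment> \<open>Two neighbouring darts at \<open>w\<close> are used, one on each of its
    strands.\<close>
  define d :: dart where "d = (w, 0)"
  have d: "d \<in> darts D" "fst d = w" using assms(3) by (simp_all add: d_def in_darts_iff)
  have "d \<noteq> x0" "turn d 1 \<noteq> x0" using False d(2) by auto
  then have "H' d = 0" "H' (turn d 1) = 0"
    using heights_constant[OF h] d assms(2) by simp_all
  then have "\<psi> D w \<noteq> 1"
    using heightsD(4)[OF h d(1)] d(2) assms(3) False by simp
  then show ?thesis using parity_values[OF D_K assms(3)] by blast
qed (use assms in simp)

end

context knot_weak_parity
begin

text \<open>Parity 0 at one crossing spreads to all others; if it occurs nowhere, all values are
  1.\<close>

lemma parity_constant:
  assumes "D \<in> K" "v \<in> crossings D" "w \<in> crossings D"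
  shows "\<psi> D v = \<psi> D w"
proof -
  have spread: "\<psi> D b = 0" if "\<psi> D a = 0" "a \<in> crossings D" "b \<in> crossings D" for a b
  proof -
    \<comment> \<open>\<open>traced_start\<close> needs an over-dart at the crossing of parity 0,
      hence the label 1.\<close>
    interpret contour K \<psi> D "(a, 1)"
      by unfold_locales (use assms K_involutive that in \<open>simp_all add: in_darts_iff\<close>)
    show ?thesis using parity_zero_spreads that by simp
  qed
  then show ?thesis using parity_values[OF assms(1)] assms(2,3) by metis
qed

end

section \<open>Passing through the diagram without crossings\<close>

text \<open>The figure eight, with one loop on \<open>U\<close>, \<open>turn U 1\<close> and the
  other on \<open>turn U 2\<close>, \<open>turn U 3\<close>. The dart \<open>U\<close> also chooses
  the name of the crossing and, by having an even or odd label, the over/under information.\<close>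

definition eight :: "dart \<Rightarrow> diagram" where
  "eight U = \<lparr>crossings = {fst U},
     glue = id(U := turn U 1, turn U 1 := U, turn U 2 := turn U 3, turn U 3 := turn U 2)\<rparr>"

lemma eight_simps [simp]: "crossings (eight U) = {fst U}" "glue (eight U) U = turn U 1"
  "glue (eight U) (turn U 1) = U" "glue (eight U) (turn U 2) = turn U 3" "glue (eight U) (turn U 3) = turn U 2"
  by (simp_all add: eight_def)

lemma darts_eight: "darts (eight U) = {U, turn U 1, turn U 2, turn U 3}"
proof -
  have "d \<in> darts (eight U) \<longleftrightarrow> d \<in> {U, turn U 1, turn U 2, turn U 3}" for d
    using same_crossing_turn[of d U] by (auto simp: in_darts_iff)
  then show ?thesis by blast
qed

lemma eight_outside: "fst d \<noteq> fst U \<Longrightarrow> glue (eight U) d = d"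
  by (auto simp: eight_def)

lemma involutive_eight: "involutive (eight U)"
proof (rule involutiveI)
  show "glue (eight U) d = d" if "d \<notin> darts (eight U)" for d
    using that eight_outside by (simp add: in_darts_iff)
qed (auto simp: darts_eight)

lemma classical_eight: "classical_diagram (eight U)"
proof -
  let ?f = "face_step (eight U)"
  have "connected_diagram (eight U)"
    unfolding connected_diagram_def
  proof (intro allI impI)
    fix S assume S: "S \<subseteq> darts (eight U)" "S \<noteq> {}" "glue (eight U) ` S \<subseteq> S" "\<forall>d\<in>S. turn d 2 \<in> S"
    have g: "glue (eight U) d \<in> S" and t: "turn d 2 \<in> S" if "d \<in> S" for d using S(3,4) that by auto
    obtain d where d: "d \<in> S" "d \<in> {U, turn U 1, turn U 2, turn U 3}" using S(1,2) darts_eight by blast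
    then have "U \<in> S"
      using g[of "turn U 1"] t[of "turn U 2"] g[of "turn U 3"] by auto
    then have "turn U 1 \<in> S" "turn U 2 \<in> S" using g[of U] t[of U] by auto
    then have "turn U 3 \<in> S" using g[of "turn U 2"] by auto
    then show "S = darts (eight U)"
      using S(1) \<open>U \<in> S\<close> \<open>turn U 1 \<in> S\<close> \<open>turn U 2 \<in> S\<close> darts_eight by auto
  qed
  moreover have "card (orbit ?f ` darts (eight U)) = 3"
  proof -
    have f: "?f U = U" "?f (turn U 1) = turn U 3" "?f (turn U 2) = turn U 2" "?f (turn U 3) = turn U 1"
      by (simp_all add: face_step_turn)
    have 1: "orbit ?f U = {U}" "orbit ?f (turn U 2) = {turn U 2}"
      using f orbit_eq_singleton_iff by metis+
    have "turn U 3 \<in> orbit ?f (turn U 1)" "turn U 1 \<in> orbit ?f (turn U 3)"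
      using f orbit.base[of ?f] by metis+
    then have 2: "orbit ?f (turn U 1) = orbit ?f (turn U 3)" "turn U 1 \<in> orbit ?f (turn U 3)"
      by (meson orbit_trans subset_antisym subsetI)+
    have "orbit ?f ` darts (eight U) = {{U}, {turn U 2}, orbit ?f (turn U 3)}"
      unfolding darts_eight using 1 2 by auto
    moreover have "{U} \<noteq> {turn U 2}" "{U} \<noteq> orbit ?f (turn U 3)" "{turn U 2} \<noteq> orbit ?f (turn U 3)"
    proof -
      have "turn U 1 \<notin> {U}" "turn U 1 \<notin> {turn U 2}" by simp_all
      then show "{U} \<noteq> orbit ?f (turn U 3)" "{turn U 2} \<noteq> orbit ?f (turn U 3)" using 2(2) by metis+
    qed simp
    ultimately show ?thesis by simp
  qed
  ultimately show ?thesis using involutive_eight by (simp add: classical_diagram_iff)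
qed

section \<open>Diagrams one move away from the diagram without crossings\<close>

lemma diagram_eqI:
  assumes "involutive D" "involutive D'" "crossings D = crossings D'"
    and "\<And>d. d \<in> darts D \<Longrightarrow> glue D d = glue D' d"
  shows "D = (D' :: diagram)"
proof -
  have "darts D = darts D'" using assms(3) by (simp add: darts_def)
  then have "glue D = glue D'"
    using assms(4) glue_outside[OF assms(1)] glue_outside[OF assms(2)] by (metis ext)
  then show ?thesis using assms(3) by simp
qed

text \<open>The loop uses two darts of the only crossing, and the other two can only be joined to
  each other.\<close>

lemma R1_to_unknot:
  assumes D: "classical_diagram D" and "R1_decreasing D v Z" "crossings Z = {}"
  obtains U where "D = eight U"
proof -
  have invD: "involutive D" using D by (simp add: classical_diagram_iff)
  obtain i where v: "v \<in> crossings D" "face_step D (v, i) = (v, i)" and "erased {v} D Z"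
    using assms(2) by (auto simp: R1_decreasing_def)
  then have cr: "crossings D = {v}" using assms(3) by (auto simp: erased_def)
  define U :: dart where "U = (v, i)"
  have UD: "U \<in> darts D" "fst U = v" using v by (simp_all add: U_def in_darts_iff)
  have gU: "glue D U = turn U 1" using v(2) by (simp add: face_step_turn turn_3_eq_iff U_def)
  have gU1: "glue D (turn U 1) = U" using gU glue_glue[OF invD] by metis
  have "turn U 2 \<in> darts D" using UD by simp
  then have g: "glue D (turn U 2) \<in> darts D" "glue D (turn U 2) \<noteq> turn U 2"
    using invD glue_neq[OF invD] by simp_all
  have "glue D (turn U 2) \<noteq> U" "glue D (turn U 2) \<noteq> turn U 1"
    using gU gU1 glue_glue[OF invD, of "turn U 2"] by auto
  then have gU2: "glue D (turn U 2) = turn U 3"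
    using g same_crossing_turn[of "glue D (turn U 2)" U] UD cr by (auto simp: in_darts_iff)
  then have gU3: "glue D (turn U 3) = turn U 2" using glue_glue[OF invD] by metis
  have "D = eight U"
  proof (rule diagram_eqI[OF invD involutive_eight])
    show "crossings D = crossings (eight U)" using cr UD by simp
    show "glue D d = glue (eight U) d" if "d \<in> darts D" for d
      using that same_crossing_turn[of d U] UD cr gU gU1 gU2 gU3 by (auto simp: in_darts_iff)
  qed
  then show thesis by (rule that)
qed

context knot_weak_parity
begin

lemma eight_in_K:
  assumes "Z \<in> K" "crossings Z = {}"
  shows "eight U \<in> K"
proof (rule K_step(1)[OF assms(1) classical_eight, of "R1_inc (fst U)"])
  have "face_step (eight U) (fst U, snd U) = (fst U, snd U)" by (simp add: face_step_turn)
  then have "R1_decreasing (eight U) (fst U) Z"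
    unfolding R1_decreasing_def using assms(2)
    by (intro conjI exI[of _ "snd U"]) (simp_all add: erased_def darts_def)
  then show "realizes (R1_inc (fst U)) Z (eight U)" by simp
qed

text \<open>A diagram with two curls is an \<open>eight\<close> with one more curl in two ways. Its
  two crossings have the same parity by \<open>parity_constant\<close>, and each keeps that parity
  when the other curl is removed. Equal names are compared through a third one.\<close>

lemma eight_parity:
  assumes Z: "Z \<in> K" "crossings Z = {}"
  shows "\<psi> (eight U) (fst U) = \<psi> (eight V) (fst V)"
proof -
  have distinct: "\<psi> (eight U) (fst U) = \<psi> (eight V) (fst V)" if UV: "fst U \<noteq> fst V" for U V
  proof -
    define B where "B = add_curl (eight U) U V"
    have "fst V \<notin> crossings (eight U)" using UV by simp
    then have 1: "R1_curl (eight U) B U V"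
      unfolding B_def by (rule R1_curl_add_curl[OF involutive_eight]) (simp add: darts_eight)
    interpret B1: R1_curl "eight U" B U V by (rule 1)
    note par1 = parity_R1[OF 1 eight_in_K[OF Z]]
    have 2: "R1_curl (eight V) B (turn V 2) (turn U 2)"
    proof unfold_locales
      show "involutive (eight V)" "involutive B" by (rule involutive_eight, rule B1.invE)
      show "crossings B = insert (fst (turn U 2)) (crossings (eight V))" using B1.crossings_E by auto
      show "fst (turn U 2) \<notin> crossings (eight V)" using UV by simp
      show "turn V 2 \<in> darts (eight V)" by (simp add: in_darts_iff)
      show "glue B (turn V 2) = turn (turn U 2) 2" by simp
      show "glue B (glue (eight V) (turn V 2)) = turn (turn U 2) 3" using B1.glue_E'(5) by simp
      have "turn U 2 \<notin> {U, glue (eight U) U}" by simp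
      then show "glue B (turn U 2) = turn (turn U 2) 1"
        using B1.glue_E_old[of "turn U 2"] by (simp add: in_darts_iff)
      show "glue B z = glue (eight V) z" if "z \<in> darts (eight V)" "z \<notin> {turn V 2, glue (eight V) (turn V 2)}" for z
        using that unfolding darts_eight by auto
    qed
    have "\<psi> B (fst V) = \<psi> (eight V) (fst V)"
      using parity_R1(2)[OF 2 eight_in_K[OF Z]] by simp
    moreover have "\<psi> B (fst U) = \<psi> B (fst V)"
      using parity_constant[OF par1(1)] B1.crossings_E by simp
    ultimately show ?thesis using par1(2) by simp
  qed
  obtain n where "n \<notin> {fst U, fst V}" using ex_new_if_finite[OF infinite_UNIV_nat, of "{fst U, fst V}"] by auto
  then have "\<psi> (eight U) (fst U) = \<psi> (eight (n, 0)) n" "\<psi> (eight V) (fst V) = \<psi> (eight (n, 0)) n"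
    using distinct[of U "(n, 0)"] distinct[of V "(n, 0)"] by auto
  then show ?thesis by simp
qed

text \<open>The four outer darts of the bigon can be joined in three ways. One violates the single
  component and one Euler's formula; the third gives two curls, one of which can be removed.\<close>

lemma R2_to_unknot:
  assumes D: "D \<in> K" and Z: "Z \<in> K" "crossings Z = {}" and R2: "R2_decreasing D u v Z"
  obtains V where "fst V \<in> crossings D" "\<psi> D (fst V) = \<psi> (eight V) (fst V)"
proof -
  have invD: "involutive D" using K_involutive[OF D] .
  note gg = glue_glue[OF invD]
  obtain i j where uv: "u \<in> crossings D" "v \<in> crossings D" "u \<noteq> v"
    "face_step D (u, i) = (v, j)" "face_step D (v, j) = (u, i)" and "erased {u, v} D Z"
    using R2 by (auto simp: R2_decreasing_def)
  then have cr: "crossings D = {u, v}" using Z(2) by (auto simp: erased_def)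
  define U V :: dart where "U = (u, i)" and "V = (v, j)"
  have UV: "U \<in> darts D" "V \<in> darts D" "fst U = u" "fst V = v" using uv by (simp_all add: U_def V_def in_darts_iff)
  have neq: "turn U k \<noteq> turn V l" "turn V l \<noteq> turn U k" "U \<noteq> turn V l" "V \<noteq> turn U k" "turn V l \<noteq> U" "turn U k \<noteq> V"
    "U \<noteq> V" "V \<noteq> U" for k l
    using UV uv(3) by (metis fst_turn)+
  have g: "glue D U = turn V 1" "glue D V = turn U 1"
    using uv(4,5) by (simp_all add: face_step_turn turn_3_eq_iff U_def V_def)
  have g1: "glue D (turn V 1) = U" "glue D (turn U 1) = V" using g gg by metis+
  have darts: "d \<in> darts D \<longleftrightarrow> d \<in> {U, turn U 1, turn U 2, turn U 3, V, turn V 1, turn V 2, turn V 3}" for d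
  proof -
    have "d \<in> darts D \<longleftrightarrow> fst d = fst U \<or> fst d = fst V" using UV cr by (simp add: in_darts_iff)
    then show ?thesis using same_crossing_turn[of d U] same_crossing_turn[of d V] by auto
  qed
  have partner: "glue D d \<in> {turn U 2, turn U 3, turn V 2, turn V 3}"
    if d: "d \<in> {turn U 2, turn U 3, turn V 2, turn V 3}" for d
  proof -
    have "d \<notin> {U, turn U 1, V, turn V 1}" using d by (auto simp: neq)
    then have "glue D d \<notin> {U, turn U 1, V, turn V 1}" using gg[of d] g g1 by auto
    moreover have "glue D d \<in> darts D" using d UV invD by auto
    ultimately show ?thesis using darts[of "glue D d"] by blast
  qed
  have no_loop: "glue D d \<noteq> d" if "d \<in> {turn U 2, turn U 3, turn V 2, turn V 3}" for d
    using that UV by (intro glue_neq[OF invD]) auto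
  have U2: "glue D (turn U 2) \<in> {turn U 3, turn V 2, turn V 3}"
    using partner[of "turn U 2"] no_loop[of "turn U 2"] by simp
  have conn: "connected_diagram D" and faces: "card (orbit (face_step D) ` darts D) = 4"
    using K_classical[OF D] cr uv(3) by (auto simp: classical_diagram_iff)
  \<comment> \<open>The strand through \<open>U\<close> would close up as a component of its
    own.\<close>
  have "glue D (turn U 2) \<noteq> turn V 3"
  proof
    assume a: "glue D (turn U 2) = turn V 3"
    then have b: "glue D (turn V 3) = turn U 2" using gg by metis
    have "{U, turn U 2, turn V 1, turn V 3} = darts D"
      by (rule connected_diagramD[OF conn, of _ U]) (use UV g g1 a b in auto)
    moreover have "turn U 1 \<in> darts D" "turn U 1 \<notin> {U, turn U 2, turn V 1, turn V 3}" using UV neq by auto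
    ultimately show False by blast
  qed
  \<comment> \<open>This way gives at most two faces instead of the four that the sphere
    requires.\<close>
  moreover have "glue D (turn U 2) \<noteq> turn V 2"
  proof
    assume a: "glue D (turn U 2) = turn V 2"
    then have b: "glue D (turn V 2) = turn U 2" using gg by metis
    have "glue D (turn U 3) \<noteq> turn U 2" "glue D (turn U 3) \<noteq> turn V 2"
      using a b gg[of "turn U 3"] neq by auto
    then have c: "glue D (turn U 3) = turn V 3"
      using partner[of "turn U 3"] no_loop[of "turn U 3"] by simp
    then have d: "glue D (turn V 3) = turn U 3" using gg by metis
    let ?f = "face_step D"
    have f: "?f U = V" "?f V = U" "?f (turn U 1) = turn V 3" "?f (turn V 3) = turn U 2" "?f (turn U 2) = turn V 1"
      "?f (turn V 1) = turn U 3" "?f (turn U 3) = turn V 2" "?f (turn V 2) = turn U 1"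
      using a b c d g g1 by (simp_all add: face_step_turn)
    have fin: "finite (darts D)" "inj_on ?f (darts D)" "?f ` darts D \<subseteq> darts D"
      using involutive_finite(2)[OF invD] inj_face_step[OF invD] face_step_image[OF invD] by auto
    have step: "orbit ?f (?f d) = orbit ?f d" if "d \<in> darts D" for d
      using orbit_eq_iff[OF fin that] that invD by (metis face_step_in orbit.base)
    have "orbit ?f d \<in> {orbit ?f U, orbit ?f (turn U 1)}" if "d \<in> darts D" for d
      using that step[of U] step[of "turn U 1"] step[of "turn V 3"] step[of "turn U 2"] step[of "turn V 1"]
        step[of "turn U 3"] UV unfolding darts[of d] f by auto
    then have "card (orbit ?f ` darts D) \<le> card {orbit ?f U, orbit ?f (turn U 1)}"
      by (intro card_mono) auto
    also have "\<dots> \<le> 2" by (simp add: card_insert_if)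
    finally show False using faces by simp
  qed
  ultimately have u2: "glue D (turn U 2) = turn U 3" using U2 by blast
  then have u3: "glue D (turn U 3) = turn U 2" using gg by metis
  have v2: "glue D (turn V 2) = turn V 3"
  proof -
    have "glue D (turn V 2) \<noteq> turn U 2" "glue D (turn V 2) \<noteq> turn U 3"
      using u2 u3 gg[of "turn V 2"] neq by auto
    then show ?thesis using partner[of "turn V 2"] no_loop[of "turn V 2"] by simp
  qed
  then have v3: "glue D (turn V 3) = turn V 2" using gg by metis
  have "R1_curl (eight V) D (turn V 1) (turn U 2)"
  proof unfold_locales
    show "involutive (eight V)" "involutive D" by (rule involutive_eight, rule invD)
    show "crossings D = insert (fst (turn U 2)) (crossings (eight V))" using cr UV by simp
    show "fst (turn U 2) \<notin> crossings (eight V)" using UV uv by simp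
    show "turn V 1 \<in> darts (eight V)" by (simp add: in_darts_iff)
    show "glue D z = glue (eight V) z" if "z \<in> darts (eight V)" "z \<notin> {turn V 1, glue (eight V) (turn V 1)}" for z
      using that v2 v3 unfolding darts_eight by auto
  qed (use g g1 u2 in simp_all)
  then have "\<psi> D (fst V) = \<psi> (eight V) (fst V)"
    by (rule parity_R1(2)[OF _ eight_in_K[OF Z]]) simp
  then show thesis using that[of V] UV uv by simp
qed

text \<open>
  The diagram without crossings has no parity of its own; its part is played by the one-crossing
  diagrams obtained from it.
\<close>

definition parity_is :: "int \<Rightarrow> diagram \<Rightarrow> bool" where
  "parity_is c D \<longleftrightarrow> (\<forall>v\<in>crossings D. \<psi> D v = c) \<and>
     (crossings D = {} \<longrightarrow> (\<forall>U. \<psi> (eight U) (fst U) = c))"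

lemma parity_is_unknot:
  assumes D: "D \<in> K" "crossings D \<noteq> {}" and Z: "Z \<in> K" "crossings Z = {}"
    and "R1_decreasing D v Z \<or> R2_decreasing D u w Z"
  shows "parity_is c D \<longleftrightarrow> parity_is c Z"
proof -
  obtain V where V: "fst V \<in> crossings D" "\<psi> D (fst V) = \<psi> (eight V) (fst V)"
    using assms(5)
  proof
    assume "R1_decreasing D v Z"
    then obtain U where "D = eight U" using R1_to_unknot K_classical D Z by metis
    then show thesis using that[of U] by simp
  next
    assume "R2_decreasing D u w Z"
    then show thesis using R2_to_unknot[OF D(1) Z] that by blast
  qed
  have "parity_is c D \<longleftrightarrow> \<psi> D (fst V) = c"
    unfolding parity_is_def using parity_constant[OF D(1) _ V(1)] V(1) D(2) by blast
  moreover have "parity_is c Z \<longleftrightarrow> \<psi> (eight V) (fst V) = c"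
    unfolding parity_is_def using eight_parity[OF Z, of _ V] Z(2) by auto
  ultimately show ?thesis using V(2) by simp
qed

lemma parity_is_shared:
  assumes "D \<in> K" "D' \<in> K" "v \<in> crossings D" "v' \<in> crossings D'" "\<psi> D v = \<psi> D' v'" "parity_is c D"
  shows "parity_is c D'"
proof -
  have "\<psi> D v = c" using assms(3,6) by (simp add: parity_is_def)
  then show ?thesis
    unfolding parity_is_def using parity_constant[OF assms(2) _ assms(4)] assms(4,5) by (metis empty_iff)
qed

text \<open>A crossing outside the move carries the constant over. If there is none, the move is a
  third one, whose participants keep their parities by (\<Psi>3), or one of the diagrams has no
  crossings.\<close>

lemma parity_is_step:
  assumes D: "D \<in> K" and m: "elementary_morphism m D D'" and c: "parity_is c D"
  shows "parity_is c D'"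
proof -
  have re: "realizes m D D'" and cl: "classical_diagram D'" using m by (auto simp: elementary_morphism_def)
  have D': "D' \<in> K" using K_step(1)[OF D cl re] .
  show ?thesis
  proof (cases "crossings D = {} \<or> crossings D' = {}")
    case False
    show ?thesis
    proof (cases "\<exists>v\<in>crossings D - participants m. the (induced m D v) \<in> crossings D'")
      case True
      then obtain v where v: "v \<in> crossings D - participants m" "the (induced m D v) \<in> crossings D'" by blast
      then show ?thesis using parity_is_shared[OF D D' _ v(2) parity_0[OF D D' m v(1)] c] by blast
    next
      case none: False
      show ?thesis
      proof (cases m)
        case (Isotopy f)
        have "bij_betw f (crossings D) (crossings D')" using re Isotopy by (simp add: isotopy_def)
        then have "f v \<in> crossings D'" if "v \<in> crossings D" for v using that by (simp add: bij_betw_apply)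
        then have "crossings D = {}" using none Isotopy by auto
        then show ?thesis using False by blast
      next
        case (R3 u v w)
        then have "u \<in> crossings D" "crossings D' = crossings D" using re by (auto simp: R3_move_def Let_def)
        moreover have "\<psi> D u = \<psi> D' (the (induced m D u))"
          using weak_parity D D' m R3 unfolding weak_parity_def by blast
        ultimately show ?thesis using parity_is_shared[OF D D' _ _ _ c, of u u] R3 by simp
      next
        case (R1_dec v)
        then have "crossings D' = crossings D - {v}" using re by (auto simp: R1_decreasing_def erased_def)
        then show ?thesis using none False R1_dec by auto
      next
        case (R1_inc v)
        then have "crossings D = crossings D' - {v}" using re by (auto simp: R1_decreasing_def erased_def)
        then show ?thesis using none False R1_inc by auto
      next
        case (R2_dec u v)
        then have "crossings D' = crossings D - {u, v}" using re by (auto simp: R2_decreasing_def erased_def)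
        then show ?thesis using none False R2_dec by auto
      next
        case (R2_inc u v)
        then have "crossings D = crossings D' - {u, v}" using re by (auto simp: R2_decreasing_def erased_def)
        then show ?thesis using none False R2_inc by auto
      qed
    qed
  next
    case True
    show ?thesis
    proof (cases "crossings D = {} \<and> crossings D' = {}")
      case True
      then show ?thesis using c by (simp add: parity_is_def)
    next
      case False
      show ?thesis
      proof (cases m)
        case (Isotopy f)
        then have "bij_betw f (crossings D) (crossings D')" using re by (simp add: isotopy_def)
        then show ?thesis using True False by (auto simp: bij_betw_def)
      next
        case (R3 u v w)
        then show ?thesis using re True False by (auto simp: R3_move_def Let_def)
      next
        case (R1_dec v)
        then have "R1_decreasing D v D'" "crossings D \<noteq> {}" "crossings D' = {}"
          using re True by (auto simp: R1_decreasing_def)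
        then show ?thesis using parity_is_unknot D D' c by blast
      next
        case (R1_inc v)
        then have "R1_decreasing D' v D" "crossings D' \<noteq> {}" "crossings D = {}"
          using re True by (auto simp: R1_decreasing_def)
        then show ?thesis using parity_is_unknot D D' c by blast
      next
        case (R2_dec u v)
        then have "R2_decreasing D u v D'" "crossings D \<noteq> {}" "crossings D' = {}"
          using re True by (auto simp: R2_decreasing_def)
        then show ?thesis using parity_is_unknot D D' c by blast
      next
        case (R2_inc u v)
        then have "R2_decreasing D' u v D" "crossings D' \<noteq> {}" "crossings D = {}"
          using re True by (auto simp: R2_decreasing_def)
        then show ?thesis using parity_is_unknot D D' c by blast
      qed
    qed
  qed
qed

lemma parity_is_morphism:
  "diagram_morphism D ms D' \<Longrightarrow> D \<in> K \<Longrightarrow> parity_is c D \<Longrightarrow> parity_is c D'"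
proof (induction rule: diagram_morphism.induct)
  case (Cons m D D' ms D'')
  have "D' \<in> K" using K_step(1)[OF Cons.prems(1)] Cons.hyps(1) by (auto simp: elementary_morphism_def)
  then show ?case using Cons.IH parity_is_step[OF Cons.prems(1) Cons.hyps(1) Cons.prems(2)] by blast
qed

lemma parity_is_somewhere:
  assumes "D \<in> K"
  obtains c where "c \<in> {0, 1}" "parity_is c D"
proof (cases "crossings D = {}")
  case True
  let ?c = "\<psi> (eight (0, 0)) 0"
  have "?c \<in> {0, 1}" using parity_values[OF eight_in_K[OF assms True]] by force
  moreover have "parity_is ?c D"
    unfolding parity_is_def using eight_parity[OF assms True, of _ "(0, 0)"] True by simp
  ultimately show thesis by (rule that)
next
  case False
  then obtain v where v: "v \<in> crossings D" by blast
  then show thesis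
    using that[of "\<psi> D v"] parity_values[OF assms v] parity_constant[OF assms _ v]
    unfolding parity_is_def by blast
qed

end

theorem mainTheorem3:
  fixes K :: "diagram set" and \<psi> :: "diagram \<Rightarrow> nat \<Rightarrow> int"
  assumes "K \<in> classical_knots"
    and "weak_parity K \<psi>"
  shows "(\<forall>D\<in>K. \<forall>v\<in>crossings D. \<psi> D v = 0) \<or> (\<forall>D\<in>K. \<forall>v\<in>crossings D. \<psi> D v = 1)"
proof -
  interpret knot_weak_parity K \<psi> by unfold_locales (rule assms)+
  obtain D0 where D0: "classical_diagram D0" "K = {D'. \<exists>ms. diagram_morphism D0 ms D'}" by (rule K_reachable)
  then have "D0 \<in> K" by (auto intro: diagram_morphism.Nil)
  then obtain c where c: "c \<in> {0, 1}" "parity_is c D0" by (rule parity_is_somewhere)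
  have "\<psi> D v = c" if "D \<in> K" "v \<in> crossings D" for D v
    using parity_is_morphism[OF _ \<open>D0 \<in> K\<close> c(2)] that D0(2) by (auto simp: parity_is_def)
  then show ?thesis using c(1) by auto
qed

end
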